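(* Let $A=A_n$, $\Phi$, $E_\Phi$ and the limit Gaussian processes $B$, $C$ be as described in the context. If the function $\Phi(z)$ is not linear in $z$, then for any fixed $s\in(0,1)$, the covariance of the process $(B_{s,t})_{t\in E_\Phi}$ (hence also that of $(C_{s,\lambda})_{\lambda\in\mathbb R}$) is not identically null.
   Context: Notation: $\mathbb C^{\pm}$ are the open upper/lower half planes; powers are defined on $\mathbb C\setminus\mathbb R_-$ with argument in $(-\pi,\pi)$. Hypothesis on the matrices. For each $n\ge 1$, $A=A_n=[a_{ij}]$ is an $n\times n$ real symmetric random matrix whose sub-diagonal entries $(a_{ij})_{i\ge j}$ (diagonal included) are i.i.d. copies of a real random variable $a$ (depending implicitly on $n$) such that: (i) $a=b+c$ where, as $n\to\infty$, $n\,\mathbb P(c\neq 0)\to 0$ and $n^{1/2}\operatorname{Var}(b)\to 0$; moreover, if the $b_i$ are independent copies of $b$, $\lim_{K\to\infty}\lim_{n\to\infty}\mathbb P\big(\sum_{i=1}^n(b_i-\mathbb E b_i)^2\ge K\big)=0$. (ii) For any $\varepsilon>0$ independent of $n$, $a$ can be decomposed as $a=b_\varepsilon+c_\varepsilon$ with $\limsup_{n}n\,\mathbb P(c_\varepsilon\ne0)\le\varepsilon$ and, for all $k\ge1$, $n\mathbb E[(b_\varepsilon-\mathbb E b_\varepsilon)^{2k}]$ has a finite limit as $n\to\infty$. (iii) With $\phi_n(\lambda):=\mathbb E[\exp(-i\lambda a^2)]$ for $\lambda\in\overline{\mathbb C^-}$, $n(\phi_n(\lambda)-1)\to\Phi(\lambda)$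 uniformly on compact subsets of $\overline{\mathbb C^-}$, for a certain function $\Phi$ on $\overline{\mathbb C^-}$. (iv) $\Phi(z)=\int_0^\infty g(y)e^{iy/z}\,dy$ for $z\in\mathbb C^-$, where for some constants $K$, $\gamma>-1$, $\kappa\ge0$, $|g(y)|\le K\mathbf 1_{y\le1}y^\gamma+K\mathbf 1_{y\ge1}y^\kappa$ for all $y>0$. (v) Either $\Phi(x)=-\sigma(ix)^{\alpha/2}$ for some $\sigma>0$, $\alpha\in(0,2)$; or for $x,y\in\mathbb C^-$, $$\Phi(x+y)=\iint_{(\mathbb R_+)^2}e^{i\frac vx+i\frac{v'}y}d\tau(v,v')+\int_{\mathbb R_+}e^{i\frac vx}d\mu(v)+\int_{\mathbb R_+}e^{i\frac{v'}y}d\mu(v')$$ for some complex measures $\tau,\mu$ on $(\mathbb R_+)^2$ and $\mathbb R_+$ such that $\int e^{-bv}d|\mu|(v)<\infty$ for all $b>0$ and, for some constants $K>0$, $-1<\gamma\le0$, $\kappa\ge0$, $$\frac{d|\tau|(v,v')}{dv\,dv'}\le K\big(v^\gamma\mathbf 1_{v\in]0,1]}+v^\kappa\mathbf 1_{v\in]1,\infty[}\big)\big(v'^\gamma\mathbf 1_{v'\in]0,1]}+v'^\kappa\mathbf 1_{v'\in]1,\infty[}\big).$$ Limiting spectral law. It is known that under this hypothesis the empirical spectral law $\mu_n:=\frac1n\sum_{j=1}^n\delta_{\lambda_j}$ of $A$ converges weakly in probability to a deterministic probability measure $\mu_\Phi$ depending only on $\Phi$. Set $F_{\mu_\Phi}(\lambda):=\mu_\Phi((-\infty,\lambda])$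 and $E_\Phi:=\{0\}\cup F_{\mu_\Phi}(\mathbb R)\cup\{1\}\subset[0,1]$. Processes. Let $\lambda_1\le\cdots\le\lambda_n$ be the eigenvalues of $A$ and $U=[u_{ij}]$ an orthogonal matrix with $A=U\operatorname{diag}(\lambda_1,\dots,\lambda_n)U^*$, chosen so that the rows of $[|u_{ij}|]$ are exchangeable. For $s,t\in[0,1]$, $\lambda\in\mathbb R$, $$B^n_{s,t}:=\frac1{\sqrt n}\sum_{1\le i\le ns,\ 1\le j\le nt}\Big(|u_{ij}|^2-\frac1n\Big),\qquad C^n_{s,\lambda}:=\frac1{\sqrt n}\sum_{1\le i\le ns}\ \sum_{1\le j\le n:\ \lambda_j\le\lambda}\Big(|u_{ij}|^2-\frac1n\Big).$$ Limit processes. As $n\to\infty$, the joint distribution of $(B^n_{s,t})_{(s,t)\in[0,1]\times E_\Phi}$ and $(C^n_{s,\lambda})_{(s,\lambda)\in[0,1]\times\mathbb R}$ converges weakly, for the Skorokhod topologies, to the joint distribution of centered Gaussian processes $(B_{s,t})_{(s,t)\in[0,1]\times E_\Phi}$ and $(C_{s,\lambda})_{(s,\lambda)\in[0,1]\times\mathbb R}$ vanishing on the boundaries of their domains, with $B$ continuous and $B_{s,F_{\mu_\Phi}(\lambda)}=C_{s,\lambda}$ for all $s\in[0,1]$, $\lambda\in\mathbb R$. These are the processes $B$ and $C$ of the claim. *)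

theory Defs
  imports "HOL-Probability.Probability" "Jordan_Normal_Form.Matrix"
begin

section \<open>Hypotheses on the law of the entries\<close>

text \<open>
  Only the law \<open>\<nu>\<close> of the entry \<open>a\<close> matters.  A decomposition \<open>a = b + c\<close> is a joint law
  \<open>\<beta>\<close> of a pair \<open>(b, c)\<close> whose sum has law \<open>\<nu>\<close>; thus \<open>fst\<close> and \<open>snd\<close> are the random
  variables \<open>b\<close> and \<open>c\<close>, defined on the probability space \<open>\<beta>\<close>.
\<close>

definition additive_decomposition :: "real measure \<Rightarrow> (real \<times> real) measure \<Rightarrow> bool" where
  "additive_decomposition \<nu> \<beta> \<longleftrightarrow>
     prob_space \<beta> \<and> sets \<beta> = sets borel \<and> distr \<beta> borel (\<lambda>p. fst p + snd p) = \<nu>"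

text \<open>The coordinates of the product measure \<open>P\<close> are independent copies of \<open>b\<close>.\<close>

definition tight_truncation :: "(nat \<Rightarrow> real measure) \<Rightarrow> bool" where
  "tight_truncation \<nu> \<longleftrightarrow>
     (\<exists>\<beta>. (\<forall>n\<ge>1. additive_decomposition (\<nu> n) (\<beta> n)) \<and>
        (\<lambda>n. real n * measure (\<beta> n) {p \<in> space (\<beta> n). snd p \<noteq> 0}) \<longlonglongrightarrow> 0 \<and>
        (\<forall>\<^sub>F n in sequentially. integrable (\<beta> n) (\<lambda>p. (fst p)\<^sup>2)) \<and>
        (\<lambda>n. sqrt (real n) * prob_space.variance (\<beta> n) fst) \<longlonglongrightarrow> 0 \<and>
        (\<exists>L :: real \<Rightarrow> real.
           (\<forall>\<^sub>F K in at_top.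
              (\<lambda>n. let P = Pi\<^sub>M {..<n} (\<lambda>_. distr (\<beta> n) borel fst) in
                   measure P {x \<in> space P.
                     (\<Sum>i<n. (x i - prob_space.expectation (\<beta> n) fst)\<^sup>2) \<ge> K}) \<longlonglongrightarrow> L K) \<and>
           (L \<longlongrightarrow> 0) at_top))"

definition moment_truncations :: "(nat \<Rightarrow> real measure) \<Rightarrow> bool" where
  "moment_truncations \<nu> \<longleftrightarrow>
     (\<forall>\<epsilon>>0. \<exists>\<beta>. (\<forall>n\<ge>1. additive_decomposition (\<nu> n) (\<beta> n)) \<and>
        limsup (\<lambda>n. ereal (real n * measure (\<beta> n) {p \<in> space (\<beta> n). snd p \<noteq> 0})) \<le> ereal \<epsilon> \<and>
        (\<forall>k\<ge>1. (\<forall>\<^sub>F n in sequentially. integrable (\<beta> n) (\<lambda>p. (fst p) ^ (2 * k))) \<and>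
           convergent (\<lambda>n. real n * prob_space.expectation (\<beta> n)
             (\<lambda>p. (fst p - prob_space.expectation (\<beta> n) fst) ^ (2 * k)))))"

abbreviation lower_half_plane :: "complex set" where
  "lower_half_plane \<equiv> {z. Im z < 0}"

abbreviation closed_lower_half_plane :: "complex set" where
  "closed_lower_half_plane \<equiv> {z. Im z \<le> 0}"

definition laplace_square :: "real measure \<Rightarrow> complex \<Rightarrow> complex" where
  "laplace_square \<nu> l = (LINT x|\<nu>. exp (- (\<i> * l * complex_of_real (x\<^sup>2))))"

definition has_limit_exponent :: "(nat \<Rightarrow> real measure) \<Rightarrow> (complex \<Rightarrow> complex) \<Rightarrow> bool" where
  "has_limit_exponent \<nu> \<Phi> \<longleftrightarrow>
     (\<forall>K. compact K \<and> K \<subseteq> closed_lower_half_plane \<longrightarrow>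
        uniform_limit K (\<lambda>n l. of_nat n * (laplace_square (\<nu> n) l - 1)) \<Phi> sequentially)"

definition integral_representation :: "(complex \<Rightarrow> complex) \<Rightarrow> bool" where
  "integral_representation \<Phi> \<longleftrightarrow>
     (\<exists>(g :: real \<Rightarrow> complex) K \<gamma> \<kappa>.
        g \<in> borel_measurable borel \<and> \<gamma> > -1 \<and> \<kappa> \<ge> 0 \<and>
        (\<forall>y>0. norm (g y) \<le> K * indicator {..1} y * y powr \<gamma> + K * indicator {1..} y * y powr \<kappa>) \<and>
        (\<forall>z\<in>lower_half_plane.
           \<Phi> z = (LINT y:{0<..}|lborel. g y * exp (\<i> * complex_of_real y / z))))"

text \<open>
  The complex measures in the addition formula for \<open>\<Phi>\<close> may have infinite total mass (only exponentially damped
  integrals against them are finite), so they are given by their polar decomposition: a positive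
  measure \<open>m\<close> (the total variation measure) and a phase \<open>h\<close> of modulus 1.  The complex measure
  is \<open>h dm\<close>, so that an integral of \<open>f\<close> against it is \<open>LINT x|m. h x * f x\<close>.
\<close>

definition complex_measure_on :: "'a::topological_space set \<Rightarrow> 'a measure \<Rightarrow> ('a \<Rightarrow> complex) \<Rightarrow> bool" where
  "complex_measure_on S m h \<longleftrightarrow>
     sets m = sets borel \<and> emeasure m (- S) = 0 \<and> h \<in> borel_measurable borel \<and> (\<forall>x. norm (h x) = 1)"

definition power_weight :: "real \<Rightarrow> real \<Rightarrow> real \<Rightarrow> real" where
  "power_weight \<gamma> \<kappa> v = v powr \<gamma> * indicator {0<..1} v + v powr \<kappa> * indicator {1<..} v"

definition stable_exponent :: "(complex \<Rightarrow> complex) \<Rightarrow> bool" where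
  "stable_exponent \<Phi> \<longleftrightarrow>
     (\<exists>(\<sigma>::real) (\<alpha>::real). \<sigma> > 0 \<and> 0 < \<alpha> \<and> \<alpha> < 2 \<and>
        (\<forall>x\<in>lower_half_plane.
           \<Phi> x = - (complex_of_real \<sigma> * (\<i> * x) powr complex_of_real (\<alpha> / 2))))"

definition addition_formula :: "(complex \<Rightarrow> complex) \<Rightarrow> bool" where
  "addition_formula \<Phi> \<longleftrightarrow>
     (\<exists>(\<tau> :: (real \<times> real) measure) h\<^sub>\<tau> (\<mu> :: real measure) h\<^sub>\<mu>.
        complex_measure_on ({0..} \<times> {0..}) \<tau> h\<^sub>\<tau> \<and> complex_measure_on {0..} \<mu> h\<^sub>\<mu> \<and>
        (\<forall>b>0. integrable \<mu> (\<lambda>v. exp (- (b * v)))) \<and>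
        (\<exists>K \<gamma> \<kappa> \<rho>. K > 0 \<and> -1 < \<gamma> \<and> \<gamma> \<le> 0 \<and> \<kappa> \<ge> 0 \<and>
           \<rho> \<in> borel_measurable borel \<and> \<tau> = density lborel \<rho> \<and>
           (\<forall>v v'. \<rho> (v, v') \<le> ennreal (K * power_weight \<gamma> \<kappa> v * power_weight \<gamma> \<kappa> v'))) \<and>
        (\<forall>x\<in>lower_half_plane. \<forall>y\<in>lower_half_plane.
           \<Phi> (x + y) =
             (LINT p|\<tau>. h\<^sub>\<tau> p * exp (\<i> * complex_of_real (fst p) / x + \<i> * complex_of_real (snd p) / y))
             + (LINT v|\<mu>. h\<^sub>\<mu> v * exp (\<i> * complex_of_real v / x))
             + (LINT v|\<mu>. h\<^sub>\<mu> v * exp (\<i> * complex_of_real v / y))))"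

definition entry_hypothesis :: "(nat \<Rightarrow> real measure) \<Rightarrow> (complex \<Rightarrow> complex) \<Rightarrow> bool" where
  "entry_hypothesis \<nu> \<Phi> \<longleftrightarrow>
     (\<forall>n\<ge>1. real_distribution (\<nu> n)) \<and>
     tight_truncation \<nu> \<and> moment_truncations \<nu> \<and> has_limit_exponent \<nu> \<Phi> \<and>
     integral_representation \<Phi> \<and> (stable_exponent \<Phi> \<or> addition_formula \<Phi>)"

text \<open>The exponent is only meaningful on the closed lower half plane.\<close>

definition linear_exponent :: "(complex \<Rightarrow> complex) \<Rightarrow> bool" where
  "linear_exponent \<Phi> \<longleftrightarrow> (\<exists>c. \<forall>z\<in>closed_lower_half_plane. \<Phi> z = c * z)"


section \<open>The matrix model and its spectral data\<close>

text \<open>Matrix indices start from 0, so that the index \<open>i\<close> stands for the row number \<open>i + 1\<close>.\<close>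

definition iid_symmetric_matrix ::
    "'w measure \<Rightarrow> nat \<Rightarrow> real measure \<Rightarrow> ('w \<Rightarrow> real mat) \<Rightarrow> bool" where
  "iid_symmetric_matrix M n \<nu> A \<longleftrightarrow>
     prob_space M \<and>
     (\<forall>\<omega>\<in>space M. A \<omega> \<in> carrier_mat n n \<and> transpose_mat (A \<omega>) = A \<omega>) \<and>
     prob_space.indep_vars M (\<lambda>_. borel) (\<lambda>(i, j) \<omega>. A \<omega> $$ (i, j)) {(i, j). j \<le> i \<and> i < n} \<and>
     (\<forall>i j. j \<le> i \<and> i < n \<longrightarrow> distr M borel (\<lambda>\<omega>. A \<omega> $$ (i, j)) = \<nu>)"

definition ordered_eigendecomposition ::
    "nat \<Rightarrow> real mat \<Rightarrow> real mat \<Rightarrow> (nat \<Rightarrow> real) \<Rightarrow> bool" where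
  "ordered_eigendecomposition n A U l \<longleftrightarrow>
     U \<in> carrier_mat n n \<and> U * transpose_mat U = 1\<^sub>m n \<and> mono_on {..<n} l \<and>
     A = U * mat n n (\<lambda>(i, j). if i = j then l j else 0) * transpose_mat U"

definition abs_rows_exchangeable :: "'w measure \<Rightarrow> nat \<Rightarrow> ('w \<Rightarrow> real mat) \<Rightarrow> bool" where
  "abs_rows_exchangeable M n U \<longleftrightarrow>
     (\<forall>i<n. \<forall>j<n. (\<lambda>\<omega>. U \<omega> $$ (i, j)) \<in> borel_measurable M) \<and>
     (\<forall>\<pi>. \<pi> permutes {..<n} \<longrightarrow>
        distr M (Pi\<^sub>M ({..<n} \<times> {..<n}) (\<lambda>_. borel))
          (\<lambda>\<omega>. \<lambda>(i, j)\<in>{..<n} \<times> {..<n}. \<bar>U \<omega> $$ (\<pi> i, j)\<bar>) =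
        distr M (Pi\<^sub>M ({..<n} \<times> {..<n}) (\<lambda>_. borel))
          (\<lambda>\<omega>. \<lambda>(i, j)\<in>{..<n} \<times> {..<n}. \<bar>U \<omega> $$ (i, j)\<bar>))"

text \<open>Weak convergence in probability of the random measures \<open>(1/n) \<Sum>\<^sub>j \<delta>(l n \<omega> j)\<close> to \<open>\<mu>\<close>.\<close>

definition spectral_law_converges ::
    "(nat \<Rightarrow> 'w measure) \<Rightarrow> (nat \<Rightarrow> 'w \<Rightarrow> nat \<Rightarrow> real) \<Rightarrow> real measure \<Rightarrow> bool" where
  "spectral_law_converges M l \<mu> \<longleftrightarrow>
     (\<forall>f :: real \<Rightarrow> real. continuous_on UNIV f \<and> bounded (range f) \<longrightarrow>
        (\<forall>\<epsilon>>0. (\<lambda>n. measure (M n)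
            {\<omega> \<in> space (M n). \<bar>(\<Sum>j<n. f (l n \<omega> j)) / real n - (LINT x|\<mu>. f x)\<bar> > \<epsilon>}) \<longlonglongrightarrow> 0))"

definition spectral_levels :: "real measure \<Rightarrow> real set" where
  "spectral_levels \<mu> = {0} \<union> range (cdf \<mu>) \<union> {1}"

definition process_B :: "nat \<Rightarrow> real mat \<Rightarrow> real \<times> real \<Rightarrow> real" where
  "process_B n U = (\<lambda>(s, t). 1 / sqrt (real n) *
     (\<Sum>i | i < n \<and> real (Suc i) \<le> real n * s. \<Sum>j | j < n \<and> real (Suc j) \<le> real n * t.
        (\<bar>U $$ (i, j)\<bar>\<^sup>2 - 1 / real n)))"

definition process_C :: "nat \<Rightarrow> real mat \<Rightarrow> (nat \<Rightarrow> real) \<Rightarrow> real \<times> real \<Rightarrow> real" where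
  "process_C n U l = (\<lambda>(s, x). 1 / sqrt (real n) *
     (\<Sum>i | i < n \<and> real (Suc i) \<le> real n * s. \<Sum>j | j < n \<and> l j \<le> x.
        (\<bar>U $$ (i, j)\<bar>\<^sup>2 - 1 / real n)))"


section \<open>Skorokhod topologies and weak convergence\<close>

text \<open>
  The cadlag functions of two parameters on \<open>S \<times> T\<close>: in each of the four
  quadrants with corner \<open>(s\<^sub>0, t\<^sub>0)\<close> given by \<open><\<close> or \<open>\<ge>\<close> in each coordinate the limit at the
  corner exists, and it equals the value at the corner for the quadrant containing it.  A limit along an
  empty or trivial quadrant is vacuous.
\<close>

definition cadlag2 :: "real set \<Rightarrow> real set \<Rightarrow> (real \<times> real \<Rightarrow> real) set" where
  "cadlag2 S T = {f \<in> extensional (S \<times> T). \<forall>s\<^sub>0\<in>S. \<forall>t\<^sub>0\<in>T.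
     (f \<longlongrightarrow> f (s\<^sub>0, t\<^sub>0)) (at (s\<^sub>0, t\<^sub>0) within (S \<inter> {s\<^sub>0..}) \<times> (T \<inter> {t\<^sub>0..})) \<and>
     (\<exists>y. (f \<longlongrightarrow> y) (at (s\<^sub>0, t\<^sub>0) within (S \<inter> {..<s\<^sub>0}) \<times> (T \<inter> {t\<^sub>0..}))) \<and>
     (\<exists>y. (f \<longlongrightarrow> y) (at (s\<^sub>0, t\<^sub>0) within (S \<inter> {s\<^sub>0..}) \<times> (T \<inter> {..<t\<^sub>0}))) \<and>
     (\<exists>y. (f \<longlongrightarrow> y) (at (s\<^sub>0, t\<^sub>0) within (S \<inter> {..<s\<^sub>0}) \<times> (T \<inter> {..<t\<^sub>0})))}"

definition time_change :: "real set \<Rightarrow> real \<Rightarrow> (real \<Rightarrow> real) \<Rightarrow> bool" where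
  "time_change S \<epsilon> \<rho> \<longleftrightarrow> strict_mono_on S \<rho> \<and> bij_betw \<rho> S S \<and> (\<forall>s\<in>S. \<bar>\<rho> s - s\<bar> < \<epsilon>)"

text \<open>
  Basic Skorokhod neighbourhood: after time changes uniformly \<open>\<epsilon>\<close>-close to the identity in each
  coordinate, \<open>g\<close> is \<open>\<epsilon>\<close>-close to \<open>f\<close> on the part of \<open>S \<times> T\<close> in the square \<open>[-N, N]\<^sup>2\<close>.  If
  \<open>S\<close> and \<open>T\<close> are bounded, this is uniform closeness for large \<open>N\<close> (the usual J1 topology); for
  unbounded \<open>T\<close> it is locally uniform closeness, as in the topology of Skorokhod, Lindvall and
  Jacod-Shiryaev on unbounded parameter sets.
\<close>

definition skorokhod_nbhd ::
    "real set \<Rightarrow> real set \<Rightarrow> real \<Rightarrow> real \<Rightarrow> (real \<times> real \<Rightarrow> real) \<Rightarrow> (real \<times> real \<Rightarrow> real) set" where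
  "skorokhod_nbhd S T \<epsilon> N f = {g \<in> cadlag2 S T.
     \<exists>\<rho> \<theta>. time_change S \<epsilon> \<rho> \<and> time_change T \<epsilon> \<theta> \<and>
       (\<forall>s\<in>S. \<forall>t\<in>T. \<bar>s\<bar> \<le> N \<and> \<bar>t\<bar> \<le> N \<longrightarrow> \<bar>g (\<rho> s, \<theta> t) - f (s, t)\<bar> < \<epsilon>)}"

definition skorokhod_open :: "real set \<Rightarrow> real set \<Rightarrow> (real \<times> real \<Rightarrow> real) set \<Rightarrow> bool" where
  "skorokhod_open S T V \<longleftrightarrow> V \<subseteq> cadlag2 S T \<and> (\<forall>f\<in>V. \<exists>\<epsilon>>0. \<exists>N. skorokhod_nbhd S T \<epsilon> N f \<subseteq> V)"

definition skorokhod_topology :: "real set \<Rightarrow> real set \<Rightarrow> (real \<times> real \<Rightarrow> real) topology" where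
  "skorokhod_topology S T = topology (skorokhod_open S T)"

lemma skorokhod_nbhd_mono:
  assumes "\<epsilon> \<le> \<epsilon>'" "N' \<le> N"
  shows "skorokhod_nbhd S T \<epsilon> N f \<subseteq> skorokhod_nbhd S T \<epsilon>' N' f"
  using assms unfolding skorokhod_nbhd_def time_change_def
  by (smt (verit, ccfv_threshold) Collect_mono)

lemma istopology_skorokhod: "istopology (skorokhod_open S T)"
proof -
  have "skorokhod_open S T (V \<inter> W)" if V: "skorokhod_open S T V" and W: "skorokhod_open S T W" for V W
    unfolding skorokhod_open_def
  proof (intro conjI ballI)
    show "V \<inter> W \<subseteq> cadlag2 S T"
      using V by (auto simp: skorokhod_open_def)
    fix f assume f: "f \<in> V \<inter> W"
    obtain e N where 1: "e > 0" "skorokhod_nbhd S T e N f \<subseteq> V"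
      using V f by (auto simp: skorokhod_open_def)
    obtain e' N' where 2: "e' > 0" "skorokhod_nbhd S T e' N' f \<subseteq> W"
      using W f by (auto simp: skorokhod_open_def)
    have "skorokhod_nbhd S T (min e e') (max N N') f \<subseteq> V \<inter> W"
      using 1 2 skorokhod_nbhd_mono[of "min e e'" e N "max N N'" S T f]
        skorokhod_nbhd_mono[of "min e e'" e' N' "max N N'" S T f] by auto
    then show "\<exists>\<epsilon>>0. \<exists>N. skorokhod_nbhd S T \<epsilon> N f \<subseteq> V \<inter> W"
      using 1 2 by (intro exI[of _ "min e e'"] conjI exI[of _ "max N N'"]) auto
  qed
  moreover have "skorokhod_open S T (\<Union>\<K>)" if "\<forall>V\<in>\<K>. skorokhod_open S T V" for \<K>
    using that unfolding skorokhod_open_def by (meson Sup_least Sup_upper UnionE order_trans)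
  ultimately show ?thesis
    unfolding istopology_def by blast
qed

lemma openin_skorokhod: "openin (skorokhod_topology S T) V \<longleftrightarrow> skorokhod_open S T V"
  unfolding skorokhod_topology_def by (simp add: istopology_skorokhod topology_inverse')

lemma topspace_skorokhod: "topspace (skorokhod_topology S T) = cadlag2 S T"
proof -
  have "skorokhod_open S T (cadlag2 S T)"
    unfolding skorokhod_open_def skorokhod_nbhd_def by (auto intro: exI[of _ "1::real"])
  then show ?thesis
    unfolding topspace_def openin_skorokhod by (auto simp: skorokhod_open_def)
qed

definition borel_sigma :: "'a topology \<Rightarrow> 'a measure" where
  "borel_sigma X = sigma (topspace X) {V. openin X V}"

definition converges_in_law ::
    "'a topology \<Rightarrow> (nat \<Rightarrow> 'w measure) \<Rightarrow> (nat \<Rightarrow> 'w \<Rightarrow> 'a) \<Rightarrow> 'v measure \<Rightarrow> ('v \<Rightarrow> 'a) \<Rightarrow> bool" where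
  "converges_in_law X M x N y \<longleftrightarrow>
     (\<forall>n\<ge>1. x n \<in> M n \<rightarrow>\<^sub>M borel_sigma X) \<and> y \<in> N \<rightarrow>\<^sub>M borel_sigma X \<and>
     (\<forall>f. continuous_map X euclideanreal f \<and> bounded (f ` topspace X) \<longrightarrow>
        (\<lambda>n. LINT \<omega>|M n. f (x n \<omega>)) \<longlonglongrightarrow> (LINT \<omega>|N. f (y \<omega>)))"


section \<open>Gaussian processes and covariance\<close>

text \<open>Degenerate Gaussian laws (Dirac mass at 0) are allowed.\<close>

definition centered_gaussian_process :: "'v measure \<Rightarrow> 'i set \<Rightarrow> ('v \<Rightarrow> 'i \<Rightarrow> real) \<Rightarrow> bool" where
  "centered_gaussian_process N I X \<longleftrightarrow>
     (\<forall>i\<in>I. (\<lambda>\<omega>. X \<omega> i) \<in> borel_measurable N) \<and>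
     (\<forall>J c. finite J \<and> J \<subseteq> I \<longrightarrow>
        (\<exists>\<sigma>>0. distributed N lborel (\<lambda>\<omega>. \<Sum>i\<in>J. c i * X \<omega> i) (normal_density 0 \<sigma>)) \<or>
        (AE \<omega> in N. (\<Sum>i\<in>J. c i * X \<omega> i) = 0))"

definition covariance :: "'v measure \<Rightarrow> ('v \<Rightarrow> real) \<Rightarrow> ('v \<Rightarrow> real) \<Rightarrow> real" where
  "covariance N X Y = (LINT \<omega>|N. (X \<omega> - (LINT \<omega>'|N. X \<omega>')) * (Y \<omega> - (LINT \<omega>'|N. Y \<omega>')))"

definition limit_processes ::
    "(nat \<Rightarrow> 'w measure) \<Rightarrow> (nat \<Rightarrow> 'w \<Rightarrow> real mat) \<Rightarrow> (nat \<Rightarrow> 'w \<Rightarrow> nat \<Rightarrow> real) \<Rightarrow> real measure \<Rightarrow>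
     'v measure \<Rightarrow> ('v \<Rightarrow> real \<times> real \<Rightarrow> real) \<Rightarrow> ('v \<Rightarrow> real \<times> real \<Rightarrow> real) \<Rightarrow> bool" where
  "limit_processes M U l \<mu> N B C \<longleftrightarrow>
     (let E = spectral_levels \<mu> in
      prob_space N \<and>
      converges_in_law
        (prod_topology (skorokhod_topology {0..1} E) (skorokhod_topology {0..1} UNIV))
        M (\<lambda>n \<omega>. (restrict (process_B n (U n \<omega>)) ({0..1} \<times> E),
                  restrict (process_C n (U n \<omega>) (l n \<omega>)) ({0..1} \<times> UNIV)))
        N (\<lambda>\<omega>. (B \<omega>, C \<omega>)) \<and>
      centered_gaussian_process N ({0..1} \<times> E) B \<and>
      centered_gaussian_process N ({0..1} \<times> UNIV) C \<and>
      (AE \<omega> in N. continuous_on ({0..1} \<times> E) (B \<omega>)) \<and>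
      (AE \<omega> in N. \<forall>t\<in>E. B \<omega> (0, t) = 0 \<and> B \<omega> (1, t) = 0) \<and>
      (AE \<omega> in N. \<forall>s\<in>{0..1}. B \<omega> (s, 0) = 0 \<and> B \<omega> (s, 1) = 0) \<and>
      (AE \<omega> in N. \<forall>x. C \<omega> (0, x) = 0 \<and> C \<omega> (1, x) = 0) \<and>
      (AE \<omega> in N. \<forall>s\<in>{0..1}. \<forall>x. B \<omega> (s, cdf \<mu> x) = C \<omega> (s, x)))"

end

theory Submission
  imports Defs "Jordan_Normal_Form.Determinant"
begin

text \<open>
  The processes are centered Gaussian and \<open>B (s, F x) = C (s, x)\<close>, so if one of the two
  covariances vanished at \<open>s\<close>, then \<open>B (s, t) = 0\<close> almost surely for every level \<open>t\<close>.  It is to be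
  shown that \<open>\<Phi>\<close> is then linear.

  The value at \<open>(s, t)\<close> is not a continuous function for
  the Skorokhod topology, but it is dominated by a supremum weighted with a bump around \<open>(s, t)\<close>, which is
  continuous and which is small at the continuous function \<open>B\<close>.  Hence \<open>B\<^sup>n (s, t) \<rightarrow> 0\<close> in probability
  (\<open>process_B_null\<close>).  Now \<open>B\<^sup>n (s, t)\<close> is \<open>1 / sqrt n\<close> times the sum of about \<open>n s\<close> entries of an exchangeable
  vector \<open>d\<close> of total sum 0, where \<open>d\<^sub>i\<close> measures by how much the mass of the row \<open>i\<close> of \<open>U\<close> on the first
  \<open>n t\<close> columns differs from its mean.  Exchanging some of the summands with entries outside of the sum does
  not change the law of the sum; averaging over the choice of the exchanged entries shows that a sum
  which tends to 0 forces \<open>E d\<^sub>0\<^sup>2 \<rightarrow> 0\<close> (\<open>exchangeable_second_moment\<close>).  Therefore the spectral measure of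
  the matrix \<open>A\<close> at the first basis vector tends to the deterministic limiting spectral law, and the
  entry \<open>(\<i> - A)\<^sup>-\<^sup>1\<^sub>0\<^sub>0\<close> of the resolvent becomes deterministic (\<open>row_average_L1\<close>).

  Let \<open>r\<close> be the first row of \<open>A\<close> without its diagonal entry,
  \<open>A'\<close> the matrix \<open>A\<close> without its first row and column, and \<open>R = (1 + A'\<^sup>2)\<^sup>-\<^sup>1\<close>.  The imaginary part of
  the Schur complement formula says that \<open>\<rho> = \<langle>r, R r\<rangle>\<close> is a function of the entry \<open>0, 0\<close> of the
  resolvent (\<open>schur_identity\<close>), so \<open>\<rho>\<close> becomes deterministic.  Here \<open>R\<close> is independent of \<open>r\<close>.
  Given \<open>R\<close>, the off-diagonal part of \<open>\<rho>\<close> is close to a constant (\<open>offdiag_error_decomposition\<close>), and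
  hence so is the diagonal part \<open>W = (\<Sum>k. R\<^sub>k\<^sub>k r\<^sub>k\<^sup>2)\<close>.  But \<open>exp (- W)\<close> is a product of independent
  factors, and its variance dominates, up to a constant factor, the sum of the variances of the factors.  The weights \<open>R\<^sub>k\<^sub>k\<close>
  have means bounded away from 0, and it follows that \<open>n E (1 - exp (- a\<^sup>2))\<^sup>2 \<rightarrow> 0\<close> for an
  entry \<open>a\<close> (\<open>row_variance_bound\<close>, \<open>master_inequality\<close>, \<open>saturated_moment_vanishes\<close>).

  With \<open>u = 1 - exp (- a\<^sup>2)\<close> one has \<open>exp (- \<i> z a\<^sup>2) - 1 = - \<i> z u + O(u\<^sup>2)\<close>
  (\<open>exp_linearization\<close>).  Multiplied by \<open>n\<close> the error vanishes in the mean, so that \<open>\<Phi> z = \<i> z \<Phi> (- \<i>)\<close>.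
\<close>

section \<open>Elementary estimates\<close>

lemma norm_integral_le:
  fixes f :: "'a \<Rightarrow> 'b::{banach, second_countable_topology}"
  assumes "integrable M f" "integrable M g" "\<And>x. x \<in> space M \<Longrightarrow> norm (f x) \<le> g x"
  shows "norm (integral\<^sup>L M f) \<le> integral\<^sup>L M g"
  by (rule order_trans[OF integral_norm_bound]) (use assms in \<open>auto intro!: integral_mono\<close>)

lemma integral_abs_le_sqrt:
  assumes "prob_space M" and f: "integrable M (\<lambda>x. (f x)\<^sup>2)" and fm: "f \<in> borel_measurable M"
  shows "integrable M f" "(LINT x|M. \<bar>f x\<bar>) \<le> sqrt (LINT x|M. (f x)\<^sup>2)"
proof -
  interpret prob_space M by fact
  show i: "integrable M f"
    by (rule square_integrable_imp_integrable[OF fm f])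
  have "0 \<le> variance (\<lambda>x. \<bar>f x\<bar>)" by (rule variance_positive)
  also have "\<dots> = (LINT x|M. (f x)\<^sup>2) - (LINT x|M. \<bar>f x\<bar>)\<^sup>2"
    using i f by (subst variance_eq) auto
  finally show "(LINT x|M. \<bar>f x\<bar>) \<le> sqrt (LINT x|M. (f x)\<^sup>2)"
    by (intro real_le_rsqrt) simp
qed

lemma exp_minus_le_half:
  fixes y :: real assumes "0 \<le> y" "y \<le> 1"
  shows "exp (- y) \<le> 1 - y / 2"
proof -
  have "exp (- y) \<le> inverse (1 + y)"
    unfolding exp_minus using assms exp_ge_add_one_self[of y] by (intro le_imp_inverse_le) auto
  also have "\<dots> \<le> 1 - y / 2"
  proof -
    have "y * y \<le> y * 1" using assms by (intro mult_left_mono) auto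
    then have "1 \<le> (1 - y / 2) * (1 + y)" by (simp add: algebra_simps)
    then show ?thesis using assms by (simp add: field_simps)
  qed
  finally show ?thesis .
qed

section \<open>Skorokhod-continuous local suprema\<close>

definition bump :: "real \<times> real \<Rightarrow> real \<Rightarrow> real \<times> real \<Rightarrow> real" where
  "bump p \<delta> q = max 0 (1 - (\<bar>fst q - fst p\<bar> + \<bar>snd q - snd p\<bar>) / \<delta>)"

text \<open>
  The values are cut off at 1 because a cadlag function on \<open>S \<times> T\<close> may be unbounded if \<open>T\<close> is not
  compact; without the cutoff the functional need not be finite or continuous.
\<close>

definition local_sup :: "(real \<times> real) set \<Rightarrow> real \<times> real \<Rightarrow> real \<Rightarrow> (real \<times> real \<Rightarrow> real) \<Rightarrow> real" where
  "local_sup D p \<delta> g = (SUP q\<in>D. bump p \<delta> q * min 1 \<bar>g q\<bar>)"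

lemma bump_bounds:
  assumes "\<delta> > 0"
  shows "0 \<le> bump p \<delta> q" "bump p \<delta> q \<le> 1" "bump p \<delta> p = 1"
  using assms by (auto simp: bump_def)

lemma bump_lipschitz:
  assumes "\<delta> > 0" "\<bar>fst q - fst q'\<bar> \<le> \<epsilon>" "\<bar>snd q - snd q'\<bar> \<le> \<epsilon>"
  shows "bump p \<delta> q \<le> bump p \<delta> q' + 2 * \<epsilon> / \<delta>"
proof -
  have "(\<bar>fst q' - fst p\<bar> + \<bar>snd q' - snd p\<bar>) / \<delta> \<le> (\<bar>fst q - fst p\<bar> + \<bar>snd q - snd p\<bar> + 2 * \<epsilon>) / \<delta>"
    using assms by (intro divide_right_mono) auto
  moreover have "0 \<le> 2 * \<epsilon> / \<delta>" using assms by auto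
  ultimately show ?thesis
    by (auto simp: bump_def add_divide_distrib max_def)
qed

lemma local_sup_term_le_1:
  assumes "\<delta> > 0"
  shows "bump p \<delta> q * min 1 \<bar>g q\<bar> \<le> 1"
proof -
  have "bump p \<delta> q * min 1 \<bar>g q\<bar> \<le> 1 * 1"
    by (intro mult_mono) (use bump_bounds[OF assms] in auto)
  then show ?thesis by simp
qed

lemma local_sup_upper:
  assumes "\<delta> > 0" "q \<in> D"
  shows "bump p \<delta> q * min 1 \<bar>g q\<bar> \<le> local_sup D p \<delta> g"
  unfolding local_sup_def
  by (intro cSUP_upper assms(2) bdd_aboveI2[where M = 1] local_sup_term_le_1 assms(1))

lemma local_sup_bounds:
  assumes "\<delta> > 0" "D \<noteq> {}"
  shows "0 \<le> local_sup D p \<delta> g" "local_sup D p \<delta> g \<le> 1"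
proof -
  obtain q where q: "q \<in> D" using assms by auto
  have "0 \<le> bump p \<delta> q * min 1 \<bar>g q\<bar>" using bump_bounds[OF assms(1)] by simp
  also have "\<dots> \<le> local_sup D p \<delta> g" by (rule local_sup_upper[OF assms(1) q])
  finally show "0 \<le> local_sup D p \<delta> g" .
  show "local_sup D p \<delta> g \<le> 1"
    unfolding local_sup_def by (rule cSUP_least[OF assms(2) local_sup_term_le_1[OF assms(1)]])
qed

lemma local_sup_le:
  assumes \<delta>: "\<delta> > 0" and ne: "D \<noteq> {}"
    and match: "\<And>q. q \<in> D \<Longrightarrow> \<exists>q'\<in>D. \<bar>fst q - fst q'\<bar> \<le> \<epsilon> \<and> \<bar>snd q - snd q'\<bar> \<le> \<epsilon> \<and> \<bar>g q - f q'\<bar> \<le> \<epsilon>"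
  shows "local_sup D p \<delta> g \<le> local_sup D p \<delta> f + (1 + 2 / \<delta>) * \<epsilon>"
  unfolding local_sup_def[of D p \<delta> g]
proof (rule cSUP_least[OF ne])
  fix q assume "q \<in> D"
  then obtain q' where q': "q' \<in> D" "\<bar>fst q - fst q'\<bar> \<le> \<epsilon>" "\<bar>snd q - snd q'\<bar> \<le> \<epsilon>"
      "\<bar>g q - f q'\<bar> \<le> \<epsilon>"
    using match by blast
  have \<epsilon>: "0 \<le> \<epsilon>" using q'(2) by linarith
  have "bump p \<delta> q * min 1 \<bar>g q\<bar> \<le> (bump p \<delta> q' + 2 * \<epsilon> / \<delta>) * min 1 \<bar>g q\<bar>"
    by (intro mult_right_mono bump_lipschitz \<delta> q') auto
  also have "\<dots> \<le> bump p \<delta> q' * min 1 \<bar>g q\<bar> + 2 * \<epsilon> / \<delta> * 1"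
    unfolding distrib_right by (intro add_left_mono mult_left_mono) (use \<epsilon> \<delta> in auto)
  also have "bump p \<delta> q' * min 1 \<bar>g q\<bar> \<le> bump p \<delta> q' * (min 1 \<bar>f q'\<bar> + \<epsilon>)"
    by (intro mult_left_mono bump_bounds \<delta>) (use q' in auto)
  also have "\<dots> \<le> bump p \<delta> q' * min 1 \<bar>f q'\<bar> + 1 * \<epsilon>"
    unfolding distrib_left by (intro add_left_mono mult_right_mono bump_bounds \<delta> \<epsilon>)
  also have "bump p \<delta> q' * min 1 \<bar>f q'\<bar> \<le> local_sup D p \<delta> f"
    by (rule local_sup_upper[OF \<delta> q'(1)])
  finally show "bump p \<delta> q * min 1 \<bar>g q\<bar> \<le> local_sup D p \<delta> f + (1 + 2 / \<delta>) * \<epsilon>"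
    by (simp add: algebra_simps)
qed

text \<open>
  A time change moves the weight \<open>bump p \<delta>\<close> by at most its Lipschitz constant \<open>1 / \<delta>\<close> times the
  displacement, and it permutes the points over which the supremum is taken.
\<close>

lemma local_sup_skorokhod_nbhd:
  assumes \<delta>: "\<delta> > 0" and ST: "S \<subseteq> {0..1}" "T \<subseteq> {0..1}" "S \<times> T \<noteq> {}"
    and g: "g \<in> skorokhod_nbhd S T \<epsilon> 1 f"
  shows "\<bar>local_sup (S \<times> T) p \<delta> g - local_sup (S \<times> T) p \<delta> f\<bar> \<le> (1 + 2 / \<delta>) * \<epsilon>"
proof -
  obtain \<rho> \<theta> where \<rho>: "time_change S \<epsilon> \<rho>" and \<theta>: "time_change T \<epsilon> \<theta>"
    and close: "\<And>s t. s \<in> S \<Longrightarrow> t \<in> T \<Longrightarrow> \<bar>s\<bar> \<le> 1 \<Longrightarrow> \<bar>t\<bar> \<le> 1 \<Longrightarrow> \<bar>g (\<rho> s, \<theta> t) - f (s, t)\<bar> < \<epsilon>"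
    using g by (auto simp: skorokhod_nbhd_def)
  have \<rho>S: "\<rho> ` S = S" "\<And>s. s \<in> S \<Longrightarrow> \<bar>\<rho> s - s\<bar> < \<epsilon>"
    using \<rho> by (auto simp: time_change_def bij_betw_def)
  have \<theta>T: "\<theta> ` T = T" "\<And>t. t \<in> T \<Longrightarrow> \<bar>\<theta> t - t\<bar> < \<epsilon>"
    using \<theta> by (auto simp: time_change_def bij_betw_def)
  have c: "\<bar>g (\<rho> s, \<theta> t) - f (s, t)\<bar> < \<epsilon>" if "s \<in> S" "t \<in> T" for s t
  proof -
    have "s \<in> {0..1}" "t \<in> {0..1}" using that ST by blast+
    then show ?thesis using close[OF that] by simp
  qed
  have "local_sup (S \<times> T) p \<delta> g \<le> local_sup (S \<times> T) p \<delta> f + (1 + 2 / \<delta>) * \<epsilon>"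
  proof (rule local_sup_le[OF \<delta> ST(3)])
    fix q assume "q \<in> S \<times> T"
    then obtain a b where ab: "q = (a, b)" "a \<in> \<rho> ` S" "b \<in> \<theta> ` T"
      unfolding \<rho>S(1) \<theta>T(1) by blast
    from ab(2) obtain s where s: "a = \<rho> s" "s \<in> S" by (rule imageE)
    from ab(3) obtain t where t: "b = \<theta> t" "t \<in> T" by (rule imageE)
    note q = ab(1)[unfolded s(1) t(1)] s(2) t(2)
    show "\<exists>q'\<in>S \<times> T. \<bar>fst q - fst q'\<bar> \<le> \<epsilon> \<and> \<bar>snd q - snd q'\<bar> \<le> \<epsilon> \<and> \<bar>g q - f q'\<bar> \<le> \<epsilon>"
      using q c[OF q(2,3)] \<rho>S(2)[OF q(2)] \<theta>T(2)[OF q(3)] by (intro bexI[of _ "(s, t)"]) auto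
  qed
  moreover have "local_sup (S \<times> T) p \<delta> f \<le> local_sup (S \<times> T) p \<delta> g + (1 + 2 / \<delta>) * \<epsilon>"
  proof (rule local_sup_le[OF \<delta> ST(3)])
    fix q assume "q \<in> S \<times> T"
    then obtain s t where q: "q = (s, t)" "s \<in> S" "t \<in> T" by auto
    have "\<rho> s \<in> S" "\<theta> t \<in> T" using q \<rho>S(1) \<theta>T(1) by auto
    then show "\<exists>q'\<in>S \<times> T. \<bar>fst q - fst q'\<bar> \<le> \<epsilon> \<and> \<bar>snd q - snd q'\<bar> \<le> \<epsilon> \<and> \<bar>f q - g q'\<bar> \<le> \<epsilon>"
      using q c[OF q(2,3)] \<rho>S(2)[OF q(2)] \<theta>T(2)[OF q(3)] by (intro bexI[of _ "(\<rho> s, \<theta> t)"]) auto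
  qed
  ultimately show ?thesis by linarith
qed

lemma local_sup_continuous:
  assumes \<delta>: "\<delta> > 0" and ST: "S \<subseteq> {0..1}" "T \<subseteq> {0..1}" "S \<times> T \<noteq> {}"
  shows "continuous_map (skorokhod_topology S T) euclideanreal (local_sup (S \<times> T) p \<delta>)"
  unfolding continuous_map_def
proof (intro conjI allI impI)
  fix W :: "real set" assume "openin euclideanreal W"
  then have W: "open W" by simp
  let ?F = "local_sup (S \<times> T) p \<delta>"
  show "openin (skorokhod_topology S T) {f \<in> topspace (skorokhod_topology S T). ?F f \<in> W}"
    unfolding openin_skorokhod topspace_skorokhod skorokhod_open_def
  proof (intro conjI ballI)
    fix f assume f: "f \<in> {f \<in> cadlag2 S T. ?F f \<in> W}"
    then obtain e where e: "e > 0" "\<And>y. \<bar>y - ?F f\<bar> < e \<Longrightarrow> y \<in> W"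
      using W unfolding open_dist dist_real_def by blast
    define c where "c = 1 + 2 / \<delta>"
    define \<epsilon> where "\<epsilon> = e / 2 / c"
    have pos: "c > 0" using \<delta> by (simp add: c_def add_pos_pos)
    have "\<epsilon> > 0" using e pos by (simp add: \<epsilon>_def)
    moreover have "g \<in> {f \<in> cadlag2 S T. ?F f \<in> W}" if g: "g \<in> skorokhod_nbhd S T \<epsilon> 1 f" for g
    proof -
      have "c * \<epsilon> = e / 2" using pos by (simp add: \<epsilon>_def)
      then have "\<bar>?F g - ?F f\<bar> < e"
        using local_sup_skorokhod_nbhd[OF \<delta> ST g, of p] e(1) unfolding c_def by linarith
      then show ?thesis using e(2) g by (auto simp: skorokhod_nbhd_def)
    qed
    ultimately show "\<exists>\<epsilon>>0. \<exists>N. skorokhod_nbhd S T \<epsilon> N f \<subseteq> {f \<in> cadlag2 S T. ?F f \<in> W}"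
      by blast
  qed auto
qed auto

lemma borel_sigma_measurable_continuous:
  assumes "continuous_map X euclideanreal f"
  shows "f \<in> borel_sigma X \<rightarrow>\<^sub>M borel"
proof (rule borel_measurableI)
  fix S :: "real set" assume "open S"
  then have "openin X {x \<in> topspace X. f x \<in> S}"
    using assms by (simp add: continuous_map_def)
  moreover have "f -` S \<inter> space (borel_sigma X) = {x \<in> topspace X. f x \<in> S}"
    by (auto simp: borel_sigma_def space_measure_of_conv)
  moreover have "{V. openin X V} \<subseteq> Pow (topspace X)"
    using openin_subset by auto
  ultimately show "f -` S \<inter> space (borel_sigma X) \<in> sets (borel_sigma X)"
    by (auto simp: borel_sigma_def sets_measure_of_conv intro: sigma_sets.Basic)
qed

lemma spectral_levels_subset:
  assumes "real_distribution \<mu>"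
  shows "spectral_levels \<mu> \<subseteq> {0..1}"
proof -
  interpret real_distribution \<mu> by fact
  show ?thesis by (auto simp: spectral_levels_def cdf_nonneg cdf_bounded_prob)
qed

lemma local_sup_tendsto_0:
  assumes cont: "continuous_on D g" and p: "p \<in> D" "g p = 0"
  shows "(\<lambda>i. local_sup D p (inverse (real (Suc i))) g) \<longlonglongrightarrow> 0"
proof (rule LIMSEQ_I)
  fix r :: real assume r: "0 < r"
  obtain d where d: "d > 0" "\<And>q. q \<in> D \<Longrightarrow> dist q p < d \<Longrightarrow> dist (g q) (g p) < r / 2"
    using cont p(1) r unfolding continuous_on_iff by (metis half_gt_zero)
  obtain i0 where i0: "inverse (real (Suc i0)) < d"
    using d(1) reals_Archimedean by blast
  have "norm (local_sup D p (inverse (real (Suc i))) g - 0) < r" if i: "i \<ge> i0" for i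
  proof -
    define \<delta> where "\<delta> = inverse (real (Suc i))"
    have \<delta>: "\<delta> > 0" by (simp add: \<delta>_def)
    have "\<delta> \<le> inverse (real (Suc i0))"
      unfolding \<delta>_def using i by (intro le_imp_inverse_le) auto
    then have \<delta>d: "\<delta> < d" using i0 by linarith
    have "local_sup D p \<delta> g \<le> r / 2"
      unfolding local_sup_def
    proof (rule cSUP_least)
      show "D \<noteq> {}" using p by auto
      fix q assume q: "q \<in> D"
      show "bump p \<delta> q * min 1 \<bar>g q\<bar> \<le> r / 2"
      proof (cases "\<bar>fst q - fst p\<bar> + \<bar>snd q - snd p\<bar> < \<delta>")
        case True
        have "dist q p \<le> \<bar>fst q - fst p\<bar> + \<bar>snd q - snd p\<bar>"
          unfolding dist_prod_def dist_real_def
          by (metis abs_ge_zero sqrt_sum_squares_le_sum power2_abs)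
        then have "\<bar>g q\<bar> < r / 2" using d(2)[OF q] True \<delta>d p(2) by (simp add: dist_real_def)
        moreover have "bump p \<delta> q * min 1 \<bar>g q\<bar> \<le> 1 * \<bar>g q\<bar>"
          by (intro mult_mono) (use bump_bounds[OF \<delta>] in auto)
        ultimately show ?thesis by linarith
      next
        case False
        then have "1 \<le> (\<bar>fst q - fst p\<bar> + \<bar>snd q - snd p\<bar>) / \<delta>" using \<delta> by simp
        then have "bump p \<delta> q = 0" by (simp add: bump_def)
        then show ?thesis using r by simp
      qed
    qed
    moreover have "0 \<le> local_sup D p \<delta> g"
      using local_sup_bounds(1)[OF \<delta>, of D p g] p by auto
    ultimately show ?thesis using r by (simp add: \<delta>_def)
  qed
  then show "\<exists>no. \<forall>n\<ge>no. norm (local_sup D p (inverse (real (Suc n))) g - 0) < r" by blast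
qed

lemma process_B_measurable:
  assumes "\<And>i j. i < n \<Longrightarrow> j < n \<Longrightarrow> (\<lambda>\<omega>. U \<omega> $$ (i, j)) \<in> borel_measurable M"
  shows "(\<lambda>\<omega>. process_B n (U \<omega>) (s, t)) \<in> borel_measurable M"
  unfolding process_B_def prod.case using assms
  by (intro borel_measurable_times borel_measurable_sum borel_measurable_const
      borel_measurable_diff borel_measurable_power borel_measurable_abs) auto

text \<open>
  The functional \<open>local_sup\<close> at \<open>(s, t)\<close> dominates the truncated value at \<open>(s, t)\<close>.  Its mean at the
  limit \<open>B\<close> is arbitrarily small for a narrow bump, by continuity of the paths of \<open>B\<close>, and convergence
  in law carries this over to \<open>process_B\<close>.
\<close>

lemma process_B_null:
  fixes s :: real
  assumes limits: "limit_processes M U l \<mu> N B C" and \<mu>: "real_distribution \<mu>"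
    and meas: "\<And>n i j. n \<ge> 1 \<Longrightarrow> i < n \<Longrightarrow> j < n \<Longrightarrow> (\<lambda>\<omega>. U n \<omega> $$ (i, j)) \<in> borel_measurable (M n)"
    and prob: "\<And>n. n \<ge> 1 \<Longrightarrow> prob_space (M n)"
    and s: "0 < s" "s < 1" and t: "t \<in> spectral_levels \<mu>"
    and null: "AE \<omega> in N. B \<omega> (s, t) = 0"
  shows "(\<lambda>n. LINT \<omega>|M n. min 1 \<bar>process_B n (U n \<omega>) (s, t)\<bar>) \<longlonglongrightarrow> 0"
proof -
  define E where "E = spectral_levels \<mu>"
  define D where "D = {0..1::real} \<times> E"
  define p where "p = (s, t)"
  define F where "F i = local_sup D p (inverse (real (Suc i)))" for i
  define X where "X = prod_topology (skorokhod_topology {0..1} E) (skorokhod_topology {0..1} UNIV)"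
  define P where "P = (\<lambda>n \<omega>. (restrict (process_B n (U n \<omega>)) ({0..1} \<times> E),
                  restrict (process_C n (U n \<omega>) (l n \<omega>)) ({0..1} \<times> UNIV)))"
  interpret N: prob_space N using limits by (simp add: limit_processes_def Let_def)
  have E: "E \<subseteq> {0..1}" using spectral_levels_subset[OF \<mu>] by (simp add: E_def)
  have pD: "p \<in> D" using s t by (auto simp: D_def p_def E_def)
  then have ne: "{0..1::real} \<times> E \<noteq> {}" by (auto simp: D_def)
  have law: "converges_in_law X M P N (\<lambda>\<omega>. (B \<omega>, C \<omega>))"
    using limits by (simp add: limit_processes_def Let_def X_def P_def E_def)
  have cont_F: "continuous_map X euclideanreal (F i \<circ> fst)" for i
    unfolding X_def F_def D_def
    by (rule continuous_map_compose[OF continuous_map_fst local_sup_continuous])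
       (use E ne in auto)
  have F01: "0 \<le> F i g" "F i g \<le> 1" for i g
    using local_sup_bounds[of "inverse (real (Suc i))" D p g] pD by (auto simp: F_def)
  have conv: "(\<lambda>n. LINT \<omega>|M n. (F i \<circ> fst) (P n \<omega>)) \<longlonglongrightarrow> (LINT \<omega>|N. (F i \<circ> fst) (B \<omega>, C \<omega>))" for i
  proof -
    have "bounded ((F i \<circ> fst) ` topspace X)"
      using F01 by (intro boundedI[of _ 1]) auto
    then show ?thesis using law cont_F[of i] unfolding converges_in_law_def by blast
  qed
  have mP: "(\<lambda>\<omega>. (F i \<circ> fst) (P n \<omega>)) \<in> borel_measurable (M n)" if "n \<ge> 1" for i n
    using law that borel_sigma_measurable_continuous[OF cont_F[of i]]
    unfolding converges_in_law_def by (metis (no_types) measurable_compose)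
  have mB: "(\<lambda>\<omega>. F i (B \<omega>)) \<in> borel_measurable N" for i
  proof -
    have "(\<lambda>\<omega>. (B \<omega>, C \<omega>)) \<in> N \<rightarrow>\<^sub>M borel_sigma X"
      using law unfolding converges_in_law_def by blast
    from measurable_compose[OF this borel_sigma_measurable_continuous[OF cont_F[of i]]]
    show ?thesis by simp
  qed
  have "AE \<omega> in N. continuous_on D (B \<omega>)"
    using limits by (simp add: limit_processes_def Let_def D_def E_def)
  then have AE: "AE \<omega> in N. (\<lambda>i. F i (B \<omega>)) \<longlonglongrightarrow> 0"
    using null unfolding F_def
    by eventually_elim (rule local_sup_tendsto_0[OF _ pD], auto simp: p_def)
  have lim: "(\<lambda>i. LINT \<omega>|N. F i (B \<omega>)) \<longlonglongrightarrow> (LINT \<omega>|N. 0)"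
    by (rule integral_dominated_convergence[where w = "\<lambda>_. 1"]) (use mB AE F01 in auto)
  show ?thesis
  proof (rule LIMSEQ_I)
    fix r :: real assume r: "0 < r"
    obtain i where i: "(LINT \<omega>|N. F i (B \<omega>)) < r"
      using order_tendstoD(2)[OF lim, of r] r by (auto dest!: eventually_happens)
    have "\<forall>\<^sub>F n in sequentially. (LINT \<omega>|M n. (F i \<circ> fst) (P n \<omega>)) < r"
      using order_tendstoD(2)[OF conv[of i]] i by simp
    then obtain n0 where n0: "\<And>n. n \<ge> n0 \<Longrightarrow> (LINT \<omega>|M n. (F i \<circ> fst) (P n \<omega>)) < r"
      unfolding eventually_sequentially by blast
    have "norm ((LINT \<omega>|M n. min 1 \<bar>process_B n (U n \<omega>) (s, t)\<bar>) - 0) < r" if n: "n \<ge> max 1 n0" for n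
    proof -
      interpret Mn: prob_space "M n" using prob n by simp
      have m: "(\<lambda>\<omega>. process_B n (U n \<omega>) (s, t)) \<in> borel_measurable (M n)"
        by (rule process_B_measurable) (use meas n in auto)
      have "(LINT \<omega>|M n. min 1 \<bar>process_B n (U n \<omega>) (s, t)\<bar>) \<le> (LINT \<omega>|M n. (F i \<circ> fst) (P n \<omega>))"
      proof (rule integral_mono)
        show "integrable (M n) (\<lambda>\<omega>. min 1 \<bar>process_B n (U n \<omega>) (s, t)\<bar>)"
          by (rule Mn.integrable_const_bound[of _ 1]) (use m in auto)
        show "integrable (M n) (\<lambda>\<omega>. (F i \<circ> fst) (P n \<omega>))"
          by (rule Mn.integrable_const_bound[of _ 1]) (use mP[of n i] F01 n in auto)
        fix \<omega> assume "\<omega> \<in> space (M n)"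
        have "bump p (inverse (real (Suc i))) p * min 1 \<bar>fst (P n \<omega>) p\<bar> \<le> F i (fst (P n \<omega>))"
          unfolding F_def by (rule local_sup_upper[OF _ pD]) simp
        then show "min 1 \<bar>process_B n (U n \<omega>) (s, t)\<bar> \<le> (F i \<circ> fst) (P n \<omega>)"
          using pD by (simp add: bump_bounds P_def p_def D_def)
      qed
      also have "\<dots> < r" using n0 n by simp
      finally show ?thesis by (simp add: integral_nonneg)
    qed
    then show "\<exists>no. \<forall>n\<ge>no. norm ((LINT \<omega>|M n. min 1 \<bar>process_B n (U n \<omega>) (s, t)\<bar>) - 0) < r"
      by blast
  qed
qed

text \<open>
  A Gaussian variable with a density has positive variance.
\<close>

lemma null_covariance_imp_null:
  assumes G: "centered_gaussian_process N I X" and i: "i \<in> I" and N: "prob_space N"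
    and cov: "covariance N (\<lambda>\<omega>. X \<omega> i) (\<lambda>\<omega>. X \<omega> i) = 0"
  shows "AE \<omega> in N. X \<omega> i = 0"
proof -
  interpret prob_space N by fact
  have "(\<exists>\<sigma>>0. distributed N lborel (\<lambda>\<omega>. \<Sum>j\<in>{i}. 1 * X \<omega> j) (normal_density 0 \<sigma>)) \<or>
        (AE \<omega> in N. (\<Sum>j\<in>{i}. 1 * X \<omega> j) = 0)"
    using G i unfolding centered_gaussian_process_def
    by (elim conjE allE[of _ "{i}"] allE[of _ "\<lambda>_. 1"]) auto
  then show ?thesis
  proof
    assume "\<exists>\<sigma>>0. distributed N lborel (\<lambda>\<omega>. \<Sum>j\<in>{i}. 1 * X \<omega> j) (normal_density 0 \<sigma>)"
    then obtain \<sigma> where \<sigma>: "\<sigma> > 0" "distributed N lborel (\<lambda>\<omega>. X \<omega> i) (normal_density 0 \<sigma>)"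
      by auto
    have "variance (\<lambda>\<omega>. X \<omega> i) = \<sigma>\<^sup>2"
      by (rule normal_distributed_variance[OF \<sigma>])
    then have False using cov \<sigma>(1) by (simp add: covariance_def power2_eq_square)
    then show ?thesis ..
  qed simp
qed

section \<open>Partial sums of exchangeable vectors\<close>

text \<open>
  Only the marginal law of the vector is involved; the vector will be a function of the absolute values
  of the eigenvectors, and nothing is known about their joint exchangeability with the eigenvalues.
\<close>

definition exchangeable_vector :: "'w measure \<Rightarrow> nat \<Rightarrow> ('w \<Rightarrow> nat \<Rightarrow> real) \<Rightarrow> bool" where
  "exchangeable_vector M n d \<longleftrightarrow>
     (\<forall>i<n. (\<lambda>\<omega>. d \<omega> i) \<in> borel_measurable M) \<and>
     (\<forall>\<pi>. \<pi> permutes {..<n} \<longrightarrow>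
        distr M (Pi\<^sub>M {..<n} (\<lambda>_. borel)) (\<lambda>\<omega>. \<lambda>i\<in>{..<n}. d \<omega> (\<pi> i)) =
        distr M (Pi\<^sub>M {..<n} (\<lambda>_. borel)) (\<lambda>\<omega>. \<lambda>i\<in>{..<n}. d \<omega> i))"

lemma exchangeable_vector_integral:
  fixes H :: "(nat \<Rightarrow> real) \<Rightarrow> 'b::{banach, second_countable_topology}"
  assumes d: "exchangeable_vector M n d" and \<pi>: "\<pi> permutes {..<n}"
    and H: "H \<in> borel_measurable (Pi\<^sub>M {..<n} (\<lambda>_. borel))"
    and ext: "\<And>v w. (\<And>i. i < n \<Longrightarrow> v i = w i) \<Longrightarrow> H v = H w"
  shows "(LINT \<omega>|M. H (\<lambda>i. d \<omega> (\<pi> i))) = (LINT \<omega>|M. H (d \<omega>))"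
proof -
  have m: "(\<lambda>\<omega>. \<lambda>i\<in>{..<n}. d \<omega> (\<sigma> i)) \<in> M \<rightarrow>\<^sub>M Pi\<^sub>M {..<n} (\<lambda>_. borel)" if "\<sigma> permutes {..<n}" for \<sigma>
    using d permutes_in_image[OF that] unfolding exchangeable_vector_def
    by (intro measurable_restrict) auto
  have *: "(LINT \<omega>|M. H (\<lambda>i. d \<omega> (\<sigma> i)))
      = integral\<^sup>L (distr M (Pi\<^sub>M {..<n} (\<lambda>_. borel)) (\<lambda>\<omega>. \<lambda>i\<in>{..<n}. d \<omega> (\<sigma> i))) H"
    if "\<sigma> permutes {..<n}" for \<sigma>
    unfolding integral_distr[OF m[OF that] H] by (intro Bochner_Integration.integral_cong refl ext) simp
  show ?thesis
    using *[OF \<pi>] *[OF permutes_id] d \<pi> unfolding exchangeable_vector_def by simp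
qed

lemma exists_permutation_pair:
  assumes "a \<in> S" "b \<in> S" "c \<in> S" "e \<in> S" "a \<noteq> b" "c \<noteq> e"
  shows "\<exists>\<pi>. \<pi> permutes S \<and> \<pi> a = c \<and> \<pi> b = e"
proof -
  define \<sigma> where "\<sigma> = Transposition.transpose a c"
  define \<tau> where "\<tau> = Transposition.transpose (\<sigma> b) e"
  have \<sigma>: "\<sigma> permutes S" unfolding \<sigma>_def using assms by (simp add: permutes_swap_id)
  then have "\<sigma> b \<in> S" using assms by (simp add: permutes_in_image)
  then have \<tau>: "\<tau> permutes S" unfolding \<tau>_def using assms by (simp add: permutes_swap_id)
  have "\<sigma> a = c" by (simp add: \<sigma>_def)
  moreover have "\<sigma> b \<noteq> c"
    using assms(5) calculation permutes_inj[OF \<sigma>] by (metis injD)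
  ultimately have "(\<tau> \<circ> \<sigma>) a = c" "(\<tau> \<circ> \<sigma>) b = e"
    using assms(6) by (auto simp: \<tau>_def transpose_def)
  then show ?thesis using permutes_compose[OF \<sigma> \<tau>] by blast
qed

text \<open>
  The characteristic function of a fair choice between 0 and \<open>x\<close>.  Its modulus is \<open>\<bar>cos (x / 2)\<bar>\<close>, which is
  estimated here by a Gaussian so that products become exponentials of sums.
\<close>

lemma norm_half_one_plus_iexp:
  fixes x :: real
  assumes "\<bar>x\<bar> \<le> 2"
  shows "cmod ((1 + iexp x) / 2) \<le> exp (- (x\<^sup>2 / 16))"
proof -
  have "\<bar>cos x - (1 - x\<^sup>2 / 2)\<bar> \<le> cmod (iexp x - (\<Sum>k\<le>3. (\<i> * x) ^ k / fact k))"
  proof -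
    have "Re (iexp x - (\<Sum>k\<le>3. (\<i> * x) ^ k / fact k)) = cos x - (1 - x\<^sup>2 / 2)"
      by (simp add: numeral_eq_Suc Re_exp power2_eq_square complex_eq_iff)
    then show ?thesis using abs_Re_le_cmod by metis
  qed
  also have "\<dots> \<le> \<bar>x\<bar> ^ Suc 3 / fact (Suc 3)" by (rule iexp_approx1)
  also have "\<dots> = x\<^sup>2 * x\<^sup>2 / 24"
    by (simp add: numeral_eq_Suc abs_mult_self_eq mult.assoc[symmetric] flip: abs_mult)
  also have "\<dots> \<le> 4 * x\<^sup>2 / 24"
    using assms by (intro divide_right_mono mult_right_mono) (auto simp: abs_le_square_iff[of x 2, simplified])
  finally have "cos x - (1 - x\<^sup>2 / 2) \<le> 4 * x\<^sup>2 / 24" by linarith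
  moreover have "0 \<le> x\<^sup>2" by simp
  ultimately have c: "cos x \<le> 1 - x\<^sup>2 / 4" by linarith
  have "(cmod ((1 + iexp x) / 2))\<^sup>2 = (1 + cos x) / 2"
  proof -
    have "(cmod (1 + iexp x))\<^sup>2 = (1 + cos x)\<^sup>2 + (sin x)\<^sup>2"
      by (simp add: cmod_power2 Re_exp Im_exp)
    also have "\<dots> = 2 * (1 + cos x)"
      using sin_cos_squared_add[of x] by (simp add: power2_eq_square algebra_simps)
    finally show ?thesis by (simp add: norm_divide power_divide)
  qed
  also have "\<dots> \<le> 1 + - (x\<^sup>2 / 8)" using c by simp
  also have "\<dots> \<le> exp (- (x\<^sup>2 / 8))" by (rule exp_ge_add_one_self)
  also have "\<dots> = (exp (- (x\<^sup>2 / 16)))\<^sup>2" by (simp add: power2_eq_square flip: exp_add)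
  finally show ?thesis by (rule power2_le_imp_le) simp
qed

lemma norm_iexp_minus_1_le: "cmod (1 - iexp x) \<le> 2 * min 1 \<bar>x\<bar>"
proof -
  have "cmod (1 - iexp x) = 2 * \<bar>sin (x / 2)\<bar>"
    using dist_exp_i_1[of x] by (simp add: norm_minus_commute)
  moreover have "2 * \<bar>sin (x / 2)\<bar> \<le> \<bar>x\<bar>" using abs_sin_x_le_abs_x[of "x / 2"] by simp
  moreover have "\<bar>sin (x / 2)\<bar> \<le> 1" by simp
  ultimately show ?thesis using abs_ge_zero[of x] by (auto simp: min_def)
qed

text \<open>
  Exchanges \<open>i\<close> and \<open>m + i\<close> for all \<open>i \<in> X\<close>; this replaces the summands with index in \<open>X\<close> of a sum over
  the first \<open>m\<close> entries by entries outside of that sum.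
\<close>

definition pair_swap :: "nat \<Rightarrow> nat set \<Rightarrow> nat \<Rightarrow> nat" where
  "pair_swap m X i = (if i < m \<and> i \<in> X then m + i else if m \<le> i \<and> i - m \<in> X then i - m else i)"

lemma pair_swap_permutes:
  assumes "X \<subseteq> {..<p}" "p \<le> m" "m + p \<le> n"
  shows "pair_swap m X permutes {..<n}"
proof -
  have inv: "pair_swap m X (pair_swap m X i) = i" for i
    using assms by (auto simp: pair_swap_def)
  have "\<exists>!x. pair_swap m X x = y" for y
  proof (rule ex1I[of _ "pair_swap m X y"])
    show "pair_swap m X (pair_swap m X y) = y" by (rule inv)
    show "x = pair_swap m X y" if "pair_swap m X x = y" for x
      using inv[of x] that by simp
  qed
  moreover have "pair_swap m X x = x" if "x \<notin> {..<n}" for x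
  proof -
    have "x - m \<notin> {..<p}" using that assms by auto
    then have "x - m \<notin> X" using assms(1) by blast
    moreover have "\<not> x < m" using that assms by auto
    ultimately show ?thesis by (simp add: pair_swap_def)
  qed
  ultimately show ?thesis unfolding permutes_def by blast
qed

lemma pair_swap_sum:
  fixes v :: "nat \<Rightarrow> real"
  assumes "X \<subseteq> {..<p}" "p \<le> m"
  shows "(\<Sum>i<m. v (pair_swap m X i)) = (\<Sum>i<m. v i) + (\<Sum>i\<in>X. v (m + i) - v i)"
proof -
  have "(\<Sum>i<m. v (pair_swap m X i)) = (\<Sum>i<m. v i + (if i \<in> X then v (m + i) - v i else 0))"
    by (intro sum.cong refl) (auto simp: pair_swap_def)
  also have "\<dots> = (\<Sum>i<m. v i) + (\<Sum>i\<in>{..<m} \<inter> X. v (m + i) - v i)"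
    by (simp add: sum.distrib sum.inter_restrict)
  also have "{..<m} \<inter> X = X" using assms by auto
  finally show ?thesis .
qed

text \<open>
  Swapping the entries \<open>i\<close> and \<open>m + i\<close> for \<open>i\<close> in any set \<open>X\<close> leaves the law of the partial sum
  unchanged.  Averaging its characteristic function over all \<open>X\<close> produces a product of factors
  \<open>(1 + exp (\<i> x\<^sub>i)) / 2\<close>, whose modulus is strictly smaller than 1 unless the differences of
  the swapped entries are small.
\<close>

lemma exchangeable_pair_differences:
  assumes M: "prob_space M" and d: "exchangeable_vector M n d"
    and bound: "\<And>\<omega> i. \<omega> \<in> space M \<Longrightarrow> i < n \<Longrightarrow> \<bar>d \<omega> i\<bar> \<le> 1"
    and p: "p \<le> m" "m + p \<le> n" and n: "n \<ge> 1"
  shows "(LINT \<omega>|M. (\<Sum>i<p. (d \<omega> (m + i) - d \<omega> i)\<^sup>2) / (16 * n))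
     \<le> 4 * (LINT \<omega>|M. min 1 \<bar>1 / sqrt n * (\<Sum>i<m. d \<omega> i)\<bar>)"
proof -
  interpret prob_space M by fact
  have md: "(\<lambda>\<omega>. d \<omega> i) \<in> borel_measurable M" if "i < n" for i
    using d that by (simp add: exchangeable_vector_def)
  define c where "c = 1 / sqrt n"
  have c2: "c\<^sup>2 = 1 / n" by (simp add: c_def power_divide)
  have c: "0 < c" "c \<le> 1" using n by (auto simp: c_def)
  define S where "S v = c * (\<Sum>i<m. v i)" for v :: "nat \<Rightarrow> real"
  define x where "x \<omega> i = c * (d \<omega> (m + i) - d \<omega> i)" for \<omega> i
  define y where "y \<omega> = (\<Sum>i<p. (d \<omega> (m + i) - d \<omega> i)\<^sup>2) / (16 * n)" for \<omega>
  have mS: "(\<lambda>\<omega>. S (d \<omega>)) \<in> borel_measurable M"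
    unfolding S_def using p by (intro borel_measurable_times borel_measurable_sum md) auto
  have mx: "(\<lambda>\<omega>. x \<omega> i) \<in> borel_measurable M" if "i < p" for i
    unfolding x_def using that p by (intro borel_measurable_times borel_measurable_diff md) auto
  have my: "y \<in> borel_measurable M"
    unfolding y_def using p
    by (intro borel_measurable_divide borel_measurable_sum borel_measurable_power borel_measurable_diff md) auto
  have mi: "(\<lambda>\<omega>. iexp (f \<omega>)) \<in> borel_measurable M" if "f \<in> borel_measurable M" for f :: "'a \<Rightarrow> real"
    using that by measurable
  have x2: "\<bar>x \<omega> i\<bar> \<le> 2" if "\<omega> \<in> space M" "i < p" for \<omega> i
  proof -
    have "\<bar>d \<omega> (m + i) - d \<omega> i\<bar> \<le> 2"
      using bound[OF that(1), of "m + i"] bound[OF that(1), of i] that p by simp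
    then have "c * \<bar>d \<omega> (m + i) - d \<omega> i\<bar> \<le> 1 * 2" by (intro mult_mono) (use c in auto)
    then show ?thesis using c by (simp add: x_def abs_mult)
  qed
  have iS: "integrable M (\<lambda>\<omega>. iexp (S (d \<omega>)))"
    by (rule integrable_const_bound[of _ 1]) (use mi mS in auto)
  have perm: "(LINT \<omega>|M. iexp (S (d \<omega>)) * (\<Prod>i\<in>X. iexp (x \<omega> i))) = (LINT \<omega>|M. iexp (S (d \<omega>)))"
    if X: "X \<subseteq> {..<p}" for X
  proof -
    have fX: "finite X" using X finite_subset by blast
    have "(LINT \<omega>|M. iexp (S (\<lambda>i. d \<omega> (pair_swap m X i)))) = (LINT \<omega>|M. iexp (S (d \<omega>)))"
    proof (rule exchangeable_vector_integral[OF d pair_swap_permutes[OF X p], where H = "\<lambda>v. iexp (S v)"])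
      show "(\<lambda>v. iexp (S v)) \<in> borel_measurable (Pi\<^sub>M {..<n} (\<lambda>_. borel))"
      proof -
        have "S \<in> borel_measurable (Pi\<^sub>M {..<n} (\<lambda>_. borel))"
          unfolding S_def using p
          by (intro borel_measurable_times borel_measurable_sum measurable_component_singleton) auto
        then show ?thesis by measurable
      qed
      show "iexp (S v) = iexp (S w)" if "\<And>i. i < n \<Longrightarrow> v i = w i" for v w
        using that p by (simp add: S_def)
    qed
    moreover have "iexp (S (\<lambda>i. d \<omega> (pair_swap m X i))) = iexp (S (d \<omega>)) * (\<Prod>i\<in>X. iexp (x \<omega> i))" for \<omega>
    proof -
      have "S (\<lambda>i. d \<omega> (pair_swap m X i)) = S (d \<omega>) + (\<Sum>i\<in>X. x \<omega> i)"
        unfolding S_def pair_swap_sum[OF X p(1)] x_def by (simp add: distrib_left sum_distrib_left)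
      then show ?thesis
        by (simp add: distrib_left exp_add exp_sum[OF fX] sum_distrib_left)
    qed
    ultimately show ?thesis by simp
  qed
  have iX: "integrable M (\<lambda>\<omega>. iexp (S (d \<omega>)) * (\<Prod>i\<in>X. iexp (x \<omega> i)))" if X: "X \<subseteq> {..<p}" for X
  proof (rule integrable_const_bound[of _ 1])
    show "AE \<omega> in M. norm (iexp (S (d \<omega>)) * (\<Prod>i\<in>X. iexp (x \<omega> i))) \<le> 1"
      by (simp add: norm_mult prod_norm[symmetric])
    show "(\<lambda>\<omega>. iexp (S (d \<omega>)) * (\<Prod>i\<in>X. iexp (x \<omega> i))) \<in> borel_measurable M"
      using X by (intro borel_measurable_times borel_measurable_prod mi mS mx) auto
  qed
  have pow: "iexp (S (d \<omega>)) * (\<Prod>i<p. 1 + iexp (x \<omega> i))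
      = (\<Sum>X\<in>Pow {..<p}. iexp (S (d \<omega>)) * (\<Prod>i\<in>X. iexp (x \<omega> i)))" for \<omega>
    using prod_add[of "{..<p}" "\<lambda>i. iexp (x \<omega> i)" "\<lambda>_. 1"]
    by (simp add: add.commute sum_distrib_left)
  have "2 ^ p * (LINT \<omega>|M. iexp (S (d \<omega>))) = (\<Sum>X\<in>Pow {..<p}. LINT \<omega>|M. iexp (S (d \<omega>)))"
    by (simp add: card_Pow)
  also have "\<dots> = (\<Sum>X\<in>Pow {..<p}. LINT \<omega>|M. iexp (S (d \<omega>)) * (\<Prod>i\<in>X. iexp (x \<omega> i)))"
    using perm by (intro sum.cong refl) auto
  also have "\<dots> = (LINT \<omega>|M. iexp (S (d \<omega>)) * (\<Prod>i<p. 1 + iexp (x \<omega> i)))"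
    unfolding pow by (rule Bochner_Integration.integral_sum[symmetric]) (use iX in auto)
  \<comment> \<open>All \<open>2\<^sup>p\<close> swapped sums have the same characteristic function, and their
    sum factorizes.\<close>
  finally have avg: "2 ^ p * (LINT \<omega>|M. iexp (S (d \<omega>)))
      = (LINT \<omega>|M. iexp (S (d \<omega>)) * (\<Prod>i<p. 1 + iexp (x \<omega> i)))" .
  have y01: "0 \<le> y \<omega>" "y \<omega> \<le> 1" if "\<omega> \<in> space M" for \<omega>
  proof -
    show "0 \<le> y \<omega>" by (simp add: y_def sum_nonneg)
    have "(d \<omega> (m + i) - d \<omega> i)\<^sup>2 \<le> 2\<^sup>2" if "i < p" for i
    proof -
      have "\<bar>d \<omega> (m + i) - d \<omega> i\<bar> \<le> \<bar>2\<bar>"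
        using bound[OF \<open>\<omega> \<in> space M\<close>, of "m + i"] bound[OF \<open>\<omega> \<in> space M\<close>, of i] that p by simp
      then show ?thesis by (simp only: abs_le_square_iff)
    qed
    then have "(\<Sum>i<p. (d \<omega> (m + i) - d \<omega> i)\<^sup>2) \<le> (\<Sum>i<p. 4)"
      by (intro sum_mono) auto
    also have "\<dots> \<le> 16 * real n" using p by simp
    finally show "y \<omega> \<le> 1" using n by (simp add: y_def)
  qed
  have pt: "cmod (iexp (S (d \<omega>)) * (\<Prod>i<p. 1 + iexp (x \<omega> i))) \<le> 2 ^ p * (1 - y \<omega> / 2)"
    if \<omega>: "\<omega> \<in> space M" for \<omega>
  proof -
    have "cmod (iexp (S (d \<omega>)) * (\<Prod>i<p. 1 + iexp (x \<omega> i))) = (\<Prod>i<p. cmod (1 + iexp (x \<omega> i)))"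
      by (simp add: norm_mult prod_norm)
    also have "\<dots> \<le> (\<Prod>i<p. 2 * exp (- ((x \<omega> i)\<^sup>2 / 16)))"
    proof (rule prod_mono, intro conjI)
      fix i assume "i \<in> {..<p}"
      then show "cmod (1 + iexp (x \<omega> i)) \<le> 2 * exp (- ((x \<omega> i)\<^sup>2 / 16))"
        using norm_half_one_plus_iexp[OF x2[OF \<omega>, of i]] by (simp add: norm_divide)
    qed simp
    also have "\<dots> = 2 ^ p * exp (\<Sum>i<p. - ((x \<omega> i)\<^sup>2 / 16))"
      by (simp add: prod.distrib exp_sum)
    also have "(\<Sum>i<p. - ((x \<omega> i)\<^sup>2 / 16)) = - y \<omega>"
      by (simp add: y_def x_def power_mult_distrib c2 sum_negf sum_divide_distrib mult.commute)
    also have "2 ^ p * exp (- y \<omega>) \<le> 2 ^ p * (1 - y \<omega> / 2)"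
      using exp_minus_le_half[OF y01[OF \<omega>]] by simp
    finally show ?thesis .
  qed
  have iy: "integrable M y"
    by (rule integrable_const_bound[of _ 1]) (use y01 my in auto)
  have "2 ^ p * cmod (LINT \<omega>|M. iexp (S (d \<omega>))) = cmod (LINT \<omega>|M. iexp (S (d \<omega>)) * (\<Prod>i<p. 1 + iexp (x \<omega> i)))"
    by (simp add: avg[symmetric] norm_mult norm_power)
  also have "\<dots> \<le> (LINT \<omega>|M. 2 ^ p * (1 - y \<omega> / 2))"
    by (rule norm_integral_le)
      (use iX iy pt in \<open>auto simp: pow\<close>)
  also have "\<dots> = 2 ^ p * (1 - (LINT \<omega>|M. y \<omega>) / 2)"
    using iy by (simp add: prob_space)
  finally have 1: "cmod (LINT \<omega>|M. iexp (S (d \<omega>))) \<le> 1 - (LINT \<omega>|M. y \<omega>) / 2" by simp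
  have "1 - cmod (LINT \<omega>|M. iexp (S (d \<omega>))) \<le> cmod (1 - (LINT \<omega>|M. iexp (S (d \<omega>))))"
    using norm_triangle_ineq2[of "1::complex" "LINT \<omega>|M. iexp (S (d \<omega>))"] by simp
  also have "1 - (LINT \<omega>|M. iexp (S (d \<omega>))) = (LINT \<omega>|M. 1 - iexp (S (d \<omega>)))"
    using iS by (simp add: prob_space)
  also have "cmod \<dots> \<le> (LINT \<omega>|M. 2 * min 1 \<bar>S (d \<omega>)\<bar>)"
  proof (rule norm_integral_le)
    show "integrable M (\<lambda>\<omega>. 2 * min 1 \<bar>S (d \<omega>)\<bar>)"
      by (rule integrable_const_bound[of _ 2]) (use mS in auto)
  qed (use iS norm_iexp_minus_1_le in auto)
  finally have "1 - cmod (LINT \<omega>|M. iexp (S (d \<omega>))) \<le> 2 * (LINT \<omega>|M. min 1 \<bar>S (d \<omega>)\<bar>)"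
    by simp
  with 1 show ?thesis by (simp add: y_def S_def c_def)
qed

text \<open>
  All differences of two entries have the same second moment.  As the entries sum to 0, the squares
  \<open>(d\<^sub>i - d\<^sub>0)\<^sup>2\<close> add up to at least \<open>n d\<^sub>0\<^sup>2\<close>, so that this common second moment bounds the one of \<open>d\<^sub>0\<close>.
\<close>

lemma exchangeable_second_moment:
  assumes M: "prob_space M" and d: "exchangeable_vector M n d"
    and bound: "\<And>\<omega> i. \<omega> \<in> space M \<Longrightarrow> i < n \<Longrightarrow> \<bar>d \<omega> i\<bar> \<le> 1"
    and sum0: "\<And>\<omega>. \<omega> \<in> space M \<Longrightarrow> (\<Sum>i<n. d \<omega> i) = 0"
    and p: "p \<le> m" "m + p \<le> n" "p > 0"
  shows "real p / real n * (LINT \<omega>|M. (d \<omega> 0)\<^sup>2)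
     \<le> 64 * (LINT \<omega>|M. min 1 \<bar>1 / sqrt n * (\<Sum>i<m. d \<omega> i)\<bar>)"
proof -
  interpret prob_space M by fact
  have n: "n \<ge> 1" using p by simp
  have md: "(\<lambda>\<omega>. d \<omega> i) \<in> borel_measurable M" if "i < n" for i
    using d that by (simp add: exchangeable_vector_def)
  have d2: "(d \<omega> i - d \<omega> j)\<^sup>2 \<le> 4" "(d \<omega> i)\<^sup>2 \<le> 1" if "\<omega> \<in> space M" "i < n" "j < n" for \<omega> i j
  proof -
    have "\<bar>d \<omega> i - d \<omega> j\<bar> \<le> \<bar>2\<bar>" using bound[OF that(1), of i] bound[OF that(1), of j] that by simp
    then show "(d \<omega> i - d \<omega> j)\<^sup>2 \<le> 4" by (simp only: abs_le_square_iff) simp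
    have "\<bar>d \<omega> i\<bar> \<le> \<bar>1\<bar>" using bound[OF that(1), of i] that by simp
    then show "(d \<omega> i)\<^sup>2 \<le> 1" by (simp only: abs_le_square_iff) simp
  qed
  have int: "integrable M (\<lambda>\<omega>. (d \<omega> i - d \<omega> j)\<^sup>2)" if "i < n" "j < n" for i j
    by (rule integrable_const_bound[of _ 4])
      (use d2 that md in \<open>auto intro!: AE_I2 borel_measurable_power borel_measurable_diff\<close>)
  have int0: "integrable M (\<lambda>\<omega>. (d \<omega> 0)\<^sup>2)"
    by (rule integrable_const_bound[of _ 1])
      (use d2(2)[of _ 0] md n in \<open>auto intro!: AE_I2 borel_measurable_power\<close>)
  define D where "D = (LINT \<omega>|M. (d \<omega> m - d \<omega> 0)\<^sup>2)"
  have D: "(LINT \<omega>|M. (d \<omega> i - d \<omega> j)\<^sup>2) = D" if ij: "i < n" "j < n" "i \<noteq> j" for i j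
  proof -
    obtain \<pi> where \<pi>: "\<pi> permutes {..<n}" "\<pi> m = i" "\<pi> 0 = j"
      using exists_permutation_pair[of m "{..<n}" 0 i j] ij p by auto
    have "(LINT \<omega>|M. (d \<omega> (\<pi> m) - d \<omega> (\<pi> 0))\<^sup>2) = D"
      unfolding D_def
    proof (rule exchangeable_vector_integral[OF d \<pi>(1), where H = "\<lambda>v. (v m - v 0)\<^sup>2"])
      show "(\<lambda>(v::nat \<Rightarrow> real). (v m - v 0)\<^sup>2) \<in> borel_measurable (Pi\<^sub>M {..<n} (\<lambda>_. borel))"
        using p by (intro borel_measurable_power borel_measurable_diff measurable_component_singleton) auto
    qed (use p in auto)
    then show ?thesis using \<pi> by simp
  qed
  have D0: "0 \<le> D" unfolding D_def by simp
  have "real n * (LINT \<omega>|M. (d \<omega> 0)\<^sup>2) = (LINT \<omega>|M. real n * (d \<omega> 0)\<^sup>2)" by simp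
  also have "\<dots> \<le> (LINT \<omega>|M. (\<Sum>i<n. (d \<omega> i - d \<omega> 0)\<^sup>2))"
  proof (rule integral_mono)
    fix \<omega> assume \<omega>: "\<omega> \<in> space M"
    have "(\<Sum>i<n. (d \<omega> i - d \<omega> 0)\<^sup>2) = (\<Sum>i<n. (d \<omega> i)\<^sup>2 - 2 * d \<omega> 0 * d \<omega> i + (d \<omega> 0)\<^sup>2)"
      by (simp add: power2_diff algebra_simps)
    also have "\<dots> = (\<Sum>i<n. (d \<omega> i)\<^sup>2) - 2 * d \<omega> 0 * (\<Sum>i<n. d \<omega> i) + n * (d \<omega> 0)\<^sup>2"
      by (simp add: sum.distrib sum_subtractf sum_distrib_left)
    finally show "real n * (d \<omega> 0)\<^sup>2 \<le> (\<Sum>i<n. (d \<omega> i - d \<omega> 0)\<^sup>2)"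
      by (simp add: sum0[OF \<omega>] sum_nonneg)
  qed (use int0 int n in auto)
  also have "\<dots> = (\<Sum>i<n. LINT \<omega>|M. (d \<omega> i - d \<omega> 0)\<^sup>2)"
    by (rule Bochner_Integration.integral_sum) (use int n in auto)
  also have "\<dots> \<le> (\<Sum>i<n. D)"
  proof (rule sum_mono)
    fix i assume i: "i \<in> {..<n}"
    show "(LINT \<omega>|M. (d \<omega> i - d \<omega> 0)\<^sup>2) \<le> D"
      using D[of i 0] D0 i n by (cases "i = 0") auto
  qed
  also have "\<dots> = real n * D" by simp
  finally have 1: "(LINT \<omega>|M. (d \<omega> 0)\<^sup>2) \<le> D" using n by simp
  have "real p * D / (16 * n) = (\<Sum>i<p. LINT \<omega>|M. (d \<omega> (m + i) - d \<omega> i)\<^sup>2) / (16 * n)"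
    using D p by simp
  also have "\<dots> = (LINT \<omega>|M. (\<Sum>i<p. (d \<omega> (m + i) - d \<omega> i)\<^sup>2) / (16 * n))"
    using int p by (subst Bochner_Integration.integral_sum[symmetric]) auto
  also have "\<dots> \<le> 4 * (LINT \<omega>|M. min 1 \<bar>1 / sqrt n * (\<Sum>i<m. d \<omega> i)\<bar>)"
    by (rule exchangeable_pair_differences[OF M d bound p(1,2) n])
  finally have D_le: "real p * D / (16 * n) \<le> 4 * (LINT \<omega>|M. min 1 \<bar>1 / sqrt n * (\<Sum>i<m. d \<omega> i)\<bar>)" .
  have "real p / real n * D = 16 * (real p * D / (16 * n))" by simp
  with D_le have "real p / real n * D \<le> 64 * (LINT \<omega>|M. min 1 \<bar>1 / sqrt n * (\<Sum>i<m. d \<omega> i)\<bar>)"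
    by linarith
  moreover have "real p / real n * (LINT \<omega>|M. (d \<omega> 0)\<^sup>2) \<le> real p / real n * D"
    using 1 by (intro mult_left_mono) auto
  ultimately show ?thesis by linarith
qed

section \<open>Random orthonormal eigenbases with exchangeable rows\<close>

lemma eigendecomposition_rows:
  assumes "ordered_eigendecomposition n A U l" "i < n" "k < n"
  shows "(\<Sum>j<n. U $$ (i, j) * U $$ (k, j)) = (if i = k then 1 else 0)"
proof -
  have U: "U \<in> carrier_mat n n" "U * transpose_mat U = 1\<^sub>m n"
    using assms(1) by (auto simp: ordered_eigendecomposition_def)
  have "(U * transpose_mat U) $$ (i, k) = (if i = k then 1 else 0)"
    unfolding U(2) using assms by simp
  then show ?thesis
    using U(1) assms(2,3) by (simp add: scalar_prod_def lessThan_atLeast0)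
qed

lemma eigendecomposition_cols:
  assumes "ordered_eigendecomposition n A U l" "i < n" "k < n"
  shows "(\<Sum>j<n. U $$ (j, i) * U $$ (j, k)) = (if i = k then 1 else 0)"
proof -
  have U: "U \<in> carrier_mat n n" "U * transpose_mat U = 1\<^sub>m n"
    using assms(1) by (auto simp: ordered_eigendecomposition_def)
  have "transpose_mat U * U = 1\<^sub>m n"
    by (rule mat_mult_left_right_inverse[OF U(1) _ U(2)]) (use U(1) in simp)
  then have "(transpose_mat U * U) $$ (i, k) = (if i = k then 1 else 0)"
    using assms by simp
  then show ?thesis
    using U(1) assms(2,3) by (simp add: scalar_prod_def lessThan_atLeast0)
qed

lemma eigendecomposition_entry:
  assumes "ordered_eigendecomposition n A U l" "i < n" "k < n"
  shows "A $$ (i, k) = (\<Sum>j<n. U $$ (i, j) * l j * U $$ (k, j))"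
proof -
  let ?D = "mat n n (\<lambda>(i, j). if i = j then l j else 0)"
  have U: "U \<in> carrier_mat n n" and A: "A = U * ?D * transpose_mat U"
    using assms(1) by (auto simp: ordered_eigendecomposition_def)
  show ?thesis
    unfolding A using U assms(2,3)
    by (simp add: scalar_prod_def lessThan_atLeast0 if_distrib[of "\<lambda>c. _ * c"] cong: if_cong)
qed

lemma eigendecomposition_apply:
  assumes e: "ordered_eigendecomposition n A U l" and ij: "i < n" "j < n"
  shows "(\<Sum>k<n. A $$ (i, k) * U $$ (k, j)) = l j * U $$ (i, j)"
proof -
  have "(\<Sum>k<n. A $$ (i, k) * U $$ (k, j)) = (\<Sum>k<n. \<Sum>m<n. U $$ (i, m) * l m * (U $$ (k, m) * U $$ (k, j)))"
    by (intro sum.cong refl)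
      (simp add: eigendecomposition_entry[OF e ij(1)] sum_distrib_right mult.assoc)
  also have "\<dots> = (\<Sum>m<n. \<Sum>k<n. U $$ (i, m) * l m * (U $$ (k, m) * U $$ (k, j)))"
    by (rule sum.swap)
  also have "\<dots> = (\<Sum>m<n. U $$ (i, m) * l m * (if m = j then 1 else 0))"
    by (intro sum.cong refl)
      (simp add: sum_distrib_left[symmetric] eigendecomposition_cols[OF e _ ij(2)])
  also have "\<dots> = l j * U $$ (i, j)"
    using ij by (simp add: if_distrib[of "\<lambda>c. _ * c"] cong: if_cong)
  finally show ?thesis .
qed

text \<open>
  Expresses the eigenvalues as polynomials in the entries of \<open>A\<close> and \<open>U\<close>, which makes them random variables.
\<close>

lemma eigendecomposition_value:
  assumes e: "ordered_eigendecomposition n A U l" and j: "j < n"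
  shows "l j = (\<Sum>i<n. U $$ (i, j) * (\<Sum>k<n. A $$ (i, k) * U $$ (k, j)))"
proof -
  have "(\<Sum>i<n. U $$ (i, j) * (\<Sum>k<n. A $$ (i, k) * U $$ (k, j)))
      = (\<Sum>i<n. l j * (U $$ (i, j) * U $$ (i, j)))"
    by (intro sum.cong refl) (simp add: eigendecomposition_apply[OF e _ j])
  also have "\<dots> = l j"
    by (simp add: sum_distrib_left[symmetric] eigendecomposition_cols[OF e j j])
  finally show ?thesis ..
qed

lemma exchangeable_row_sums:
  assumes "abs_rows_exchangeable M n U"
  shows "exchangeable_vector M n (\<lambda>\<omega> i. \<Sum>j<n. c j * (\<bar>U \<omega> $$ (i, j)\<bar>\<^sup>2 - b))"
  unfolding exchangeable_vector_def
proof (intro conjI allI impI)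
  let ?S = "{..<n} \<times> {..<n}"
  let ?Q = "Pi\<^sub>M ?S (\<lambda>_. borel) :: (nat \<times> nat \<Rightarrow> real) measure"
  let ?R = "Pi\<^sub>M {..<n} (\<lambda>_. borel) :: (nat \<Rightarrow> real) measure"
  have mU: "(\<lambda>\<omega>. U \<omega> $$ (i, j)) \<in> borel_measurable M" if "i < n" "j < n" for i j
    using assms that by (simp add: abs_rows_exchangeable_def)
  show "(\<lambda>\<omega>. \<Sum>j<n. c j * (\<bar>U \<omega> $$ (i, j)\<bar>\<^sup>2 - b)) \<in> borel_measurable M" if "i < n" for i
    using that by (intro borel_measurable_sum borel_measurable_times borel_measurable_diff
        borel_measurable_power borel_measurable_abs borel_measurable_const mU) auto
  fix \<pi> assume \<pi>: "\<pi> permutes {..<n}"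
  define T where "T v = (\<lambda>i\<in>{..<n}. \<Sum>j<n. c j * ((v (i, j))\<^sup>2 - b))" for v :: "nat \<times> nat \<Rightarrow> real"
  have mT: "T \<in> ?Q \<rightarrow>\<^sub>M ?R"
    unfolding T_def
    by (intro measurable_restrict borel_measurable_sum borel_measurable_times borel_measurable_diff
        borel_measurable_power borel_measurable_const measurable_component_singleton) auto
  have *: "distr M ?R (\<lambda>\<omega>. \<lambda>i\<in>{..<n}. \<Sum>j<n. c j * (\<bar>U \<omega> $$ (\<sigma> i, j)\<bar>\<^sup>2 - b))
      = distr (distr M ?Q (\<lambda>\<omega>. \<lambda>(i, j)\<in>?S. \<bar>U \<omega> $$ (\<sigma> i, j)\<bar>)) ?R T"
    if \<sigma>: "\<sigma> permutes {..<n}" for \<sigma>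
  proof -
    have less: "\<sigma> i < n" if "i < n" for i
      using permutes_in_image[OF \<sigma>, of i] that by simp
    have "(\<lambda>\<omega>. case x of (i, j) \<Rightarrow> \<bar>U \<omega> $$ (\<sigma> i, j)\<bar>) \<in> borel_measurable M" if "x \<in> ?S" for x
    proof -
      obtain i j where x: "x = (i, j)" "i < n" "j < n" using \<open>x \<in> ?S\<close> by auto
      show ?thesis unfolding x(1) prod.case by (intro borel_measurable_abs mU less x)
    qed
    then have "(\<lambda>\<omega>. \<lambda>(i, j)\<in>?S. \<bar>U \<omega> $$ (\<sigma> i, j)\<bar>) \<in> M \<rightarrow>\<^sub>M ?Q"
      by (rule measurable_restrict)
    then have "distr (distr M ?Q (\<lambda>\<omega>. \<lambda>(i, j)\<in>?S. \<bar>U \<omega> $$ (\<sigma> i, j)\<bar>)) ?R T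
        = distr M ?R (T \<circ> (\<lambda>\<omega>. \<lambda>(i, j)\<in>?S. \<bar>U \<omega> $$ (\<sigma> i, j)\<bar>))"
      by (rule distr_distr[OF mT])
    also have "T \<circ> (\<lambda>\<omega>. \<lambda>(i, j)\<in>?S. \<bar>U \<omega> $$ (\<sigma> i, j)\<bar>)
        = (\<lambda>\<omega>. \<lambda>i\<in>{..<n}. \<Sum>j<n. c j * (\<bar>U \<omega> $$ (\<sigma> i, j)\<bar>\<^sup>2 - b))"
      by (auto simp: T_def fun_eq_iff restrict_def)
    finally show ?thesis ..
  qed
  show "distr M ?R (\<lambda>\<omega>. \<lambda>i\<in>{..<n}. \<Sum>j<n. c j * (\<bar>U \<omega> $$ (\<pi> i, j)\<bar>\<^sup>2 - b))
      = distr M ?R (\<lambda>\<omega>. \<lambda>i\<in>{..<n}. \<Sum>j<n. c j * (\<bar>U \<omega> $$ (i, j)\<bar>\<^sup>2 - b))"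
    using *[OF \<pi>] *[OF permutes_id] assms \<pi> unfolding abs_rows_exchangeable_def by simp
qed

lemma card_nat_window:
  fixes a b :: real
  assumes "a \<le> b" and J: "\<And>j. j \<in> J \<Longrightarrow> a \<le> real (Suc j) \<and> real (Suc j) \<le> b" and fin: "finite J"
  shows "real (card J) \<le> b - a + 1"
proof (cases "J = {}")
  case False
  have "J \<subseteq> {Min J..Max J}" using fin by auto
  then have "card J \<le> card {Min J..Max J}" by (intro card_mono) auto
  moreover have "Min J \<in> J" "Max J \<in> J" "Min J \<le> Max J" using fin False by auto
  ultimately show ?thesis using J[of "Min J"] J[of "Max J"] by auto
qed (use assms in simp)

locale random_eigenbasis = prob_space M for M :: "'w measure" +
  fixes n :: nat and A U :: "'w \<Rightarrow> real mat" and l :: "'w \<Rightarrow> nat \<Rightarrow> real"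
  assumes n: "n \<ge> 1"
    and A_measurable: "\<And>i j. i < n \<Longrightarrow> j < n \<Longrightarrow> (\<lambda>\<omega>. A \<omega> $$ (i, j)) \<in> borel_measurable M"
    and eigen: "\<And>\<omega>. \<omega> \<in> space M \<Longrightarrow> ordered_eigendecomposition n (A \<omega>) (U \<omega>) (l \<omega>)"
    and exch: "abs_rows_exchangeable M n U"
begin

lemma U_measurable: "i < n \<Longrightarrow> j < n \<Longrightarrow> (\<lambda>\<omega>. U \<omega> $$ (i, j)) \<in> borel_measurable M"
  using exch by (simp add: abs_rows_exchangeable_def)

lemma l_measurable:
  assumes j: "j < n"
  shows "(\<lambda>\<omega>. l \<omega> j) \<in> borel_measurable M"
proof -
  have "(\<lambda>\<omega>. \<Sum>i<n. U \<omega> $$ (i, j) * (\<Sum>k<n. A \<omega> $$ (i, k) * U \<omega> $$ (k, j))) \<in> borel_measurable M"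
    using j by (intro borel_measurable_sum borel_measurable_times U_measurable A_measurable) auto
  moreover have "l \<omega> j = (\<Sum>i<n. U \<omega> $$ (i, j) * (\<Sum>k<n. A \<omega> $$ (i, k) * U \<omega> $$ (k, j)))"
    if "\<omega> \<in> space M" for \<omega>
    by (rule eigendecomposition_value[OF eigen[OF that] j])
  ultimately show ?thesis by (simp cong: measurable_cong)
qed

lemma row_norm: "\<omega> \<in> space M \<Longrightarrow> i < n \<Longrightarrow> (\<Sum>j<n. \<bar>U \<omega> $$ (i, j)\<bar>\<^sup>2) = 1"
  using eigendecomposition_rows[OF eigen, of \<omega> i i] by (simp add: power2_eq_square)

lemma col_norm: "\<omega> \<in> space M \<Longrightarrow> j < n \<Longrightarrow> (\<Sum>i<n. \<bar>U \<omega> $$ (i, j)\<bar>\<^sup>2) = 1"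
  using eigendecomposition_cols[OF eigen, of \<omega> j j] by (simp add: power2_eq_square)

lemma entry_le_1: "\<omega> \<in> space M \<Longrightarrow> i < n \<Longrightarrow> j < n \<Longrightarrow> \<bar>U \<omega> $$ (i, j)\<bar>\<^sup>2 \<le> 1"
  using row_norm[of \<omega> i] member_le_sum[of j "{..<n}" "\<lambda>j. \<bar>U \<omega> $$ (i, j)\<bar>\<^sup>2"] by auto

text \<open>
  For \<open>P j \<longleftrightarrow> real (Suc j) \<le> real n * t\<close> these are the row sums of which \<open>process_B\<close> is composed, and for
  \<open>P j \<longleftrightarrow> l \<omega> j \<le> x\<close> (which depends on \<open>\<omega>\<close>) those of \<open>process_C\<close>.
\<close>

definition dev :: "(nat \<Rightarrow> bool) \<Rightarrow> 'w \<Rightarrow> nat \<Rightarrow> real" where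
  "dev P \<omega> i = (\<Sum>j | j < n \<and> P j. (\<bar>U \<omega> $$ (i, j)\<bar>\<^sup>2 - 1 / n))"

lemma dev_eq: "dev P \<omega> i = (\<Sum>j<n. (if P j then 1 else 0) * (\<bar>U \<omega> $$ (i, j)\<bar>\<^sup>2 - 1 / n))"
proof -
  have *: "{j. j < n \<and> P j} = {j \<in> {..<n}. P j}" by auto
  show ?thesis
    unfolding dev_def * sum.inter_filter[OF finite_lessThan] by (intro sum.cong) auto
qed

lemma dev_bound:
  assumes "\<omega> \<in> space M" "i < n"
  shows "\<bar>dev P \<omega> i\<bar> \<le> 1"
proof -
  let ?J = "{j. j < n \<and> P j}"
  have s: "0 \<le> (\<Sum>j\<in>?J. \<bar>U \<omega> $$ (i, j)\<bar>\<^sup>2)" "(\<Sum>j\<in>?J. \<bar>U \<omega> $$ (i, j)\<bar>\<^sup>2) \<le> 1"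
  proof -
    have "(\<Sum>j\<in>?J. \<bar>U \<omega> $$ (i, j)\<bar>\<^sup>2) \<le> (\<Sum>j<n. \<bar>U \<omega> $$ (i, j)\<bar>\<^sup>2)"
      by (rule sum_mono2) auto
    then show "(\<Sum>j\<in>?J. \<bar>U \<omega> $$ (i, j)\<bar>\<^sup>2) \<le> 1" using row_norm[OF assms] by simp
  qed (simp add: sum_nonneg)
  have "card ?J \<le> card {..<n}" by (rule card_mono) auto
  then have c: "0 \<le> real (card ?J) / n" "real (card ?J) / n \<le> 1" using n by auto
  have "dev P \<omega> i = (\<Sum>j\<in>?J. \<bar>U \<omega> $$ (i, j)\<bar>\<^sup>2) - card ?J / n"
    by (simp add: dev_def sum_subtractf)
  moreover have "\<bar>(\<Sum>j\<in>?J. \<bar>U \<omega> $$ (i, j)\<bar>\<^sup>2) - card ?J / n\<bar> \<le> 1"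
    using s c by linarith
  ultimately show ?thesis by simp
qed

lemma dev_exchangeable: "exchangeable_vector M n (dev P)"
  using exchangeable_row_sums[OF exch, of "\<lambda>j. if P j then 1 else 0" "1 / n"]
  unfolding dev_eq[abs_def] .

lemma dev_measurable: "i < n \<Longrightarrow> (\<lambda>\<omega>. dev P \<omega> i) \<in> borel_measurable M"
  using dev_exchangeable by (simp add: exchangeable_vector_def)

lemma dev_sum_rows:
  assumes "\<omega> \<in> space M"
  shows "(\<Sum>i<n. dev P \<omega> i) = 0"
proof -
  have "(\<Sum>i<n. dev P \<omega> i) = (\<Sum>j | j < n \<and> P j. \<Sum>i<n. (\<bar>U \<omega> $$ (i, j)\<bar>\<^sup>2 - 1 / n))"
    unfolding dev_def by (rule sum.swap)
  also have "\<dots> = 0"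
  proof (rule sum.neutral, intro ballI)
    fix j assume "j \<in> {j. j < n \<and> P j}"
    then show "(\<Sum>i<n. (\<bar>U \<omega> $$ (i, j)\<bar>\<^sup>2 - 1 / n)) = 0"
      using n col_norm[OF assms, of j] by (simp add: sum_subtractf)
  qed
  finally show ?thesis .
qed

lemma process_B_eq_dev:
  assumes "0 \<le> s" "s \<le> 1"
  shows "process_B n (U \<omega>) (s, t)
    = 1 / sqrt n * (\<Sum>i<nat \<lfloor>real n * s\<rfloor>. dev (\<lambda>j. real (Suc j) \<le> real n * t) \<omega> i)"
proof -
  have ns: "real n * s \<le> real n" "0 \<le> real n * s" using assms by (simp_all add: mult_left_le)
  have iff: "i < n \<and> real (Suc i) \<le> real n * s \<longleftrightarrow> i < nat \<lfloor>real n * s\<rfloor>" for i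
  proof
    assume "i < n \<and> real (Suc i) \<le> real n * s"
    then show "i < nat \<lfloor>real n * s\<rfloor>" using le_nat_floor[of "Suc i"] by (simp add: Suc_le_eq)
  next
    assume "i < nat \<lfloor>real n * s\<rfloor>"
    then have "real (Suc i) \<le> real (nat \<lfloor>real n * s\<rfloor>)" by (simp only: of_nat_le_iff Suc_le_eq)
    also have "\<dots> \<le> real n * s" by (rule of_nat_floor[OF ns(2)])
    finally show "i < n \<and> real (Suc i) \<le> real n * s" using ns(1) by auto
  qed
  then have "{i. i < n \<and> real (Suc i) \<le> real n * s} = {..<nat \<lfloor>real n * s\<rfloor>}"
    by (simp add: lessThan_def)
  then show ?thesis by (simp add: process_B_def dev_def)
qed

lemma dev_second_moment:
  assumes s: "0 < s" "s < 1" and large: "2 \<le> real n * s" "2 \<le> real n * (1 - s)"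
  shows "min s (1 - s) / 2 * (LINT \<omega>|M. (dev (\<lambda>j. real (Suc j) \<le> real n * t) \<omega> 0)\<^sup>2)
     \<le> 64 * (LINT \<omega>|M. min 1 \<bar>process_B n (U \<omega>) (s, t)\<bar>)"
proof -
  define P where "P j \<longleftrightarrow> real (Suc j) \<le> real n * t" for j
  define m where "m = nat \<lfloor>real n * s\<rfloor>"
  \<comment> \<open>The number of disjoint pairs with one index inside and one outside of the sum.\<close>
  define p where "p = min m (n - m)"
  have m: "real n * s - 1 \<le> real m" "real m \<le> real n * s"
  proof -
    have "0 \<le> real n * s" using s by simp
    then show "real m \<le> real n * s" unfolding m_def by (rule of_nat_floor)
    have "real_of_int \<lfloor>real n * s\<rfloor> \<le> real m" unfolding m_def by simp
    then show "real n * s - 1 \<le> real m" using real_of_int_floor_gt_diff_one[of "real n * s"] by linarith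
  qed
  have ns: "real n * s \<le> real n" using s by (simp add: mult_left_le)
  then have mn: "m \<le> n" using m(2) by linarith
  have h1: "real n * s / 2 \<le> real m" using m(1) large(1) by linarith
  have "real n * (1 - s) = real n - real n * s" by (simp add: right_diff_distrib)
  then have h2: "real n * (1 - s) / 2 \<le> real (n - m)"
    using m(2) mn large(2) by (simp add: of_nat_diff)
  have h3: "real n * min s (1 - s) \<le> real n * s" "real n * min s (1 - s) \<le> real n * (1 - s)"
    by (auto intro!: mult_left_mono)
  have pn: "real n * min s (1 - s) / 2 \<le> real p"
  proof (cases "m \<le> n - m")
    case True
    then have "p = m" by (simp add: p_def)
    then show ?thesis using h1 h3(1) by linarith
  next
    case False
    then have "p = n - m" by (simp add: p_def)
    then show ?thesis using h2 h3(2) by linarith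
  qed
  have "0 < real n * min s (1 - s) / 2" using n s by simp
  then have p0: "p > 0" using pn by linarith
  have "min s (1 - s) / 2 \<le> real p / real n" using pn n by (simp add: field_simps)
  then have "min s (1 - s) / 2 * (LINT \<omega>|M. (dev P \<omega> 0)\<^sup>2) \<le> real p / real n * (LINT \<omega>|M. (dev P \<omega> 0)\<^sup>2)"
    by (rule mult_right_mono) simp
  also have "\<dots> \<le> 64 * (LINT \<omega>|M. min 1 \<bar>1 / sqrt n * (\<Sum>i<m. dev P \<omega> i)\<bar>)"
    by (rule exchangeable_second_moment[OF prob_space_axioms dev_exchangeable])
      (use dev_bound dev_sum_rows p0 mn in \<open>auto simp: p_def\<close>)
  finally show ?thesis
    using s unfolding P_def m_def by (simp add: process_B_eq_dev)
qed

lemma entry_expectation: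
  assumes j: "j < n"
  shows "(LINT \<omega>|M. \<bar>U \<omega> $$ (0, j)\<bar>\<^sup>2) = 1 / n"
    and "integrable M (\<lambda>\<omega>. \<bar>U \<omega> $$ (0, j)\<bar>\<^sup>2)"
proof -
  have int: "integrable M (\<lambda>\<omega>. \<bar>U \<omega> $$ (i, j)\<bar>\<^sup>2)" if "i < n" for i
    by (rule integrable_const_bound[of _ 1])
      (use U_measurable[OF that j] entry_le_1 that j in auto)
  then show "integrable M (\<lambda>\<omega>. \<bar>U \<omega> $$ (0, j)\<bar>\<^sup>2)" using n by auto
  define d where "d = (\<lambda>\<omega> i. \<Sum>k<n. (if k = j then 1 else 0) * (\<bar>U \<omega> $$ (i, k)\<bar>\<^sup>2 - 0))"
  have d: "exchangeable_vector M n d"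
    unfolding d_def by (rule exchangeable_row_sums[OF exch])
  have d_eq: "d \<omega> i = \<bar>U \<omega> $$ (i, j)\<bar>\<^sup>2" for \<omega> i
    using j by (simp add: d_def if_distrib[of "\<lambda>c. c * _"] cong: if_cong)
  have same: "(LINT \<omega>|M. d \<omega> i) = (LINT \<omega>|M. d \<omega> 0)" if i: "i < n" for i
  proof -
    have \<pi>: "Transposition.transpose 0 i permutes {..<n}"
      using i n by (intro permutes_swap_id) auto
    have "(LINT \<omega>|M. d \<omega> (Transposition.transpose 0 i 0)) = (LINT \<omega>|M. d \<omega> 0)"
      by (rule exchangeable_vector_integral[OF d \<pi>, where H = "\<lambda>v. v 0"])
        (use n in \<open>auto intro: measurable_component_singleton\<close>)
    then show ?thesis by simp
  qed
  have sum1: "(\<Sum>i<n. d \<omega> i) = 1" if "\<omega> \<in> space M" for \<omega>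
    using col_norm[OF that j] by (simp add: d_eq)
  have "1 = (LINT \<omega>|M. (1::real))" by (simp add: prob_space)
  also have "\<dots> = (LINT \<omega>|M. (\<Sum>i<n. d \<omega> i))"
    by (rule Bochner_Integration.integral_cong[OF refl]) (simp add: sum1)
  also have "\<dots> = (\<Sum>i<n. LINT \<omega>|M. d \<omega> i)"
    by (rule Bochner_Integration.integral_sum) (use int in \<open>auto simp: d_eq\<close>)
  also have "\<dots> = (\<Sum>i<n. LINT \<omega>|M. d \<omega> 0)"
    by (rule sum.cong[OF refl], rule same) simp
  also have "\<dots> = n * (LINT \<omega>|M. d \<omega> 0)" by simp
  finally show "(LINT \<omega>|M. \<bar>U \<omega> $$ (0, j)\<bar>\<^sup>2) = 1 / n"
    using n by (simp add: d_eq field_simps)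
qed

definition counting :: "real \<Rightarrow> 'w \<Rightarrow> real" where
  "counting x \<omega> = real (card {j. j < n \<and> l \<omega> j \<le> x}) / n"

lemma counting_eq: "counting x \<omega> = (\<Sum>j<n. indicator {..x} (l \<omega> j)) / n"
proof -
  have "{j. j < n \<and> l \<omega> j \<le> x} = {j \<in> {..<n}. l \<omega> j \<le> x}" by auto
  then have "real (card {j. j < n \<and> l \<omega> j \<le> x}) = (\<Sum>j\<in>{j \<in> {..<n}. l \<omega> j \<le> x}. 1)"
    by simp
  also have "\<dots> = (\<Sum>j<n. if l \<omega> j \<le> x then 1 else 0)"
    by (rule sum.inter_filter) simp
  also have "\<dots> = (\<Sum>j<n. indicator {..x} (l \<omega> j))"
    by (rule sum.cong) (auto simp: indicator_def)
  finally show ?thesis by (simp add: counting_def)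
qed

lemma counting_measurable: "counting x \<in> borel_measurable M"
proof -
  have "(\<lambda>\<omega>. indicator {..x} (l \<omega> j) :: real) \<in> borel_measurable M" if "j < n" for j
    by (rule measurable_compose[OF l_measurable[OF that]]) simp
  then show ?thesis
    unfolding counting_eq[abs_def] by (intro borel_measurable_divide borel_measurable_sum) auto
qed

lemma initial_segment:
  assumes "\<omega> \<in> space M"
  shows "{j. j < n \<and> l \<omega> j \<le> x} = {..<card {j. j < n \<and> l \<omega> j \<le> x}}"
proof -
  let ?L = "{j. j < n \<and> l \<omega> j \<le> x}"
  have mono: "mono_on {..<n} (l \<omega>)"
    using eigen[OF assms] by (simp add: ordered_eigendecomposition_def)
  have down: "i \<in> ?L" if "j \<in> ?L" "i \<le> j" for i j
    using that mono_onD[OF mono, of i j] by force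
  have fin: "finite ?L" by simp
  show ?thesis
  proof (rule card_subset_eq[OF _ _, symmetric])
    show "{..<card ?L} \<subseteq> ?L"
    proof
      fix i assume i: "i \<in> {..<card ?L}"
      show "i \<in> ?L"
      proof (rule ccontr)
        assume "i \<notin> ?L"
        have "j < i" if "j \<in> ?L" for j
          using down[OF that, of i] \<open>i \<notin> ?L\<close> not_less by blast
        then have "?L \<subseteq> {..<i}" by blast
        then have "card ?L \<le> i" using card_mono[of "{..<i}" ?L] by simp
        then show False using i by simp
      qed
    qed
  qed auto
qed

definition row_cdf_dev :: "real \<Rightarrow> 'w \<Rightarrow> real" where
  "row_cdf_dev x \<omega> = (\<Sum>j<n. indicator {..x} (l \<omega> j) * (\<bar>U \<omega> $$ (0, j)\<bar>\<^sup>2 - 1 / n))"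

lemma row_cdf_dev_eq: "row_cdf_dev x \<omega> = dev (\<lambda>j. l \<omega> j \<le> x) \<omega> 0"
  unfolding row_cdf_dev_def dev_eq by (rule sum.cong) (auto simp: indicator_def)

lemma row_cdf_dev_measurable: "row_cdf_dev x \<in> borel_measurable M"
proof -
  have "(\<lambda>\<omega>. indicator {..x} (l \<omega> j) :: real) \<in> borel_measurable M" if "j < n" for j
    by (rule measurable_compose[OF l_measurable[OF that]]) simp
  then show ?thesis
    unfolding row_cdf_dev_def[abs_def] using n
    by (intro borel_measurable_sum borel_measurable_times borel_measurable_diff
        borel_measurable_power borel_measurable_abs borel_measurable_const U_measurable) auto
qed

text \<open>
  Eigenvalues are ordered, so the condition \<open>l \<omega> j \<le> x\<close> selects an initial segment of the indices.  If its length
  is within \<open>n \<epsilon>\<close> of \<open>n t\<close>, then it differs from the first \<open>n t\<close> indices only in a deterministic window.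
\<close>

lemma row_cdf_dev_pointwise:
  assumes \<omega>: "\<omega> \<in> space M"
  shows "\<bar>row_cdf_dev x \<omega>\<bar> \<le> \<bar>dev (\<lambda>j. real (Suc j) \<le> real n * t) \<omega> 0\<bar>
     + (\<Sum>j | j < n \<and> \<bar>real (Suc j) - real n * t\<bar> \<le> real n * \<epsilon>. \<bar>U \<omega> $$ (0, j)\<bar>\<^sup>2 + 1 / n)
     + indicator {\<omega>. \<bar>counting x \<omega> - t\<bar> > \<epsilon>} \<omega>"
proof -
  let ?J = "{j. j < n \<and> \<bar>real (Suc j) - real n * t\<bar> \<le> real n * \<epsilon>}"
  let ?d = "\<lambda>j. \<bar>U \<omega> $$ (0, j)\<bar>\<^sup>2 - 1 / n" and ?a = "\<lambda>j. \<bar>U \<omega> $$ (0, j)\<bar>\<^sup>2 + 1 / n"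
  have a0: "0 \<le> (\<Sum>j\<in>?J. ?a j)" by (intro sum_nonneg) auto
  show ?thesis
  proof (cases "\<bar>counting x \<omega> - t\<bar> > \<epsilon>")
    case True
    have "\<bar>row_cdf_dev x \<omega>\<bar> \<le> 1" unfolding row_cdf_dev_eq using dev_bound \<omega> n by simp
    moreover have "indicator {\<omega>. \<bar>counting x \<omega> - t\<bar> > \<epsilon>} \<omega> = (1::real)" using True by simp
    ultimately show ?thesis using a0 abs_ge_zero[of "dev (\<lambda>j. real (Suc j) \<le> real n * t) \<omega> 0"] by linarith
  next
    case False
    define N where "N = card {j. j < n \<and> l \<omega> j \<le> x}"
    have L: "j < n \<and> l \<omega> j \<le> x \<longleftrightarrow> j < N" for j
    proof -
      have "(j \<in> {j. j < n \<and> l \<omega> j \<le> x}) = (j \<in> {..<N})"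
        unfolding N_def by (rule arg_cong[OF initial_segment[OF \<omega>]])
      then show ?thesis by simp
    qed
    have "\<bar>real N / real n - t\<bar> \<le> \<epsilon>" using False by (simp add: counting_def N_def)
    then have "real n * \<bar>real N / real n - t\<bar> \<le> real n * \<epsilon>" by (intro mult_left_mono) auto
    moreover have "real n * \<bar>real N / real n - t\<bar> = \<bar>real N - real n * t\<bar>"
      using n by (simp add: abs_mult_pos' right_diff_distrib)
    ultimately have N: "\<bar>real N - real n * t\<bar> \<le> real n * \<epsilon>" by simp
    let ?D = "dev (\<lambda>j. real (Suc j) \<le> real n * t) \<omega> 0"
    have diff: "row_cdf_dev x \<omega> - ?D = (\<Sum>j<n. ((if l \<omega> j \<le> x then 1 else 0) - (if real (Suc j) \<le> real n * t then 1 else 0)) * ?d j)"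
      unfolding row_cdf_dev_eq dev_eq sum_subtractf[symmetric] by (simp only: left_diff_distrib)
    have "\<bar>row_cdf_dev x \<omega> - ?D\<bar> \<le> (\<Sum>j<n. if j \<in> ?J then ?a j else 0)"
      unfolding diff
    proof (rule order_trans[OF sum_abs], rule sum_mono)
      fix j assume "j \<in> {..<n}"
      then have j: "j < n" by simp
      have d: "\<bar>?d j\<bar> \<le> ?a j" by (simp add: abs_le_iff)
      show "\<bar>((if l \<omega> j \<le> x then 1 else 0) - (if real (Suc j) \<le> real n * t then 1 else 0)) * ?d j\<bar>
          \<le> (if j \<in> ?J then ?a j else 0)"
      proof (cases "j \<in> ?J")
        case True
        then show ?thesis using d by auto
      next
        case False
        then have "l \<omega> j \<le> x \<longleftrightarrow> real (Suc j) \<le> real n * t"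
          using L[of j] j N by auto
        then show ?thesis using False by simp
      qed
    qed
    also have "\<dots> = (\<Sum>j\<in>?J. ?a j)"
    proof -
      have "(\<Sum>j\<in>{j \<in> {..<n}. j \<in> ?J}. ?a j) = (\<Sum>j<n. if j \<in> ?J then ?a j else 0)"
        by (rule sum.inter_filter) simp
      moreover have "{j \<in> {..<n}. j \<in> ?J} = ?J" by auto
      ultimately show ?thesis by simp
    qed
    finally have "\<bar>row_cdf_dev x \<omega> - ?D\<bar> \<le> (\<Sum>j\<in>?J. ?a j)" .
    moreover have "indicator {\<omega>. \<bar>counting x \<omega> - t\<bar> > \<epsilon>} \<omega> = (0::real)" using False by simp
    ultimately show ?thesis by linarith
  qed
qed

text \<open>
  The window has at most \<open>2 n \<epsilon> + 1\<close> indices and is deterministic, so its contribution is controlled by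
  \<open>E U\<^sub>0\<^sub>j\<^sup>2 = 1 / n\<close>, although \<open>U\<^sub>0\<^sub>j\<close> and the eigenvalues are dependent.
\<close>

lemma row_cdf_dev_expectation:
  assumes \<epsilon>: "\<epsilon> > 0"
  shows "(LINT \<omega>|M. \<bar>row_cdf_dev x \<omega>\<bar>)
    \<le> sqrt (LINT \<omega>|M. (dev (\<lambda>j. real (Suc j) \<le> real n * t) \<omega> 0)\<^sup>2)
      + (4 * \<epsilon> + 2 / n) + prob {\<omega> \<in> space M. \<bar>counting x \<omega> - t\<bar> > \<epsilon>}"
proof -
  let ?J = "{j. j < n \<and> \<bar>real (Suc j) - real n * t\<bar> \<le> real n * \<epsilon>}"
  let ?D = "\<lambda>\<omega>. dev (\<lambda>j. real (Suc j) \<le> real n * t) \<omega> 0"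
  let ?a = "\<lambda>\<omega> j. \<bar>U \<omega> $$ (0, j)\<bar>\<^sup>2 + 1 / n"
  let ?E = "{\<omega> \<in> space M. \<bar>counting x \<omega> - t\<bar> > \<epsilon>}"
  have E: "?E \<in> sets M" using counting_measurable[of x] by measurable
  have mD: "?D \<in> borel_measurable M" using dev_measurable n by simp
  have iD2: "integrable M (\<lambda>\<omega>. (?D \<omega>)\<^sup>2)"
    by (rule integrable_const_bound[of _ 1])
      (use mD dev_bound[of _ 0] n in \<open>auto intro!: AE_I2 simp: abs_square_le_1\<close>)
  note D = integral_abs_le_sqrt[OF prob_space_axioms iD2 mD]
  have ia: "integrable M (\<lambda>\<omega>. ?a \<omega> j)" if "j \<in> ?J" for j
    using entry_expectation(2)[of j] that by simp
  have iE: "integrable M (indicator ?E :: 'w \<Rightarrow> real)"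
    by (rule integrable_const_bound[of _ 1]) (use E in \<open>auto simp: indicator_def\<close>)
  have ie: "integrable M (\<lambda>\<omega>. \<bar>row_cdf_dev x \<omega>\<bar>)"
    by (rule integrable_const_bound[of _ 1])
      (use row_cdf_dev_measurable dev_bound n in \<open>auto intro!: AE_I2 simp: row_cdf_dev_eq[symmetric]\<close>,
       simp add: row_cdf_dev_eq dev_bound)
  have "(LINT \<omega>|M. \<bar>row_cdf_dev x \<omega>\<bar>) \<le> (LINT \<omega>|M. \<bar>?D \<omega>\<bar> + (\<Sum>j\<in>?J. ?a \<omega> j) + indicator ?E \<omega>)"
  proof (rule integral_mono[OF ie])
    show "integrable M (\<lambda>\<omega>. \<bar>?D \<omega>\<bar> + (\<Sum>j\<in>?J. ?a \<omega> j) + indicator ?E \<omega>)"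
      by (intro Bochner_Integration.integrable_add integrable_abs[OF D(1)]
          Bochner_Integration.integrable_sum[OF ia] iE)
    show "\<bar>row_cdf_dev x \<omega>\<bar> \<le> \<bar>?D \<omega>\<bar> + (\<Sum>j\<in>?J. ?a \<omega> j) + indicator ?E \<omega>" if "\<omega> \<in> space M" for \<omega>
      using row_cdf_dev_pointwise[OF that, of x t \<epsilon>] that by (simp add: indicator_def)
  qed
  also have "\<dots> = (LINT \<omega>|M. \<bar>?D \<omega>\<bar>) + (LINT \<omega>|M. (\<Sum>j\<in>?J. ?a \<omega> j)) + (LINT \<omega>|M. indicator ?E \<omega>)"
  proof -
    have *: "(LINT \<omega>|M. F \<omega> + G \<omega> + H \<omega>) = (LINT \<omega>|M. F \<omega>) + (LINT \<omega>|M. G \<omega>) + (LINT \<omega>|M. H \<omega>)"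
      if "integrable M F" "integrable M G" "integrable M H" for F G H :: "'w \<Rightarrow> real"
      using that by simp
    show ?thesis
      by (rule *[OF integrable_abs[OF D(1)] Bochner_Integration.integrable_sum[OF ia]
            iE])
  qed
  also have "(LINT \<omega>|M. indicator ?E \<omega>) = prob ?E"
    using E sets.sets_into_space[OF E] by (simp add: Int_absorb2)
  also have "(LINT \<omega>|M. (\<Sum>j\<in>?J. ?a \<omega> j)) = (\<Sum>j\<in>?J. LINT \<omega>|M. ?a \<omega> j)"
    by (rule Bochner_Integration.integral_sum[OF ia])
  also have "(\<Sum>j\<in>?J. LINT \<omega>|M. ?a \<omega> j) = card ?J * (2 / n)"
  proof -
    have "(LINT \<omega>|M. ?a \<omega> j) = 2 / n" if "j \<in> ?J" for j
    proof -
      have "(LINT \<omega>|M. ?a \<omega> j) = (LINT \<omega>|M. \<bar>U \<omega> $$ (0, j)\<bar>\<^sup>2) + 1 / n"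
        using entry_expectation(2)[of j] that by (simp add: prob_space del: power2_abs)
      then show ?thesis using entry_expectation(1)[of j] that by simp
    qed
    then show ?thesis by simp
  qed
  also have "\<dots> \<le> (2 * (real n * \<epsilon>) + 1) * (2 / n)"
  proof (rule mult_right_mono)
    show "real (card ?J) \<le> 2 * (real n * \<epsilon>) + 1"
    proof -
      have "real (card ?J) \<le> (real n * t + real n * \<epsilon>) - (real n * t - real n * \<epsilon>) + 1"
      proof (rule card_nat_window)
        show "real n * t - real n * \<epsilon> \<le> real n * t + real n * \<epsilon>" using \<epsilon> by simp
        show "real n * t - real n * \<epsilon> \<le> real (Suc j) \<and> real (Suc j) \<le> real n * t + real n * \<epsilon>"
          if "j \<in> ?J" for j
        proof -
          have "\<bar>real (Suc j) - real n * t\<bar> \<le> real n * \<epsilon>" using that by blast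
          then show ?thesis by linarith
        qed
      qed simp
      then show ?thesis by linarith
    qed
  qed simp
  also have "(2 * (real n * \<epsilon>) + 1) * (2 / n) = 4 * \<epsilon> + 2 / n"
    using n by (simp add: field_simps)
  finally show ?thesis using D(2) by linarith
qed

definition row_average :: "(real \<Rightarrow> real) \<Rightarrow> 'w \<Rightarrow> real" where
  "row_average f \<omega> = (\<Sum>j<n. \<bar>U \<omega> $$ (0, j)\<bar>\<^sup>2 * f (l \<omega> j))"

definition spectral_average :: "(real \<Rightarrow> real) \<Rightarrow> 'w \<Rightarrow> real" where
  "spectral_average f \<omega> = (\<Sum>j<n. f (l \<omega> j)) / n"

lemma average_measurable:
  assumes "f \<in> borel_measurable borel"
  shows "spectral_average f \<in> borel_measurable M" "row_average f \<in> borel_measurable M"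
proof -
  have m: "(\<lambda>\<omega>. f (l \<omega> j)) \<in> borel_measurable M" if "j < n" for j
    by (rule measurable_compose[OF l_measurable[OF that] assms])
  show "spectral_average f \<in> borel_measurable M"
    unfolding spectral_average_def[abs_def]
    by (intro borel_measurable_divide borel_measurable_sum m) auto
  show "row_average f \<in> borel_measurable M"
    unfolding row_average_def[abs_def] using n
    by (intro borel_measurable_times borel_measurable_sum borel_measurable_power borel_measurable_abs
        U_measurable m) auto
qed

lemma average_bounds:
  assumes f: "\<And>y. \<bar>f y\<bar> \<le> 1" and \<omega>: "\<omega> \<in> space M"
  shows "\<bar>spectral_average f \<omega>\<bar> \<le> 1" "\<bar>row_average f \<omega>\<bar> \<le> 1"
proof -
  have "\<bar>\<Sum>j<n. f (l \<omega> j)\<bar> \<le> (\<Sum>j<n. 1)" by (rule order_trans[OF sum_abs]) (intro sum_mono f)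
  then show "\<bar>spectral_average f \<omega>\<bar> \<le> 1" using n by (simp add: spectral_average_def)
  have "\<bar>row_average f \<omega>\<bar> \<le> (\<Sum>j<n. \<bar>U \<omega> $$ (0, j)\<bar>\<^sup>2)"
    unfolding row_average_def
    by (rule order_trans[OF sum_abs]) (intro sum_mono, simp add: abs_mult mult_left_le f)
  then show "\<bar>row_average f \<omega>\<bar> \<le> 1" using row_norm[OF \<omega>, of 0] n by simp
qed

lemma average_difference:
  assumes "\<omega> \<in> space M"
  shows "row_average f \<omega> - spectral_average f \<omega> = (\<Sum>j<n. f (l \<omega> j) * (\<bar>U \<omega> $$ (0, j)\<bar>\<^sup>2 - 1 / n))"
proof -
  have "(\<Sum>j<n. f (l \<omega> j) * (\<bar>U \<omega> $$ (0, j)\<bar>\<^sup>2 - 1 / n))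
      = (\<Sum>j<n. \<bar>U \<omega> $$ (0, j)\<bar>\<^sup>2 * f (l \<omega> j) - f (l \<omega> j) / n)"
    by (rule sum.cong) (simp_all add: algebra_simps)
  then show ?thesis
    unfolding row_average_def spectral_average_def by (simp only: sum_subtractf sum_divide_distrib)
qed

end

section \<open>Convergence of the spectral measure at a basis vector\<close>

text \<open>
  Only countably many points are atoms.
\<close>

lemma (in real_distribution) ex_continuity_point:
  assumes "a < b"
  shows "\<exists>c. a < c \<and> c < b \<and> isCont (cdf M) c"
proof -
  have "uncountable {a<..<b}" using assms by (simp add: uncountable_open_interval)
  then have "\<not> {a<..<b} \<subseteq> {x. measure M {x} > 0}"
    using countable_atoms countable_subset by blast
  then obtain c where "c \<in> {a<..<b}" "c \<notin> {x. measure M {x} > 0}" by blast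
  then have c: "c \<in> {a<..<b}" "\<not> measure M {c} > 0" by simp_all
  then have "measure M {c} = 0" by (simp add: order_antisym not_less)
  then show ?thesis using c by (auto simp: isCont_cdf)
qed

definition step_function :: "(real \<Rightarrow> real) \<Rightarrow> (nat \<Rightarrow> real) \<Rightarrow> nat \<Rightarrow> real \<Rightarrow> real" where
  "step_function f c L y = (\<Sum>i<L. f (c i) * (indicator {..c (Suc i)} y - indicator {..c i} y))"

lemma step_function_inside:
  assumes mono: "\<forall>i. c i < c (Suc i)" and y: "c 0 < y" "y \<le> c L"
  shows "\<exists>i<L. c i < y \<and> y \<le> c (Suc i) \<and> step_function f c L y = f (c i)"
  using y(2)
proof (induction L)
  case 0
  then show ?case using y(1) by simp
next
  case (Suc L)
  show ?case
  proof (cases "y \<le> c L")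
    case True
    then obtain i where i: "i < L" "c i < y" "y \<le> c (Suc i)" "step_function f c L y = f (c i)"
      using Suc.IH by blast
    have "step_function f c (Suc L) y = step_function f c L y"
      using True mono[rule_format, of L] by (simp add: step_function_def indicator_def)
    then show ?thesis using i by (intro exI[of _ i]) auto
  next
    case False
    have less: "c i \<le> c L" if "i \<le> L" for i
      by (rule lift_Suc_mono_le[OF _ that]) (use mono in \<open>auto intro: less_imp_le\<close>)
    have "step_function f c L y = 0"
      unfolding step_function_def
    proof (rule sum.neutral, intro ballI)
      fix i assume "i \<in> {..<L}"
      then have "c i < y" "c (Suc i) < y" using less[of i] less[of "Suc i"] False by auto
      then show "f (c i) * (indicator {..c (Suc i)} y - indicator {..c i} y) = 0" by simp
    qed
    then have "step_function f c (Suc L) y = f (c L)"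
      using False Suc.prems by (simp add: step_function_def)
    then show ?thesis using False Suc.prems by (intro exI[of _ L]) auto
  qed
qed

lemma step_function_outside:
  assumes mono: "\<forall>i. c i < c (Suc i)" and y: "y \<le> c 0 \<or> c L < y"
  shows "step_function f c L y = 0"
  unfolding step_function_def
proof (rule sum.neutral, intro ballI)
  have less: "c i \<le> c j" if "i \<le> j" for i j
    by (rule lift_Suc_mono_le[OF _ that]) (use mono in \<open>auto intro: less_imp_le\<close>)
  fix i assume i: "i \<in> {..<L}"
  have "y \<le> c i \<and> y \<le> c (Suc i) \<or> c i < y \<and> c (Suc i) < y"
    using y
  proof
    assume "y \<le> c 0"
    then show ?thesis using less[of 0 i] less[of 0 "Suc i"] by linarith
  next
    assume "c L < y"
    then show ?thesis using less[of i L] less[of "Suc i" L] i by auto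
  qed
  then show "f (c i) * (indicator {..c (Suc i)} y - indicator {..c i} y) = 0" by auto
qed

text \<open>
  The jumps are placed at continuity points of the distribution function in consecutive intervals of
  length \<open>\<eta> / 2\<close>, far enough to both sides for \<open>f\<close> to be at most \<open>\<eta>\<close> outside.
\<close>

lemma (in real_distribution) ex_step_approximation:
  fixes f :: "real \<Rightarrow> real"
  assumes lip: "\<And>y z. \<bar>f y - f z\<bar> \<le> \<bar>y - z\<bar>" and decay: "\<And>y. \<bar>f y\<bar> * \<bar>y\<bar> \<le> 1" and \<eta>: "\<eta> > 0"
  shows "\<exists>c L. (\<forall>i. isCont (cdf M) (c i)) \<and> (\<forall>y. \<bar>f y - step_function f c L y\<bar> \<le> \<eta>)"
proof -
  define \<delta> where "\<delta> = \<eta> / 2"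
  have \<delta>: "\<delta> > 0" using \<eta> by (simp add: \<delta>_def)
  \<comment> \<open>The first jump lies below \<open>\<delta> - R = - 1 / \<eta>\<close>, where
    \<open>f\<close> is small; the last one will lie above \<open>R\<close>.\<close>
  define R where "R = 1 / \<eta> + \<delta>"
  have "\<exists>c. - R + real i * \<delta> < c \<and> c < - R + real (Suc i) * \<delta> \<and> isCont (cdf M) c" for i
    by (rule ex_continuity_point) (use \<delta> in \<open>simp add: algebra_simps\<close>)
  then obtain c where c: "\<And>i. - R + real i * \<delta> < c i" "\<And>i. c i < - R + real (Suc i) * \<delta>"
      "\<And>i. isCont (cdf M) (c i)"
    by metis
  have mono: "\<forall>i. c i < c (Suc i)"
  proof
    show "c i < c (Suc i)" for i using c(2)[of i] c(1)[of "Suc i"] by linarith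
  qed
  obtain L where L: "2 * R < real L * \<delta>"
    using ex_less_of_nat_mult[OF \<delta>, of "2 * R"] by blast
  have far: "\<bar>f y\<bar> \<le> \<eta>" if "1 / \<eta> \<le> \<bar>y\<bar>" for y
  proof -
    have "\<bar>f y\<bar> * (1 / \<eta>) \<le> \<bar>f y\<bar> * \<bar>y\<bar>" using that by (intro mult_left_mono) auto
    then have "\<bar>f y\<bar> * (1 / \<eta>) \<le> 1" using decay[of y] by linarith
    then show ?thesis using \<eta> by (simp add: field_simps)
  qed
  have "\<bar>f y - step_function f c L y\<bar> \<le> \<eta>" for y
  proof (cases "c 0 < y \<and> y \<le> c L")
    case True
    then obtain i where i: "c i < y" "y \<le> c (Suc i)" "step_function f c L y = f (c i)"
      using step_function_inside[OF mono] by blast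
    have "\<bar>f y - f (c i)\<bar> \<le> \<bar>y - c i\<bar>" by (rule lip)
    also have "\<dots> \<le> 2 * \<delta>" using i c(1)[of i] c(2)[of "Suc i"] by (simp add: algebra_simps)
    finally show ?thesis using i(3) by (simp add: \<delta>_def)
  next
    case False
    have c0: "c 0 < - (1 / \<eta>)" using c(2)[of 0] by (simp add: R_def)
    have cL: "R < c L" using c(1)[of L] L by linarith
    have "1 / \<eta> \<le> R" using \<delta> by (simp add: R_def)
    then have "1 / \<eta> \<le> \<bar>y\<bar>" using False c0 cL by linarith
    then show ?thesis using far step_function_outside[OF mono, of y L f] False by auto
  qed
  then show ?thesis using c(3) by blast
qed

locale eigenbasis_sequence = real_distribution \<mu> for \<mu> :: "real measure" +
  fixes M :: "nat \<Rightarrow> 'w measure" and A U :: "nat \<Rightarrow> 'w \<Rightarrow> real mat" and l :: "nat \<Rightarrow> 'w \<Rightarrow> nat \<Rightarrow> real"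
  assumes basis: "\<And>n. n \<ge> 1 \<Longrightarrow> random_eigenbasis (M n) n (A n) (U n) (l n)"
    and spectral: "spectral_law_converges M l \<mu>"
begin

abbreviation counting where "counting n \<equiv> random_eigenbasis.counting n (l n)"
abbreviation dev where "dev n \<equiv> random_eigenbasis.dev n (U n)"
abbreviation row_cdf_dev where "row_cdf_dev n \<equiv> random_eigenbasis.row_cdf_dev n (U n) (l n)"
abbreviation row_average where "row_average n \<equiv> random_eigenbasis.row_average n (U n) (l n)"
abbreviation spectral_average where "spectral_average n \<equiv> random_eigenbasis.spectral_average n (l n)"

lemma spectral_average_in_probability:
  assumes "continuous_on UNIV f" "bounded (range f)" "\<epsilon> > 0"
  shows "(\<lambda>n. measure (M n) {\<omega> \<in> space (M n). \<bar>spectral_average n f \<omega> - (LINT x|\<mu>. f x)\<bar> > \<epsilon>}) \<longlonglongrightarrow> 0"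
proof -
  have e: "\<forall>\<^sub>F n in sequentially. measure (M n) {\<omega> \<in> space (M n). \<bar>(\<Sum>j<n. f (l n \<omega> j)) / real n - (LINT x|\<mu>. f x)\<bar> > \<epsilon>}
      = measure (M n) {\<omega> \<in> space (M n). \<bar>spectral_average n f \<omega> - (LINT x|\<mu>. f x)\<bar> > \<epsilon>}"
    using eventually_ge_at_top[of 1]
    by eventually_elim (simp add: random_eigenbasis.spectral_average_def[OF basis])
  have "(\<lambda>n. measure (M n) {\<omega> \<in> space (M n). \<bar>(\<Sum>j<n. f (l n \<omega> j)) / real n - (LINT x|\<mu>. f x)\<bar> > \<epsilon>}) \<longlonglongrightarrow> 0"
    using spectral assms unfolding spectral_law_converges_def by blast
  then show ?thesis using tendsto_cong[OF e] by simp
qed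

text \<open>
  Weak convergence in probability only tests continuous functions; the indicator of \<open>{..x}\<close> is enclosed
  between two continuous steps whose integrals are close to \<open>cdf \<mu> x\<close>.
\<close>

lemma counting_in_probability:
  assumes x: "isCont (cdf \<mu>) x" and \<epsilon>: "\<epsilon> > 0"
  shows "(\<lambda>n. measure (M n) {\<omega> \<in> space (M n). \<bar>counting n x \<omega> - cdf \<mu> x\<bar> > \<epsilon>}) \<longlonglongrightarrow> 0"
proof -
  obtain d where d: "d > 0" "\<And>y. \<bar>y - x\<bar> < d \<Longrightarrow> \<bar>cdf \<mu> y - cdf \<mu> x\<bar> < \<epsilon> / 2"
    using x \<epsilon> unfolding continuous_at_eps_delta dist_real_def by (metis half_gt_zero)
  \<comment> \<open>The two steps descend on \<open>[y1, x]\<close> and on \<open>[x, y2]\<close>.\<close>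
  define y1 where "y1 = x - d / 2"
  define y2 where "y2 = x + d / 2"
  have y: "y1 < x" "x < y2" "cdf \<mu> x - \<epsilon> / 2 \<le> cdf \<mu> y1" "cdf \<mu> y2 \<le> cdf \<mu> x + \<epsilon> / 2"
  proof -
    show "y1 < x" "x < y2" using d(1) by (simp_all add: y1_def y2_def)
    have "\<bar>cdf \<mu> y1 - cdf \<mu> x\<bar> < \<epsilon> / 2" "\<bar>cdf \<mu> y2 - cdf \<mu> x\<bar> < \<epsilon> / 2"
      by (rule d(2); use d(1) in \<open>simp add: y1_def y2_def\<close>)+
    then show "cdf \<mu> x - \<epsilon> / 2 \<le> cdf \<mu> y1" "cdf \<mu> y2 \<le> cdf \<mu> x + \<epsilon> / 2" by linarith+
  qed
  define h1 where "h1 = cts_step y1 x"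
  define h2 where "h2 = cts_step x y2"
  have h: "continuous_on UNIV h1" "bounded (range h1)" "continuous_on UNIV h2" "bounded (range h2)"
  proof -
    have "continuous_on UNIV (cts_step a b)" "bounded (range (cts_step a b))" if "a < b" for a b
    proof -
      show "continuous_on UNIV (cts_step a b)"
        by (rule uniformly_continuous_imp_continuous[OF cts_step_uniformly_continuous[OF that]])
      have "norm (cts_step a b y) \<le> 1" for y
        using that by (auto simp: cts_step_def)
      then show "bounded (range (cts_step a b))" by (intro boundedI[of _ 1]) auto
    qed
    then show "continuous_on UNIV h1" "bounded (range h1)" "continuous_on UNIV h2" "bounded (range h2)"
      using y unfolding h1_def h2_def by blast+
  qed
  have I1: "cdf \<mu> x - \<epsilon> / 2 \<le> (LINT x|\<mu>. h1 x)" using cdf_cts_step(1)[OF y(1)] y(3) by (simp add: h1_def)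
  have I2: "(LINT x|\<mu>. h2 x) \<le> cdf \<mu> x + \<epsilon> / 2" using cdf_cts_step(2)[OF y(2)] y(4) by (simp add: h2_def)
  let ?E = "\<lambda>n h. {\<omega> \<in> space (M n). \<bar>spectral_average n h \<omega> - (LINT x|\<mu>. h x)\<bar> > \<epsilon> / 2}"
  have lim: "(\<lambda>n. measure (M n) (?E n h1) + measure (M n) (?E n h2)) \<longlonglongrightarrow> 0 + 0"
    by (intro tendsto_add spectral_average_in_probability h) (use \<epsilon> in auto)
  have "\<forall>\<^sub>F n in sequentially. norm (measure (M n) {\<omega> \<in> space (M n). \<bar>counting n x \<omega> - cdf \<mu> x\<bar> > \<epsilon>})
      \<le> measure (M n) (?E n h1) + measure (M n) (?E n h2)"
    using eventually_ge_at_top[of 1]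
  proof eventually_elim
    case (elim n)
    interpret B: random_eigenbasis "M n" n "A n" "U n" "l n" by (rule basis[OF elim])
    have m: "spectral_average n f \<in> borel_measurable (M n)" if "continuous_on UNIV f" for f
      by (rule B.average_measurable(1)[OF borel_measurable_continuous_onI[OF that]])
    have E: "?E n h1 \<in> sets (M n)" "?E n h2 \<in> sets (M n)"
      using m[OF h(1)] m[OF h(3)] by measurable
    have sub: "{\<omega> \<in> space (M n). \<bar>counting n x \<omega> - cdf \<mu> x\<bar> > \<epsilon>} \<subseteq> ?E n h1 \<union> ?E n h2"
    proof
      fix \<omega> assume \<omega>: "\<omega> \<in> {\<omega> \<in> space (M n). \<bar>counting n x \<omega> - cdf \<mu> x\<bar> > \<epsilon>}"
      have le: "spectral_average n h1 \<omega> \<le> counting n x \<omega>" "counting n x \<omega> \<le> spectral_average n h2 \<omega>"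
      proof -
        have "h1 z \<le> indicator {..x} z" "indicator {..x} z \<le> h2 z" for z
          using y unfolding h1_def h2_def by (auto simp: cts_step_def indicator_def)
        then show "spectral_average n h1 \<omega> \<le> counting n x \<omega>" "counting n x \<omega> \<le> spectral_average n h2 \<omega>"
          unfolding B.counting_eq B.spectral_average_def by (intro divide_right_mono sum_mono; simp)+
      qed
      have "\<bar>counting n x \<omega> - cdf \<mu> x\<bar> > \<epsilon>" using \<omega> by simp
      then have "\<bar>spectral_average n h1 \<omega> - (LINT x|\<mu>. h1 x)\<bar> > \<epsilon> / 2
          \<or> \<bar>spectral_average n h2 \<omega> - (LINT x|\<mu>. h2 x)\<bar> > \<epsilon> / 2"
        using le I1 I2 by linarith
      then show "\<omega> \<in> ?E n h1 \<union> ?E n h2" using \<omega> by auto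
    qed
    have "measure (M n) {\<omega> \<in> space (M n). \<bar>counting n x \<omega> - cdf \<mu> x\<bar> > \<epsilon>} \<le> measure (M n) (?E n h1 \<union> ?E n h2)"
      using sub E by (intro B.finite_measure_mono) auto
    also have "\<dots> \<le> measure (M n) (?E n h1) + measure (M n) (?E n h2)"
      by (rule measure_Un_le[OF E])
    finally show ?case by simp
  qed
  then show ?thesis by (rule Lim_null_comparison) (use lim in simp)
qed

lemma spectral_average_L1:
  assumes cont: "continuous_on UNIV f" and bound: "\<And>y. \<bar>f y\<bar> \<le> 1"
  shows "(\<lambda>n. LINT \<omega>|M n. \<bar>spectral_average n f \<omega> - (LINT x|\<mu>. f x)\<bar>) \<longlonglongrightarrow> 0"
proof (rule LIMSEQ_I)
  fix r :: real assume r: "0 < r"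
  define I where "I = (LINT x|\<mu>. f x)"
  have "bounded (range f)" using bound by (intro boundedI[of _ 1]) auto
  then have "(\<lambda>n. measure (M n) {\<omega> \<in> space (M n). \<bar>spectral_average n f \<omega> - I\<bar> > r / 4}) \<longlonglongrightarrow> 0"
    unfolding I_def using cont r by (intro spectral_average_in_probability) auto
  then have "\<forall>\<^sub>F n in sequentially. measure (M n) {\<omega> \<in> space (M n). \<bar>spectral_average n f \<omega> - I\<bar> > r / 4} < r / 4"
    by (rule order_tendstoD) (use r in simp)
  then have "\<forall>\<^sub>F n in sequentially. norm ((LINT \<omega>|M n. \<bar>spectral_average n f \<omega> - I\<bar>) - 0) < r"
    using eventually_ge_at_top[of 1]
  proof eventually_elim
    case (elim n)
    interpret B: random_eigenbasis "M n" n "A n" "U n" "l n" by (rule basis[OF elim(2)])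
    let ?E = "{\<omega> \<in> space (M n). \<bar>spectral_average n f \<omega> - I\<bar> > r / 4}"
    have m: "spectral_average n f \<in> borel_measurable (M n)"
      by (rule B.average_measurable(1)[OF borel_measurable_continuous_onI[OF cont]])
    have E: "?E \<in> sets (M n)" using m by measurable
    have "\<bar>I\<bar> \<le> (LINT x|\<mu>. 1)"
    proof -
      have "f \<in> borel_measurable \<mu>"
        unfolding measurable_cong_sets[OF events_eq_borel refl]
        by (rule borel_measurable_continuous_onI[OF cont])
      then have "integrable \<mu> f"
        using bound by (intro integrable_const_bound[of _ 1]) auto
      then show ?thesis
        unfolding I_def real_norm_def[symmetric] using bound by (intro norm_integral_le) auto
    qed
    moreover have "(LINT x|\<mu>. (1::real)) = 1" using prob_space by simp
    ultimately have I: "\<bar>I\<bar> \<le> 1" by linarith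
    have b: "\<bar>spectral_average n f \<omega> - I\<bar> \<le> 2" if "\<omega> \<in> space (M n)" for \<omega>
      using B.average_bounds(1)[of f, OF bound that] I by linarith
    have "(LINT \<omega>|M n. \<bar>spectral_average n f \<omega> - I\<bar>) \<le> (LINT \<omega>|M n. r / 4 + 2 * indicator ?E \<omega>)"
    proof (rule integral_mono)
      show "integrable (M n) (\<lambda>\<omega>. \<bar>spectral_average n f \<omega> - I\<bar>)"
        by (rule B.integrable_const_bound[of _ 2]) (use b m in auto)
      show "integrable (M n) (\<lambda>\<omega>. r / 4 + 2 * indicator ?E \<omega>)"
        using E by (intro Bochner_Integration.integrable_add integrable_mult_right
            integrable_real_indicator) (auto simp: less_top[symmetric])
      show "\<bar>spectral_average n f \<omega> - I\<bar> \<le> r / 4 + 2 * indicator ?E \<omega>" if "\<omega> \<in> space (M n)" for \<omega>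
        using b[OF that] that r by (auto simp: indicator_def)
    qed
    also have "\<dots> = r / 4 + 2 * measure (M n) ?E"
      using E sets.sets_into_space[OF E] by (simp add: B.prob_space Int_absorb2 less_top[symmetric])
    also have "\<dots> < r" using elim r by linarith
    finally show ?case by simp
  qed
  then show "\<exists>no. \<forall>n\<ge>no. norm ((LINT \<omega>|M n. \<bar>spectral_average n f \<omega> - (LINT x|\<mu>. f x)\<bar>) - 0) < r"
    by (simp add: I_def eventually_sequentially)
qed

lemma row_cdf_dev_L1:
  assumes x: "isCont (cdf \<mu>) x"
    and null: "(\<lambda>n. LINT \<omega>|M n. (dev n (\<lambda>j. real (Suc j) \<le> real n * cdf \<mu> x) \<omega> 0)\<^sup>2) \<longlonglongrightarrow> 0"
  shows "(\<lambda>n. LINT \<omega>|M n. \<bar>row_cdf_dev n x \<omega>\<bar>) \<longlonglongrightarrow> 0"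
proof (rule LIMSEQ_I)
  fix r :: real assume r: "0 < r"
  define \<epsilon> where "\<epsilon> = r / 8"
  have \<epsilon>: "\<epsilon> > 0" using r by (simp add: \<epsilon>_def)
  let ?S = "\<lambda>n. sqrt (LINT \<omega>|M n. (dev n (\<lambda>j. real (Suc j) \<le> real n * cdf \<mu> x) \<omega> 0)\<^sup>2)
     + (4 * \<epsilon> + 2 / n) + measure (M n) {\<omega> \<in> space (M n). \<bar>counting n x \<omega> - cdf \<mu> x\<bar> > \<epsilon>}"
  have "?S \<longlonglongrightarrow> sqrt 0 + (4 * \<epsilon> + 0) + 0"
    by (intro tendsto_add tendsto_real_sqrt null tendsto_const counting_in_probability x \<epsilon>
        lim_const_over_n)
  then have "\<forall>\<^sub>F n in sequentially. ?S n < r"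
    by (rule order_tendstoD) (use r in \<open>simp add: \<epsilon>_def\<close>)
  then have "\<forall>\<^sub>F n in sequentially. norm ((LINT \<omega>|M n. \<bar>row_cdf_dev n x \<omega>\<bar>) - 0) < r"
    using eventually_ge_at_top[of 1]
  proof eventually_elim
    case (elim n)
    interpret B: random_eigenbasis "M n" n "A n" "U n" "l n" by (rule basis[OF elim(2)])
    show ?case using B.row_cdf_dev_expectation[OF \<epsilon>, of x "cdf \<mu> x"] elim(1) by simp
  qed
  then show "\<exists>no. \<forall>n\<ge>no. norm ((LINT \<omega>|M n. \<bar>row_cdf_dev n x \<omega>\<bar>) - 0) < r"
    by (simp add: eventually_sequentially)
qed

text \<open>
  Approximates \<open>f\<close> uniformly by step functions with jumps at continuity points of \<open>cdf \<mu>\<close>.  For a step function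
  the difference between the average weighted with the row and the plain average is a combination of
  finitely many values of \<open>row_cdf_dev\<close>.
\<close>

lemma row_average_L1:
  fixes f :: "real \<Rightarrow> real"
  assumes lip: "\<And>y z. \<bar>f y - f z\<bar> \<le> \<bar>y - z\<bar>" and decay: "\<And>y. \<bar>f y\<bar> * \<bar>y\<bar> \<le> 1" and bound: "\<And>y. \<bar>f y\<bar> \<le> 1"
    and null: "\<And>t. t \<in> spectral_levels \<mu> \<Longrightarrow>
       (\<lambda>n. LINT \<omega>|M n. (dev n (\<lambda>j. real (Suc j) \<le> real n * t) \<omega> 0)\<^sup>2) \<longlonglongrightarrow> 0"
  shows "(\<lambda>n. LINT \<omega>|M n. \<bar>row_average n f \<omega> - (LINT x|\<mu>. f x)\<bar>) \<longlonglongrightarrow> 0"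
proof (rule LIMSEQ_I)
  fix r :: real assume r: "0 < r"
  define \<eta> where "\<eta> = r / 4"
  have \<eta>: "\<eta> > 0" using r by (simp add: \<eta>_def)
  obtain c L where c: "\<And>i. isCont (cdf \<mu>) (c i)"
    and step: "\<And>y. \<bar>f y - step_function f c L y\<bar> \<le> \<eta>"
    using ex_step_approximation[OF lip decay \<eta>] by blast
  have "continuous_on UNIV f"
    unfolding continuous_on_iff dist_real_def using lip by (metis le_less_trans)
  note cont = this
  have e: "(\<lambda>n. LINT \<omega>|M n. \<bar>row_cdf_dev n (c i) \<omega>\<bar>) \<longlonglongrightarrow> 0" for i
    by (rule row_cdf_dev_L1[OF c null]) (simp add: spectral_levels_def)
  define I where "I = (LINT x|\<mu>. f x)"
  let ?S = "\<lambda>n. (\<Sum>i<L. (LINT \<omega>|M n. \<bar>row_cdf_dev n (c (Suc i)) \<omega>\<bar>) + (LINT \<omega>|M n. \<bar>row_cdf_dev n (c i) \<omega>\<bar>))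
    + 2 * \<eta> + (LINT \<omega>|M n. \<bar>spectral_average n f \<omega> - I\<bar>)"
  have "?S \<longlonglongrightarrow> (\<Sum>i<L. 0 + 0) + 2 * \<eta> + 0"
    unfolding I_def by (intro tendsto_add tendsto_sum tendsto_const e spectral_average_L1 cont bound)
  then have "\<forall>\<^sub>F n in sequentially. ?S n < r"
    by (rule order_tendstoD) (use r in \<open>simp add: \<eta>_def\<close>)
  then have "\<forall>\<^sub>F n in sequentially. norm ((LINT \<omega>|M n. \<bar>row_average n f \<omega> - I\<bar>) - 0) < r"
    using eventually_ge_at_top[of 1]
  proof eventually_elim
    case (elim n)
    interpret B: random_eigenbasis "M n" n "A n" "U n" "l n" by (rule basis[OF elim(2)])
    have fm: "f \<in> borel_measurable borel" by (rule borel_measurable_continuous_onI[OF cont])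
    have ie: "integrable (M n) (\<lambda>\<omega>. \<bar>row_cdf_dev n x \<omega>\<bar>)" for x
    proof (rule B.integrable_const_bound[of _ 1])
      show "(\<lambda>\<omega>. \<bar>row_cdf_dev n x \<omega>\<bar>) \<in> borel_measurable (M n)"
        by (rule borel_measurable_abs[OF B.row_cdf_dev_measurable])
      show "AE \<omega> in M n. norm \<bar>row_cdf_dev n x \<omega>\<bar> \<le> 1"
        using B.dev_bound B.n by (intro AE_I2) (simp add: B.row_cdf_dev_eq)
    qed
    have iS: "integrable (M n) (\<lambda>\<omega>. \<bar>spectral_average n f \<omega> - I\<bar>)"
    proof (intro integrable_abs Bochner_Integration.integrable_diff)
      show "integrable (M n) (spectral_average n f)"
        by (rule B.integrable_const_bound[of _ 1])
          (use B.average_measurable(1)[OF fm] B.average_bounds(1)[OF bound] in auto)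
    qed simp
    have ir: "integrable (M n) (\<lambda>\<omega>. \<bar>row_average n f \<omega> - I\<bar>)"
    proof (intro integrable_abs Bochner_Integration.integrable_diff)
      show "integrable (M n) (row_average n f)"
        by (rule B.integrable_const_bound[of _ 1])
          (use B.average_measurable(2)[OF fm] B.average_bounds(2)[OF bound] in auto)
    qed simp
    have pt: "\<bar>row_average n f \<omega> - I\<bar> \<le> (\<Sum>i<L. \<bar>row_cdf_dev n (c (Suc i)) \<omega>\<bar> + \<bar>row_cdf_dev n (c i) \<omega>\<bar>)
        + 2 * \<eta> + \<bar>spectral_average n f \<omega> - I\<bar>" if \<omega>: "\<omega> \<in> space (M n)" for \<omega>
    proof -
      define d where "d j = \<bar>U n \<omega> $$ (0, j)\<bar>\<^sup>2 - 1 / n" for j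
      define g where "g = step_function f c L"
      have "(\<Sum>j<n. \<bar>d j\<bar>) \<le> (\<Sum>j<n. \<bar>U n \<omega> $$ (0, j)\<bar>\<^sup>2 + 1 / n)"
        by (rule sum_mono) (simp add: d_def abs_le_iff)
      also have "\<dots> = 2" using B.row_norm[OF \<omega>, of 0] elim(2) by (simp add: sum.distrib)
      finally have d2: "(\<Sum>j<n. \<bar>d j\<bar>) \<le> 2" .
      have "\<bar>\<Sum>j<n. (f (l n \<omega> j) - g (l n \<omega> j)) * d j\<bar> \<le> (\<Sum>j<n. \<eta> * \<bar>d j\<bar>)"
        by (rule order_trans[OF sum_abs], rule sum_mono)
          (simp add: abs_mult mult_right_mono step g_def)
      also have "\<dots> = \<eta> * (\<Sum>j<n. \<bar>d j\<bar>)" by (simp add: sum_distrib_left)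
      also have "\<dots> \<le> \<eta> * 2" using d2 \<eta> by (intro mult_left_mono) auto
      finally have 1: "\<bar>\<Sum>j<n. (f (l n \<omega> j) - g (l n \<omega> j)) * d j\<bar> \<le> 2 * \<eta>" by simp
      have "(\<Sum>j<n. g (l n \<omega> j) * d j)
          = (\<Sum>j<n. \<Sum>i<L. f (c i) * (indicator {..c (Suc i)} (l n \<omega> j) * d j - indicator {..c i} (l n \<omega> j) * d j))"
        unfolding g_def step_function_def sum_distrib_right
        by (intro sum.cong refl) (simp add: algebra_simps)
      also have "\<dots> = (\<Sum>i<L. \<Sum>j<n. f (c i) * (indicator {..c (Suc i)} (l n \<omega> j) * d j - indicator {..c i} (l n \<omega> j) * d j))"
        by (rule sum.swap)
      also have "\<dots> = (\<Sum>i<L. f (c i) * (row_cdf_dev n (c (Suc i)) \<omega> - row_cdf_dev n (c i) \<omega>))"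
        by (simp only: sum_distrib_left[symmetric] sum_subtractf B.row_cdf_dev_def d_def)
      finally have g: "(\<Sum>j<n. g (l n \<omega> j) * d j)
          = (\<Sum>i<L. f (c i) * (row_cdf_dev n (c (Suc i)) \<omega> - row_cdf_dev n (c i) \<omega>))" .
      have 2: "\<bar>\<Sum>j<n. g (l n \<omega> j) * d j\<bar> \<le> (\<Sum>i<L. \<bar>row_cdf_dev n (c (Suc i)) \<omega>\<bar> + \<bar>row_cdf_dev n (c i) \<omega>\<bar>)"
        unfolding g
      proof (rule order_trans[OF sum_abs], rule sum_mono)
        fix i
        have "\<bar>f (c i)\<bar> * \<bar>row_cdf_dev n (c (Suc i)) \<omega> - row_cdf_dev n (c i) \<omega>\<bar>
            \<le> 1 * (\<bar>row_cdf_dev n (c (Suc i)) \<omega>\<bar> + \<bar>row_cdf_dev n (c i) \<omega>\<bar>)"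
          by (rule mult_mono) (use bound in auto)
        then show "\<bar>f (c i) * (row_cdf_dev n (c (Suc i)) \<omega> - row_cdf_dev n (c i) \<omega>)\<bar>
            \<le> \<bar>row_cdf_dev n (c (Suc i)) \<omega>\<bar> + \<bar>row_cdf_dev n (c i) \<omega>\<bar>"
          by (simp add: abs_mult)
      qed
      have "row_average n f \<omega> - spectral_average n f \<omega>
          = (\<Sum>j<n. (f (l n \<omega> j) - g (l n \<omega> j)) * d j) + (\<Sum>j<n. g (l n \<omega> j) * d j)"
        unfolding B.average_difference[OF \<omega>] sum.distrib[symmetric] d_def[symmetric]
        by (rule sum.cong) (simp_all add: left_diff_distrib)
      then show ?thesis using 1 2 by linarith
    qed
    have "(LINT \<omega>|M n. \<bar>row_average n f \<omega> - I\<bar>) \<le> (LINT \<omega>|M n.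
        (\<Sum>i<L. \<bar>row_cdf_dev n (c (Suc i)) \<omega>\<bar> + \<bar>row_cdf_dev n (c i) \<omega>\<bar>) + 2 * \<eta> + \<bar>spectral_average n f \<omega> - I\<bar>)"
      by (rule integral_mono[OF ir _ pt])
        (intro Bochner_Integration.integrable_add Bochner_Integration.integrable_sum ie iS, simp)
    also have "\<dots> = ?S n"
      using ie iS by (simp add: B.prob_space)
    finally show ?case using elim(1) by simp
  qed
  then show "\<exists>no. \<forall>n\<ge>no. norm ((LINT \<omega>|M n. \<bar>row_average n f \<omega> - (LINT x|\<mu>. f x)\<bar>) - 0) < r"
    by (simp add: I_def eventually_sequentially)
qed

end

text \<open>
  For large \<open>n\<close> the constants in \<open>dev_second_moment\<close> depend only on \<open>s\<close>; this is where \<open>0 < s < 1\<close> is needed.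
\<close>

lemma row_deviation_vanishes:
  fixes s :: real
  assumes basis: "\<And>n. n \<ge> 1 \<Longrightarrow> random_eigenbasis (M n) n (A n) (U n) (l n)"
    and s: "0 < s" "s < 1"
    and B0: "(\<lambda>n. LINT \<omega>|M n. min 1 \<bar>process_B n (U n \<omega>) (s, t)\<bar>) \<longlonglongrightarrow> 0"
  shows "(\<lambda>n. LINT \<omega>|M n. (random_eigenbasis.dev n (U n) (\<lambda>j. real (Suc j) \<le> real n * t) \<omega> 0)\<^sup>2) \<longlonglongrightarrow> 0"
proof (rule Lim_null_comparison)
  define c where "c = min s (1 - s) / 2"
  have c: "c > 0" using s by (simp add: c_def)
  show "(\<lambda>n. 64 / c * (LINT \<omega>|M n. min 1 \<bar>process_B n (U n \<omega>) (s, t)\<bar>)) \<longlonglongrightarrow> 0"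
    using tendsto_mult[OF tendsto_const B0, of "64 / c"] by simp
  have "\<forall>\<^sub>F n in sequentially. 2 / s \<le> real n" "\<forall>\<^sub>F n in sequentially. 2 / (1 - s) \<le> real n"
    using filterlim_real_sequentially unfolding filterlim_at_top by blast+
  then show "\<forall>\<^sub>F n in sequentially.
      norm (LINT \<omega>|M n. (random_eigenbasis.dev n (U n) (\<lambda>j. real (Suc j) \<le> real n * t) \<omega> 0)\<^sup>2)
      \<le> 64 / c * (LINT \<omega>|M n. min 1 \<bar>process_B n (U n \<omega>) (s, t)\<bar>)"
    using eventually_ge_at_top[of 1]
  proof eventually_elim
    case (elim n)
    interpret E: random_eigenbasis "M n" n "A n" "U n" "l n" by (rule basis[OF elim(3)])
    have "2 \<le> real n * s" "2 \<le> real n * (1 - s)" using elim s by (simp_all add: field_simps)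
    from E.dev_second_moment[OF s this, of t]
    have "c * (LINT \<omega>|M n. (E.dev (\<lambda>j. real (Suc j) \<le> real n * t) \<omega> 0)\<^sup>2)
        \<le> 64 * (LINT \<omega>|M n. min 1 \<bar>process_B n (U n \<omega>) (s, t)\<bar>)"
      by (simp only: c_def)
    then show ?case using c by (simp add: field_simps)
  qed
qed

section \<open>The resolvent of a symmetric matrix and the Schur complement\<close>

definition matvec :: "nat \<Rightarrow> (nat \<Rightarrow> nat \<Rightarrow> real) \<Rightarrow> (nat \<Rightarrow> real) \<Rightarrow> nat \<Rightarrow> real" where
  "matvec N a v i = (\<Sum>j<N. a i j * v j)"

definition symmetric_on :: "nat \<Rightarrow> (nat \<Rightarrow> nat \<Rightarrow> real) \<Rightarrow> bool" where
  "symmetric_on N a \<longleftrightarrow> (\<forall>i<N. \<forall>j<N. a i j = a j i)"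

lemma matvec_adjoint:
  assumes "symmetric_on N a"
  shows "(\<Sum>i<N. u i * matvec N a v i) = (\<Sum>i<N. matvec N a u i * v i)"
proof -
  have "(\<Sum>i<N. u i * matvec N a v i) = (\<Sum>i<N. \<Sum>j<N. u i * a i j * v j)"
    by (simp add: matvec_def sum_distrib_left mult.assoc)
  also have "\<dots> = (\<Sum>j<N. \<Sum>i<N. u i * a i j * v j)"
    by (rule sum.swap)
  also have "\<dots> = (\<Sum>j<N. matvec N a u j * v j)"
    using assms unfolding matvec_def sum_distrib_right symmetric_on_def
    by (intro sum.cong refl) (simp add: mult.commute)
  finally show ?thesis .
qed

text \<open>
  The equation \<open>(1 + a\<^sup>2) y = x\<close>.  Solutions are handled through this relation so that the estimates follow
  from the quadratic form of \<open>1 + a\<^sup>2\<close>.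
\<close>

definition solves :: "nat \<Rightarrow> (nat \<Rightarrow> nat \<Rightarrow> real) \<Rightarrow> (nat \<Rightarrow> real) \<Rightarrow> (nat \<Rightarrow> real) \<Rightarrow> bool" where
  "solves N a y x \<longleftrightarrow> (\<forall>i<N. y i + matvec N a (matvec N a y) i = x i)"

lemma solves_form:
  assumes "symmetric_on N a" "solves N a y x"
  shows "(\<Sum>i<N. u i * x i) = (\<Sum>i<N. u i * y i) + (\<Sum>i<N. matvec N a u i * matvec N a y i)"
proof -
  have "(\<Sum>i<N. u i * x i) = (\<Sum>i<N. u i * y i + u i * matvec N a (matvec N a y) i)"
    using assms(2) unfolding solves_def by (intro sum.cong refl) (metis distrib_left lessThan_iff)
  then show ?thesis
    by (simp add: sum.distrib matvec_adjoint[OF assms(1)])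
qed

lemma solves_energy:
  assumes "symmetric_on N a" "solves N a y x"
  shows "(\<Sum>i<N. y i * x i) = (\<Sum>i<N. (y i)\<^sup>2) + (\<Sum>i<N. (matvec N a y i)\<^sup>2)"
  using solves_form[OF assms, of y] by (simp add: power2_eq_square)

lemma solves_contraction:
  assumes "symmetric_on N a" "solves N a y x"
  shows "(\<Sum>i<N. (y i)\<^sup>2) \<le> (\<Sum>i<N. (x i)\<^sup>2)"
proof -
  have "(\<Sum>i<N. (y i)\<^sup>2) \<le> (\<Sum>i<N. y i * x i)"
    using solves_energy[OF assms] by (simp add: sum_nonneg)
  also have "\<dots> \<le> (\<Sum>i<N. ((y i)\<^sup>2 + (x i)\<^sup>2) / 2)"
    by (intro sum_mono) (use sum_squares_bound in \<open>auto simp: field_simps power2_eq_square\<close>)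
  also have "\<dots> = ((\<Sum>i<N. (y i)\<^sup>2) + (\<Sum>i<N. (x i)\<^sup>2)) / 2"
    by (simp add: sum.distrib add_divide_distrib sum_divide_distrib)
  finally show ?thesis by simp
qed

definition one_plus_square :: "nat \<Rightarrow> (nat \<Rightarrow> nat \<Rightarrow> real) \<Rightarrow> real mat" where
  "one_plus_square N a = mat N N (\<lambda>(i, j). (if i = j then 1 else 0) + (\<Sum>k<N. a i k * a k j))"

text \<open>
  The inverse of \<open>1 + a\<^sup>2\<close>, that is, \<open>- Im (\<i> - a)\<^sup>-\<^sup>1\<close>.  Cramer's rule exhibits its entries as rational functions
  of the entries of \<open>a\<close>, which gives measurability.
\<close>

definition resolvent :: "nat \<Rightarrow> (nat \<Rightarrow> nat \<Rightarrow> real) \<Rightarrow> nat \<Rightarrow> nat \<Rightarrow> real" where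
  "resolvent N a i j = adj_mat (one_plus_square N a) $$ (i, j) / det (one_plus_square N a)"

lemma one_plus_square_apply:
  assumes "i < N"
  shows "(\<Sum>j<N. one_plus_square N a $$ (i, j) * y j) = y i + matvec N a (matvec N a y) i"
proof -
  have "(\<Sum>j<N. one_plus_square N a $$ (i, j) * y j)
      = (\<Sum>j<N. (if i = j then y j else 0) + (\<Sum>k<N. a i k * a k j * y j))"
    using assms by (intro sum.cong refl)
      (auto simp: one_plus_square_def algebra_simps sum_distrib_left sum_distrib_right)
  also have "\<dots> = y i + (\<Sum>j<N. \<Sum>k<N. a i k * a k j * y j)"
    using assms by (simp add: sum.distrib)
  also have "(\<Sum>j<N. \<Sum>k<N. a i k * a k j * y j) = (\<Sum>k<N. \<Sum>j<N. a i k * a k j * y j)"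
    by (rule sum.swap)
  finally show ?thesis
    by (simp add: matvec_def sum_distrib_left mult.assoc)
qed

lemma det_one_plus_square_nonzero:
  assumes "symmetric_on N a"
  shows "det (one_plus_square N a) \<noteq> 0"
proof
  assume "det (one_plus_square N a) = 0"
  moreover have C: "one_plus_square N a \<in> carrier_mat N N"
    by (simp add: one_plus_square_def)
  ultimately obtain v where v: "v \<in> carrier_vec N" "v \<noteq> 0\<^sub>v N"
      "one_plus_square N a *\<^sub>v v = 0\<^sub>v N"
    using det_0_iff_vec_prod_zero by blast
  define y where "y i = vec_index v i" for i
  have "solves N a y (\<lambda>_. 0)"
    unfolding solves_def
  proof (intro allI impI)
    fix i assume i: "i < N"
    have "vec_index (one_plus_square N a *\<^sub>v v) i = 0"
      using v(3) i by simp
    then have "(\<Sum>j<N. one_plus_square N a $$ (i, j) * y j) = 0"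
      using i v(1) C by (auto simp: scalar_prod_def y_def lessThan_atLeast0 intro!: sum.cong)
    then show "y i + matvec N a (matvec N a y) i = 0"
      by (simp add: one_plus_square_apply[OF i])
  qed
  from solves_contraction[OF assms this] have "(\<Sum>i<N. (y i)\<^sup>2) = 0"
    by (simp add: order_antisym sum_nonneg)
  then have "\<forall>i<N. y i = 0"
    by (simp add: sum_nonneg_eq_0_iff)
  then have "v = 0\<^sub>v N"
    using v(1) by (auto simp: y_def)
  with v(2) show False by simp
qed

lemma resolvent_solves:
  assumes "symmetric_on N a"
  shows "solves N a (matvec N (resolvent N a) x) x"
  unfolding solves_def
proof (intro allI impI)
  fix i assume i: "i < N"
  let ?B = "one_plus_square N a"
  have C: "?B \<in> carrier_mat N N" by (simp add: one_plus_square_def)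
  note adj = adj_mat[OF C]
  have *: "(\<Sum>k<N. ?B $$ (i, k) * resolvent N a k j) = (if i = j then 1 else 0)" if j: "j < N" for j
  proof -
    have "(?B * adj_mat ?B) $$ (i, j) = (det ?B \<cdot>\<^sub>m 1\<^sub>m N) $$ (i, j)"
      by (simp add: adj(2))
    then have "(\<Sum>k<N. ?B $$ (i, k) * adj_mat ?B $$ (k, j)) = det ?B * (if i = j then 1 else 0)"
      using i j C adj(1) by (auto simp: scalar_prod_def lessThan_atLeast0)
    then show ?thesis
      using det_one_plus_square_nonzero[OF assms]
      by (simp add: resolvent_def sum_divide_distrib[symmetric])
  qed
  have "matvec N (resolvent N a) x i + matvec N a (matvec N a (matvec N (resolvent N a) x)) i
      = (\<Sum>k<N. ?B $$ (i, k) * matvec N (resolvent N a) x k)"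
    by (rule one_plus_square_apply[OF i, symmetric])
  also have "\<dots> = (\<Sum>k<N. \<Sum>j<N. ?B $$ (i, k) * resolvent N a k j * x j)"
    by (simp add: matvec_def sum_distrib_left mult.assoc)
  also have "\<dots> = (\<Sum>j<N. \<Sum>k<N. ?B $$ (i, k) * resolvent N a k j * x j)"
    by (rule sum.swap)
  also have "\<dots> = (\<Sum>j<N. (if i = j then 1 else 0) * x j)"
    using * by (intro sum.cong refl) (simp add: sum_distrib_right[symmetric])
  also have "\<dots> = x i" using i by (simp add: if_distrib[of "\<lambda>c. c * _"] cong: if_cong)
  finally show "matvec N (resolvent N a) x i + matvec N a (matvec N a (matvec N (resolvent N a) x)) i = x i" .
qed

lemma resolvent_column:
  assumes "k < N"
  shows "matvec N (resolvent N a) (\<lambda>j. if j = k then 1 else 0) i = resolvent N a i k"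
  using assms by (simp add: matvec_def if_distrib[of "\<lambda>c. _ * c"] cong: if_cong)

lemma resolvent_column_solves:
  assumes "symmetric_on N a" "k < N"
  shows "solves N a (\<lambda>i. resolvent N a i k) (\<lambda>j. if j = k then 1 else 0)"
proof -
  have "matvec N (resolvent N a) (\<lambda>j. if j = k then 1 else 0) = (\<lambda>i. resolvent N a i k)"
    by (rule ext) (rule resolvent_column[OF assms(2)])
  then show ?thesis
    using resolvent_solves[OF assms(1), of "\<lambda>j. if j = k then 1 else 0"] by simp
qed

lemma resolvent_sym:
  assumes "symmetric_on N a"
  shows "symmetric_on N (resolvent N a)"
  unfolding symmetric_on_def
proof (intro allI impI)
  fix i j assume ij: "i < N" "j < N"
  let ?y = "\<lambda>k. resolvent N a k j" and ?z = "\<lambda>k. resolvent N a k i"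
  have "(\<Sum>k<N. ?y k * (if k = i then 1 else 0)) = (\<Sum>k<N. ?z k * (if k = j then 1 else 0))"
    using solves_form[OF assms resolvent_column_solves[OF assms ij(1)], of ?y]
      solves_form[OF assms resolvent_column_solves[OF assms ij(2)], of ?z]
    by (simp add: mult.commute)
  then show "resolvent N a i j = resolvent N a j i"
    using ij by (simp add: if_distrib[of "\<lambda>c. _ * c"] cong: if_cong)
qed

lemma resolvent_energy:
  assumes "symmetric_on N a" "k < N"
  shows "resolvent N a k k
      = (\<Sum>i<N. (resolvent N a i k)\<^sup>2) + (\<Sum>i<N. (matvec N a (\<lambda>i. resolvent N a i k) i)\<^sup>2)"
  using solves_energy[OF assms(1) resolvent_column_solves[OF assms]] assms(2)
  by (simp add: if_distrib[of "\<lambda>c. _ * c"] cong: if_cong)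

lemma resolvent_row_norm:
  assumes "symmetric_on N a" "j < N"
  shows "(\<Sum>k<N. (resolvent N a j k)\<^sup>2) \<le> 1"
proof -
  have "(\<Sum>i<N. (resolvent N a i j)\<^sup>2) \<le> (\<Sum>i<N. (if i = j then 1 else 0 :: real)\<^sup>2)"
    by (rule solves_contraction[OF assms(1) resolvent_column_solves[OF assms]])
  also have "\<dots> = 1"
    using assms(2) by (simp add: if_distrib[of "\<lambda>c. c\<^sup>2"] cong: if_cong)
  finally show ?thesis
    using resolvent_sym[OF assms(1)] assms(2) unfolding symmetric_on_def
    by (metis (no_types, lifting) lessThan_iff sum.cong)
qed

lemma resolvent_row_sums:
  assumes "symmetric_on N a"
  shows "(\<Sum>j<N. (\<Sum>k<N. resolvent N a j k)\<^sup>2) \<le> N"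
  using solves_contraction[OF assms resolvent_solves[OF assms, of "\<lambda>_. 1"]]
  by (simp add: matvec_def)

lemma resolvent_diag_bounds:
  assumes "symmetric_on N a" "k < N"
  shows "0 \<le> resolvent N a k k" "resolvent N a k k \<le> 1"
proof -
  show "0 \<le> resolvent N a k k"
    by (subst resolvent_energy[OF assms]) (simp add: sum_nonneg)
  have "(resolvent N a k k)\<^sup>2 \<le> (\<Sum>j<N. (resolvent N a k j)\<^sup>2)"
    using assms(2) by (intro member_le_sum) auto
  also have "\<dots> \<le> 1" by (rule resolvent_row_norm[OF assms])
  finally show "resolvent N a k k \<le> 1"
    by (simp add: abs_square_le_1 power2_le_iff_abs_le)
qed

text \<open>
  By the Cauchy-Schwarz inequality \<open>1 \<le> y (1 + \<alpha>)\<close> for the diagonal entry \<open>y\<close> of the inverse, where \<open>1 + \<alpha>\<close> is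
  the diagonal entry of \<open>1 + a\<^sup>2\<close>.  The exponential form is the one whose mean factorizes for
  independent entries.
\<close>

lemma resolvent_diag_lower:
  assumes "symmetric_on N a" "k < N"
  shows "exp (- (\<Sum>j<N. (a k j)\<^sup>2)) \<le> resolvent N a k k"
proof -
  define y where "y = (\<lambda>i. resolvent N a i k)"
  define \<alpha> where "\<alpha> = (\<Sum>j<N. (a k j)\<^sup>2)"
  define \<beta> where "\<beta> = (\<Sum>i<N. (matvec N a y i)\<^sup>2)"
  have y: "0 \<le> y k" "y k \<le> 1" using resolvent_diag_bounds[OF assms] by (auto simp: y_def)
  have \<alpha>0: "\<alpha> \<ge> 0" by (simp add: \<alpha>_def sum_nonneg)
  have e: "y k = (\<Sum>i<N. (y i)\<^sup>2) + \<beta>"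
    using resolvent_energy[OF assms] by (simp add: y_def \<beta>_def)
  have "(y k)\<^sup>2 \<le> (\<Sum>i<N. (y i)\<^sup>2)"
    using assms(2) by (intro member_le_sum) auto
  then have b: "\<beta> \<le> y k * (1 - y k)" using e by (simp add: algebra_simps power2_eq_square)
  have "1 - y k = (\<Sum>j<N. a k j * matvec N a y j)"
    using resolvent_column_solves[OF assms] assms(2) unfolding solves_def y_def[symmetric]
    by (auto simp: matvec_def[of N a "matvec N a y"])
  then have "(1 - y k)\<^sup>2 \<le> \<alpha> * \<beta>"
    unfolding \<alpha>_def \<beta>_def by (simp add: Cauchy_Schwarz_ineq_sum)
  also have "\<dots> \<le> \<alpha> * (y k * (1 - y k))" using b \<alpha>0 by (rule mult_left_mono)
  finally have c: "(1 - y k) * (1 - y k) \<le> (1 - y k) * (\<alpha> * y k)"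
    by (simp add: power2_eq_square algebra_simps)
  have "1 - y k \<le> \<alpha> * y k"
  proof (cases "y k = 1")
    case False
    then have "0 < 1 - y k" using y by simp
    then show ?thesis using c mult_le_cancel_left_pos by blast
  qed (use \<alpha>0 in simp)
  then have "1 \<le> (1 + \<alpha>) * y k" by (simp add: algebra_simps)
  then have "1 \<le> exp \<alpha> * y k"
    using mult_right_mono[OF exp_ge_add_one_self[of \<alpha>] y(1)] by linarith
  then show ?thesis
    by (simp add: exp_minus field_simps \<alpha>_def[symmetric] y_def)
qed

text \<open>
  The vectors \<open>(q, y)\<close> and \<open>(p, x)\<close> are, up to sign, the imaginary and real parts of the first column of the
  resolvent at \<open>\<i>\<close> of the symmetric matrix with corner \<open>d\<close>, border \<open>r\<close> and minor \<open>a\<close>.  Pairing the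
  equations for the minor with \<open>z\<close> and with \<open>a z\<close> expresses \<open>\<langle>r, x\<rangle>\<close> and \<open>\<langle>r, y\<rangle>\<close> by \<open>\<rho> = \<langle>r, z\<rangle>\<close> and
  \<open>\<langle>a r, z\<rangle>\<close>, and the latter quantity cancels between the two equations of the first row.
\<close>

lemma schur_identity:
  fixes a :: "nat \<Rightarrow> nat \<Rightarrow> real" and r :: "nat \<Rightarrow> real"
  assumes sym: "symmetric_on N a"
    and z: "solves N a z r"
    and eq0: "d * p + (\<Sum>k<N. r k * x k) + q = 1"
    and eq1: "d * q + (\<Sum>k<N. r k * y k) = p"
    and eqx: "\<And>i. i < N \<Longrightarrow> r i * q + matvec N a y i = x i"
    and eqy: "\<And>i. i < N \<Longrightarrow> r i * p + matvec N a x i + y i = 0"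
  shows "(p\<^sup>2 + q\<^sup>2) * (1 + (\<Sum>k<N. r k * z k)) = q"
proof -
  define \<rho> where "\<rho> = (\<Sum>k<N. r k * z k)"
  define \<kappa> where "\<kappa> = (\<Sum>k<N. matvec N a r k * z k)"
  have x: "(\<Sum>k<N. x k * u k) = q * (\<Sum>k<N. r k * u k) + (\<Sum>k<N. y k * matvec N a u k)" for u
  proof -
    have "(\<Sum>k<N. x k * u k) = (\<Sum>k<N. q * (r k * u k) + matvec N a y k * u k)"
    proof (intro sum.cong refl)
      fix k assume "k \<in> {..<N}"
      then have "x k = r k * q + matvec N a y k" using eqx[of k] by simp
      then show "x k * u k = q * (r k * u k) + matvec N a y k * u k" by (simp add: algebra_simps)
    qed
    then show ?thesis by (simp add: sum.distrib sum_distrib_left matvec_adjoint[OF sym])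
  qed
  have y: "(\<Sum>k<N. y k * u k) = - p * (\<Sum>k<N. r k * u k) - (\<Sum>k<N. x k * matvec N a u k)" for u
  proof -
    have "(\<Sum>k<N. y k * u k) = (\<Sum>k<N. - p * (r k * u k) - matvec N a x k * u k)"
    proof (intro sum.cong refl)
      fix k assume "k \<in> {..<N}"
      then have yk: "y k = - r k * p - matvec N a x k" using eqy[of k] by simp
      show "y k * u k = - p * (r k * u k) - matvec N a x k * u k" unfolding yk by (simp add: algebra_simps)
    qed
    then show ?thesis
      by (simp add: sum_subtractf sum_distrib_left matvec_adjoint[OF sym] sum_negf)
  qed
  have raz: "(\<Sum>k<N. r k * matvec N a z k) = \<kappa>"
    by (simp add: \<kappa>_def matvec_adjoint[OF sym])
  have "(\<Sum>k<N. x k * r k) = (\<Sum>k<N. x k * z k) + (\<Sum>k<N. matvec N a x k * matvec N a z k)"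
    by (rule solves_form[OF sym z])
  also have "(\<Sum>k<N. matvec N a x k * matvec N a z k) = (\<Sum>k<N. x k * matvec N a (matvec N a z) k)"
    by (simp add: matvec_adjoint[OF sym])
  also have "\<dots> = - p * \<kappa> - (\<Sum>k<N. y k * matvec N a z k)"
    using y[of "matvec N a z"] raz by simp
  also have "(\<Sum>k<N. x k * z k) = q * \<rho> + (\<Sum>k<N. y k * matvec N a z k)"
    using x[of z] by (simp add: \<rho>_def)
  finally have xr: "(\<Sum>k<N. r k * x k) = q * \<rho> - p * \<kappa>" by (simp add: mult.commute)
  have "(\<Sum>k<N. y k * r k) = (\<Sum>k<N. y k * z k) + (\<Sum>k<N. matvec N a y k * matvec N a z k)"
    by (rule solves_form[OF sym z])
  also have "(\<Sum>k<N. matvec N a y k * matvec N a z k) = (\<Sum>k<N. y k * matvec N a (matvec N a z) k)"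
    by (simp add: matvec_adjoint[OF sym])
  also have "\<dots> = (\<Sum>k<N. x k * matvec N a z k) - q * \<kappa>"
    using x[of "matvec N a z"] raz by simp
  also have "(\<Sum>k<N. y k * z k) = - p * \<rho> - (\<Sum>k<N. x k * matvec N a z k)"
    using y[of z] by (simp add: \<rho>_def)
  finally have yr: "(\<Sum>k<N. r k * y k) = - p * \<rho> - q * \<kappa>" by (simp add: mult.commute)
  have 0: "d * p + (q * \<rho> - p * \<kappa>) + q = 1" using eq0 xr by simp
  have 1: "d * q + (- p * \<rho> - q * \<kappa>) = p" using eq1 yr by simp
  have "q * (d * p + (q * \<rho> - p * \<kappa>) + q) - p * (d * q + (- p * \<rho> - q * \<kappa>)) = q * 1 - p * p"
    by (simp only: 0 1)
  then have "(p\<^sup>2 + q\<^sup>2) * (1 + \<rho>) = q"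
    by (simp add: algebra_simps power2_eq_square)
  then show ?thesis by (simp add: \<rho>_def)
qed

lemma borel_measurable_det:
  fixes F :: "'a \<Rightarrow> nat \<Rightarrow> nat \<Rightarrow> real"
  assumes "\<And>i j. i < N \<Longrightarrow> j < N \<Longrightarrow> (\<lambda>\<omega>. F \<omega> i j) \<in> borel_measurable M"
  shows "(\<lambda>\<omega>. det (mat N N (\<lambda>(i, j). F \<omega> i j))) \<in> borel_measurable M"
proof -
  have less: "p i < N" if "p permutes {0..<N}" "i < N" for p i
    using permutes_in_image[OF that(1), of i] that(2) by simp
  have "det (mat N N (\<lambda>(i, j). F \<omega> i j))
      = (\<Sum>p\<in>{p. p permutes {0..<N}}. signof p * (\<Prod>i = 0..<N. F \<omega> i (p i)))" for \<omega>
    unfolding det_def by (auto intro!: sum.cong prod.cong arg_cong2[where f = "(*)"]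
        simp: less)
  then show ?thesis
    using assms by (auto intro!: borel_measurable_sum borel_measurable_times borel_measurable_prod
        simp: less)
qed

lemma borel_measurable_resolvent:
  fixes F :: "'a \<Rightarrow> nat \<Rightarrow> nat \<Rightarrow> real"
  assumes [measurable]: "\<And>i j. i < N \<Longrightarrow> j < N \<Longrightarrow> (\<lambda>\<omega>. F \<omega> i j) \<in> borel_measurable M"
    and ij: "i < N" "j < N"
  shows "(\<lambda>\<omega>. resolvent N (F \<omega>) i j) \<in> borel_measurable M"
proof -
  define G where "G \<omega> i j = (if i = j then 1 else 0) + (\<Sum>k<N. F \<omega> i k * F \<omega> k j)" for \<omega> i j
  have G: "(\<lambda>\<omega>. G \<omega> i j) \<in> borel_measurable M" if "i < N" "j < N" for i j
    unfolding G_def using that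
    by (intro borel_measurable_add borel_measurable_sum borel_measurable_times) (auto intro: assms)
  have o: "one_plus_square N (F \<omega>) = mat N N (\<lambda>(i, j). G \<omega> i j)" for \<omega>
    by (simp add: one_plus_square_def G_def)
  have c: "mat_delete (mat N N (\<lambda>(i, j). G \<omega> i j)) j i
      = mat (N - 1) (N - 1) (\<lambda>(i', j'). G \<omega> (insert_index j i') (insert_index i j'))" for \<omega>
    using ij unfolding mat_delete_def
    by (auto simp: insert_index_def intro!: eq_matI)
  have *: "resolvent N (F \<omega>) i j = ((-1) ^ (j + i) *
      det (mat (N - 1) (N - 1) (\<lambda>(i', j'). G \<omega> (insert_index j i') (insert_index i j')))) /
      det (mat N N (\<lambda>(i, j). G \<omega> i j))" for \<omega>
    unfolding resolvent_def o adj_mat_def using ij by (simp add: cofactor_def c)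
  show ?thesis
    unfolding * using ij
    by (intro borel_measurable_divide borel_measurable_times borel_measurable_const
        borel_measurable_det G) (auto simp: insert_index_def)
qed

section \<open>Off-diagonal parts of quadratic forms in independent variables\<close>

text \<open>
  Squarefree monomials in independent centered variables are orthogonal; this needs only second moments.
\<close>

lemma PiM_integral_monomials:
  fixes g :: "'b \<Rightarrow> real"
  assumes D: "prob_space D" and J: "finite J"
    and g1: "integrable D g" and g2: "integrable D (\<lambda>x. (g x)\<^sup>2)"
    and mean: "(LINT x|D. g x) = 0" and var: "(LINT x|D. (g x)\<^sup>2) = V"
    and e: "e \<subseteq> J" and f: "f \<subseteq> J"
  shows "integrable (Pi\<^sub>M J (\<lambda>_. D)) (\<lambda>z. (\<Prod>i\<in>e. g (z i)) * (\<Prod>i\<in>f. g (z i)))" (is ?I)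
    and "(LINT z|Pi\<^sub>M J (\<lambda>_. D). (\<Prod>i\<in>e. g (z i)) * (\<Prod>i\<in>f. g (z i)))
           = (if e = f then V ^ card e else 0)" (is ?E)
proof -
  interpret D: prob_space D by fact
  interpret P: product_sigma_finite "\<lambda>_. D" by unfold_locales
  define h where "h i x = (if i \<in> e then g x else 1) * (if i \<in> f then g x else 1)" for i x
  have hi: "integrable D (h i)" for i
    by (cases "i \<in> e"; cases "i \<in> f")
      (use g1 g2 in \<open>simp_all add: h_def[abs_def] power2_eq_square\<close>)
  have eq: "(\<Prod>i\<in>e. g (z i)) * (\<Prod>i\<in>f. g (z i)) = (\<Prod>i\<in>J. h i (z i))" for z
  proof -
    have *: "(\<Prod>i\<in>s. g (z i)) = (\<Prod>i\<in>J. if i \<in> s then g (z i) else 1)" if "s \<subseteq> J" for s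
      using that J by (simp add: prod.inter_restrict[symmetric] Int_absorb1)
    show ?thesis by (simp add: *[OF e] *[OF f] h_def prod.distrib)
  qed
  show ?I unfolding eq by (rule P.product_integrable_prod[OF J hi])
  have E: "(LINT z|Pi\<^sub>M J (\<lambda>_. D). (\<Prod>i\<in>e. g (z i)) * (\<Prod>i\<in>f. g (z i)))
      = (\<Prod>i\<in>J. integral\<^sup>L D (h i))"
    unfolding eq by (rule P.product_integral_prod[OF J hi])
  show ?E
  proof (cases "e = f")
    case True
    have "integral\<^sup>L D (h i) = (if i \<in> e then V else 1)" for i
      using True var by (simp add: h_def[abs_def] power2_eq_square D.prob_space)
    then have "(\<Prod>i\<in>J. integral\<^sup>L D (h i)) = (\<Prod>i\<in>J \<inter> e. V)"
      by (subst prod.inter_restrict[OF J]) simp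
    then show ?thesis using True E e by (simp add: Int_absorb1)
  next
    case False
    then obtain i where i: "i \<in> J" "(i \<in> e \<and> i \<notin> f) \<or> (i \<notin> e \<and> i \<in> f)" using e f by blast
    then have "integral\<^sup>L D (h i) = 0" using mean by (auto simp: h_def[abs_def])
    then have "(\<Prod>i\<in>J. integral\<^sup>L D (h i)) = 0" using i(1) J by (auto intro: prod_zero)
    then show ?thesis using False E by simp
  qed
qed

definition offdiag :: "'i set \<Rightarrow> ('i \<times> 'i) set" where
  "offdiag J = {p \<in> J \<times> J. fst p \<noteq> snd p}"

lemma finite_offdiag: "finite J \<Longrightarrow> finite (offdiag J)"
  by (simp add: offdiag_def)

lemma offdiag_quadratic_second_moment:
  fixes g :: "'b \<Rightarrow> real" and R :: "'i \<Rightarrow> 'i \<Rightarrow> real"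
  assumes D: "prob_space D" and J: "finite J"
    and g1: "integrable D g" and g2: "integrable D (\<lambda>x. (g x)\<^sup>2)"
    and mean: "(LINT x|D. g x) = 0" and var: "(LINT x|D. (g x)\<^sup>2) = V"
    and sym: "\<forall>j\<in>J. \<forall>k\<in>J. R j k = R k j"
    and row: "\<forall>j\<in>J. (\<Sum>k\<in>J. (R j k)\<^sup>2) \<le> 1"
  defines "Q \<equiv> \<lambda>z. \<Sum>(j, k)\<in>offdiag J. R j k * (g (z j) * g (z k))"
  shows "integrable (Pi\<^sub>M J (\<lambda>_. D)) (\<lambda>z. (Q z)\<^sup>2)"
    and "(LINT z|Pi\<^sub>M J (\<lambda>_. D). (Q z)\<^sup>2) \<le> 2 * V\<^sup>2 * card J"
proof -
  define P where "P = offdiag J"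
  define c where "c p = R (fst p) (snd p)" for p
  define X where "X p z = (\<Prod>i\<in>{fst p, snd p}. g (z i))" for p :: "'i \<times> 'i" and z
  have fP: "finite P" using J by (simp add: P_def finite_offdiag)
  have Pd: "p \<in> P \<longleftrightarrow> fst p \<in> J \<and> snd p \<in> J \<and> fst p \<noteq> snd p" for p
    by (auto simp: P_def offdiag_def mem_Times_iff)
  have Q: "Q z = (\<Sum>p\<in>P. c p * X p z)" for z
    unfolding Q_def P_def[symmetric]
    by (intro sum.cong refl) (auto simp: c_def X_def Pd)
  have sq: "(Q z)\<^sup>2 = (\<Sum>p\<in>P. \<Sum>q\<in>P. c p * c q * (X p z * X q z))" for z
    unfolding Q power2_eq_square sum_product by (intro sum.cong refl) (simp add: algebra_simps)
  have int: "integrable (Pi\<^sub>M J (\<lambda>_. D)) (\<lambda>z. X p z * X q z)"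
    and ex: "(LINT z|Pi\<^sub>M J (\<lambda>_. D). X p z * X q z)
       = (if {fst p, snd p} = {fst q, snd q} then V\<^sup>2 else 0)" if "p \<in> P" "q \<in> P" for p q
    using PiM_integral_monomials[OF D J g1 g2 mean var, of "{fst p, snd p}" "{fst q, snd q}"] that
    by (auto simp: X_def Pd power2_eq_square)
  show "integrable (Pi\<^sub>M J (\<lambda>_. D)) (\<lambda>z. (Q z)\<^sup>2)"
    unfolding sq by (intro Bochner_Integration.integrable_sum integrable_mult_right int)
  have "(LINT z|Pi\<^sub>M J (\<lambda>_. D). (Q z)\<^sup>2)
      = (\<Sum>p\<in>P. \<Sum>q\<in>P. c p * c q * (LINT z|Pi\<^sub>M J (\<lambda>_. D). X p z * X q z))"
    unfolding sq by (simp add: Bochner_Integration.integral_sum Bochner_Integration.integrable_sum int)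
  also have "\<dots> = (\<Sum>p\<in>P. 2 * V\<^sup>2 * (c p)\<^sup>2)"
  proof (rule sum.cong[OF refl])
    fix p assume p: "p \<in> P"
    define p' where "p' = (snd p, fst p)"
    have p': "p' \<in> P" "p \<noteq> p'" using p by (auto simp: Pd p'_def prod_eq_iff)
    have same: "{fst p, snd p} = {fst q, snd q} \<longleftrightarrow> q \<in> {p, p'}" for q
      by (auto simp: p'_def doubleton_eq_iff prod_eq_iff)
    have "(\<Sum>q\<in>P. c p * c q * (LINT z|Pi\<^sub>M J (\<lambda>_. D). X p z * X q z))
        = (\<Sum>q\<in>P. if q \<in> {p, p'} then V\<^sup>2 * (c p * c q) else 0)"
      by (intro sum.cong refl) (simp add: ex[OF p] same)
    also have "\<dots> = (\<Sum>q\<in>P \<inter> {p, p'}. V\<^sup>2 * (c p * c q))"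
      by (rule sum.inter_restrict[OF fP, symmetric])
    also have "P \<inter> {p, p'} = {p, p'}" using p p' by auto
    also have "(\<Sum>q\<in>{p, p'}. V\<^sup>2 * (c p * c q)) = V\<^sup>2 * (c p * c p) + V\<^sup>2 * (c p * c p')"
      using p'(2) by simp
    also have "c p' = c p" using sym p by (auto simp: c_def p'_def Pd)
    finally show "(\<Sum>q\<in>P. c p * c q * (LINT z|Pi\<^sub>M J (\<lambda>_. D). X p z * X q z)) = 2 * V\<^sup>2 * (c p)\<^sup>2"
      by (simp add: power2_eq_square)
  qed
  also have "\<dots> = 2 * V\<^sup>2 * (\<Sum>p\<in>P. (c p)\<^sup>2)" by (simp add: sum_distrib_left)
  also have "\<dots> \<le> 2 * V\<^sup>2 * card J"
  proof (rule mult_left_mono)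
    have "(\<Sum>p\<in>P. (c p)\<^sup>2) \<le> (\<Sum>p\<in>J \<times> J. (c p)\<^sup>2)"
      by (rule sum_mono2) (use J in \<open>auto simp: Pd\<close>)
    also have "\<dots> = (\<Sum>j\<in>J. \<Sum>k\<in>J. (R j k)\<^sup>2)"
      by (simp add: sum.cartesian_product c_def case_prod_unfold)
    also have "\<dots> \<le> (\<Sum>j\<in>J. 1)" using row by (intro sum_mono) blast
    finally show "(\<Sum>p\<in>P. (c p)\<^sup>2) \<le> card J" by simp
  qed simp
  finally show "(LINT z|Pi\<^sub>M J (\<lambda>_. D). (Q z)\<^sup>2) \<le> 2 * V\<^sup>2 * card J" .
qed

lemma linear_second_moment:
  fixes g :: "'b \<Rightarrow> real" and t :: "'i \<Rightarrow> real"
  assumes D: "prob_space D" and J: "finite J"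
    and g1: "integrable D g" and g2: "integrable D (\<lambda>x. (g x)\<^sup>2)"
    and mean: "(LINT x|D. g x) = 0" and var: "(LINT x|D. (g x)\<^sup>2) = V"
  shows "integrable (Pi\<^sub>M J (\<lambda>_. D)) (\<lambda>z. (\<Sum>j\<in>J. t j * g (z j))\<^sup>2)"
    and "(LINT z|Pi\<^sub>M J (\<lambda>_. D). (\<Sum>j\<in>J. t j * g (z j))\<^sup>2) = V * (\<Sum>j\<in>J. (t j)\<^sup>2)"
proof -
  have sq: "(\<Sum>j\<in>J. t j * g (z j))\<^sup>2 = (\<Sum>j\<in>J. \<Sum>k\<in>J. t j * t k * (g (z j) * g (z k)))" for z
    unfolding power2_eq_square sum_product by (intro sum.cong refl) (simp add: algebra_simps)
  have int: "integrable (Pi\<^sub>M J (\<lambda>_. D)) (\<lambda>z. g (z j) * g (z k))"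
    and ex: "(LINT z|Pi\<^sub>M J (\<lambda>_. D). g (z j) * g (z k)) = (if k = j then V else 0)"
    if "j \<in> J" "k \<in> J" for j k
    using PiM_integral_monomials[OF D J g1 g2 mean var, of "{j}" "{k}"] that by auto
  show "integrable (Pi\<^sub>M J (\<lambda>_. D)) (\<lambda>z. (\<Sum>j\<in>J. t j * g (z j))\<^sup>2)"
    unfolding sq by (intro Bochner_Integration.integrable_sum integrable_mult_right int)
  have "(LINT z|Pi\<^sub>M J (\<lambda>_. D). (\<Sum>j\<in>J. t j * g (z j))\<^sup>2)
      = (\<Sum>j\<in>J. \<Sum>k\<in>J. t j * t k * (LINT z|Pi\<^sub>M J (\<lambda>_. D). g (z j) * g (z k)))"
    unfolding sq by (simp add: Bochner_Integration.integral_sum Bochner_Integration.integrable_sum int)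
  also have "\<dots> = (\<Sum>j\<in>J. V * (t j)\<^sup>2)"
    using J by (intro sum.cong refl) (simp add: ex if_distrib[of "\<lambda>c. _ * c"] power2_eq_square cong: if_cong)
  finally show "(LINT z|Pi\<^sub>M J (\<lambda>_. D). (\<Sum>j\<in>J. t j * g (z j))\<^sup>2) = V * (\<Sum>j\<in>J. (t j)\<^sup>2)"
    by (simp add: sum_distrib_left)
qed

text \<open>
  The off-diagonal part of a quadratic form, centered by its mean for independent variables of mean \<open>m\<close>.
\<close>

definition offdiag_error :: "'i set \<Rightarrow> ('i \<Rightarrow> 'i \<Rightarrow> real) \<Rightarrow> real \<Rightarrow> ('i \<Rightarrow> real) \<Rightarrow> real" where
  "offdiag_error J R m x = (\<Sum>(j, k)\<in>offdiag J. R j k * (x j * x k - m\<^sup>2))"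

text \<open>
  Substituting \<open>x j = (x j - m) + m\<close> splits the error into a quadratic and a linear part in the centered variables.
\<close>

lemma offdiag_error_eq:
  fixes R :: "'i \<Rightarrow> 'i \<Rightarrow> real"
  assumes J: "finite J" and sym: "\<forall>j\<in>J. \<forall>k\<in>J. R j k = R k j"
  shows "offdiag_error J R m x = (\<Sum>(j, k)\<in>offdiag J. R j k * ((x j - m) * (x k - m)))
      + (\<Sum>j\<in>J. 2 * m * ((\<Sum>k\<in>J. R j k) - R j j) * (x j - m))"
proof -
  have sums: "(\<Sum>(j, k)\<in>offdiag J. F j k) = (\<Sum>j\<in>J. \<Sum>k\<in>J - {j}. F j k)" for F :: "'i \<Rightarrow> 'i \<Rightarrow> real"
  proof -
    have "offdiag J = (SIGMA j:J. J - {j})" by (auto simp: offdiag_def)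
    then show ?thesis using J by (simp add: sum.Sigma)
  qed
  have swap: "(\<Sum>(j, k)\<in>offdiag J. F j k) = (\<Sum>(j, k)\<in>offdiag J. F k j)" for F :: "'i \<Rightarrow> 'i \<Rightarrow> real"
    by (rule sum.reindex_bij_witness[of _ prod.swap prod.swap]) (auto simp: offdiag_def)
  have row: "(\<Sum>(j, k)\<in>offdiag J. R j k * (m * (x j - m)))
      = (\<Sum>j\<in>J. m * ((\<Sum>k\<in>J. R j k) - R j j) * (x j - m))"
    unfolding sums
  proof (rule sum.cong[OF refl])
    fix j assume j: "j \<in> J"
    have "(\<Sum>k\<in>J - {j}. R j k) = (\<Sum>k\<in>J. R j k) - R j j"
      using J j by (simp add: sum_diff1)
    moreover have "(\<Sum>k\<in>J - {j}. R j k * (m * (x j - m))) = (\<Sum>k\<in>J - {j}. R j k) * (m * (x j - m))"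
      by (rule sum_distrib_right[symmetric])
    ultimately show "(\<Sum>k\<in>J - {j}. R j k * (m * (x j - m))) = m * ((\<Sum>k\<in>J. R j k) - R j j) * (x j - m)"
      by simp
  qed
  have "(\<Sum>(j, k)\<in>offdiag J. R j k * (m * (x k - m))) = (\<Sum>(j, k)\<in>offdiag J. R k j * (m * (x j - m)))"
    by (rule swap)
  also have "\<dots> = (\<Sum>(j, k)\<in>offdiag J. R j k * (m * (x j - m)))"
    by (intro sum.cong refl) (auto simp: offdiag_def sym)
  finally have col: "(\<Sum>(j, k)\<in>offdiag J. R j k * (m * (x k - m)))
      = (\<Sum>(j, k)\<in>offdiag J. R j k * (m * (x j - m)))" .
  have "offdiag_error J R m x = (\<Sum>(j, k)\<in>offdiag J. R j k * ((x j - m) * (x k - m))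
      + R j k * (m * (x j - m)) + R j k * (m * (x k - m)))"
    unfolding offdiag_error_def
    by (intro sum.cong refl) (auto simp: algebra_simps power2_eq_square)
  also have "\<dots> = (\<Sum>(j, k)\<in>offdiag J. R j k * ((x j - m) * (x k - m)))
      + (\<Sum>(j, k)\<in>offdiag J. R j k * (m * (x j - m))) + (\<Sum>(j, k)\<in>offdiag J. R j k * (m * (x k - m)))"
    by (simp add: sum.distrib case_prod_unfold)
  also have "\<dots> = (\<Sum>(j, k)\<in>offdiag J. R j k * ((x j - m) * (x k - m)))
      + (\<Sum>j\<in>J. 2 * m * ((\<Sum>k\<in>J. R j k) - R j j) * (x j - m))"
    unfolding col row by (simp add: sum_distrib_left mult.assoc)
  finally show ?thesis .
qed

text \<open>
  The mean \<open>m\<close> of the truncated entries cannot be neglected in general, but it enters only through \<open>m\<^sup>2 V N\<close>.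
\<close>

definition offdiag_bound :: "real \<Rightarrow> real \<Rightarrow> real \<Rightarrow> real" where
  "offdiag_bound N m V = sqrt (4 * V\<^sup>2 * N + 32 * m\<^sup>2 * V * N)"

lemma offdiag_error_first_moment:
  fixes b :: "'b \<Rightarrow> real" and R :: "'i \<Rightarrow> 'i \<Rightarrow> real"
  assumes D: "prob_space D" and J: "finite J"
    and b: "b \<in> borel_measurable D" and b2: "integrable D (\<lambda>x. (b x)\<^sup>2)"
    and m: "m = (LINT x|D. b x)" and V: "V = (LINT x|D. (b x - m)\<^sup>2)"
    and sym: "\<forall>j\<in>J. \<forall>k\<in>J. R j k = R k j"
    and row: "\<forall>j\<in>J. (\<Sum>k\<in>J. (R j k)\<^sup>2) \<le> 1"
    and rows: "(\<Sum>j\<in>J. (\<Sum>k\<in>J. R j k)\<^sup>2) \<le> card J"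
  shows "integrable (Pi\<^sub>M J (\<lambda>_. D)) (\<lambda>z. offdiag_error J R m (\<lambda>j. b (z j)))"
    and "(LINT z|Pi\<^sub>M J (\<lambda>_. D). \<bar>offdiag_error J R m (\<lambda>j. b (z j))\<bar>) \<le> offdiag_bound (card J) m V"
proof -
  interpret D: prob_space D by fact
  interpret PJ: prob_space "Pi\<^sub>M J (\<lambda>_. D)" by (intro prob_space_PiM D)
  let ?P = "Pi\<^sub>M J (\<lambda>_. D)"
  define g where "g x = b x - m" for x
  define t where "t j = 2 * m * ((\<Sum>k\<in>J. R j k) - R j j)" for j
  have b1: "integrable D b" by (rule D.square_integrable_imp_integrable[OF b b2])
  have g1: "integrable D g" unfolding g_def[abs_def] using b1 by simp
  have g2: "integrable D (\<lambda>x. (g x)\<^sup>2)"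
    unfolding g_def[abs_def] power2_diff using b1 b2 by simp
  have mean: "(LINT x|D. g x) = 0" unfolding g_def using b1 m by (simp add: D.prob_space)
  have var: "(LINT x|D. (g x)\<^sup>2) = V" by (simp add: V g_def)
  define Q where "Q z = (\<Sum>(j, k)\<in>offdiag J. R j k * (g (z j) * g (z k)))" for z
  define L where "L z = (\<Sum>j\<in>J. t j * g (z j))" for z
  define T where "T z = offdiag_error J R m (\<lambda>j. b (z j))" for z
  have TQL: "T z = Q z + L z" for z
    unfolding T_def offdiag_error_eq[OF J sym] Q_def L_def g_def t_def ..
  have mb: "(\<lambda>z. b (z j)) \<in> borel_measurable ?P" if "j \<in> J" for j
    by (rule measurable_compose[OF measurable_component_singleton[OF that] b])
  have mT: "T \<in> borel_measurable ?P"
    unfolding T_def[abs_def] offdiag_error_def case_prod_unfold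
    by (intro borel_measurable_sum borel_measurable_times borel_measurable_diff
        borel_measurable_const mb) (auto simp: offdiag_def)
  have Q2: "integrable ?P (\<lambda>z. (Q z)\<^sup>2)" "(LINT z|?P. (Q z)\<^sup>2) \<le> 2 * V\<^sup>2 * card J"
    using offdiag_quadratic_second_moment[OF D J g1 g2 mean var sym row] unfolding Q_def by auto
  have L2: "integrable ?P (\<lambda>z. (L z)\<^sup>2)" "(LINT z|?P. (L z)\<^sup>2) = V * (\<Sum>j\<in>J. (t j)\<^sup>2)"
    using linear_second_moment[OF D J g1 g2 mean var] unfolding L_def by auto
  have V0: "0 \<le> V" unfolding V by simp
  have le: "(T z)\<^sup>2 \<le> 2 * (Q z)\<^sup>2 + 2 * (L z)\<^sup>2" for z
    using sum_squares_bound[of "Q z" "L z"] by (simp add: TQL power2_sum)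
  have T2: "integrable ?P (\<lambda>z. (T z)\<^sup>2)"
    by (rule Bochner_Integration.integrable_bound[of _ "\<lambda>z. 2 * (Q z)\<^sup>2 + 2 * (L z)\<^sup>2"])
      (use Q2 L2 le mT in auto)
  have diag: "(R j j)\<^sup>2 \<le> 1" if "j \<in> J" for j
    by (rule order_trans[OF member_le_sum row[rule_format, OF that]]) (use that J in auto)
  have "(\<Sum>j\<in>J. (t j)\<^sup>2) \<le> (\<Sum>j\<in>J. 8 * m\<^sup>2 * ((\<Sum>k\<in>J. R j k)\<^sup>2 + 1))"
  proof (rule sum_mono)
    fix j assume j: "j \<in> J"
    define s where "s = (\<Sum>k\<in>J. R j k)"
    have "(s - R j j)\<^sup>2 \<le> 2 * s\<^sup>2 + 2 * (R j j)\<^sup>2"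
      using sum_squares_bound[of s "- R j j"] by (simp add: power2_diff)
    also have "\<dots> \<le> 2 * (s\<^sup>2 + 1)" using diag[OF j] by simp
    finally have "4 * m\<^sup>2 * (s - R j j)\<^sup>2 \<le> 4 * m\<^sup>2 * (2 * (s\<^sup>2 + 1))"
      by (rule mult_left_mono) simp
    moreover have "(t j)\<^sup>2 = 4 * m\<^sup>2 * (s - R j j)\<^sup>2"
      by (simp add: t_def s_def power_mult_distrib)
    ultimately show "(t j)\<^sup>2 \<le> 8 * m\<^sup>2 * ((\<Sum>k\<in>J. R j k)\<^sup>2 + 1)"
      unfolding s_def by linarith
  qed
  also have "\<dots> = 8 * m\<^sup>2 * ((\<Sum>j\<in>J. (\<Sum>k\<in>J. R j k)\<^sup>2) + card J)"
    by (simp add: sum_distrib_left[symmetric] sum.distrib)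
  also have "\<dots> \<le> 8 * m\<^sup>2 * (card J + card J)"
    using rows by (intro mult_left_mono add_right_mono) auto
  finally have t2: "(\<Sum>j\<in>J. (t j)\<^sup>2) \<le> 16 * m\<^sup>2 * card J" by simp
  have "(LINT z|?P. (T z)\<^sup>2) \<le> (LINT z|?P. 2 * (Q z)\<^sup>2 + 2 * (L z)\<^sup>2)"
    by (rule integral_mono) (use T2 Q2 L2 le in auto)
  also have "\<dots> = 2 * (LINT z|?P. (Q z)\<^sup>2) + 2 * (LINT z|?P. (L z)\<^sup>2)"
    using Q2 L2 by simp
  also have "\<dots> \<le> 2 * (2 * V\<^sup>2 * card J) + 2 * (V * (16 * m\<^sup>2 * card J))"
    unfolding L2(2) by (intro add_mono mult_left_mono Q2 t2 V0) auto
  also have "\<dots> = 4 * V\<^sup>2 * card J + 32 * m\<^sup>2 * V * card J" by simp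
  finally have T2le: "(LINT z|?P. (T z)\<^sup>2) \<le> 4 * V\<^sup>2 * card J + 32 * m\<^sup>2 * V * card J" .
  note I = integral_abs_le_sqrt[OF PJ.prob_space_axioms T2 mT]
  show "integrable ?P (\<lambda>z. offdiag_error J R m (\<lambda>j. b (z j)))"
    using I(1) by (simp add: T_def[abs_def])
  have "(LINT z|?P. \<bar>T z\<bar>) \<le> offdiag_bound (card J) m V"
    unfolding offdiag_bound_def by (rule order_trans[OF I(2)]) (use T2le in simp)
  then show "(LINT z|?P. \<bar>offdiag_error J R m (\<lambda>j. b (z j))\<bar>) \<le> offdiag_bound (card J) m V"
    by (simp add: T_def)
qed

text \<open>
  The entries \<open>b + c\<close> agree with the square integrable entries \<open>b\<close> except on an event of small probability.
\<close>

lemma offdiag_error_decomposition: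
  fixes R :: "'i \<Rightarrow> 'i \<Rightarrow> real"
  assumes dec: "additive_decomposition \<nu> \<beta>" and J: "finite J"
    and b2: "integrable \<beta> (\<lambda>p. (fst p)\<^sup>2)"
    and m: "m = prob_space.expectation \<beta> fst" and V: "V = prob_space.variance \<beta> fst"
    and sym: "\<forall>j\<in>J. \<forall>k\<in>J. R j k = R k j"
    and row: "\<forall>j\<in>J. (\<Sum>k\<in>J. (R j k)\<^sup>2) \<le> 1"
    and rows: "(\<Sum>j\<in>J. (\<Sum>k\<in>J. R j k)\<^sup>2) \<le> card J"
  shows "(LINT r|Pi\<^sub>M J (\<lambda>_. \<nu>). min 1 \<bar>offdiag_error J R m r\<bar>)
     \<le> card J * measure \<beta> {p \<in> space \<beta>. snd p \<noteq> 0} + offdiag_bound (card J) m V"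
proof -
  have \<beta>: "prob_space \<beta>" and sets: "sets \<beta> = sets borel"
    and \<nu>: "\<nu> = distr \<beta> borel (\<lambda>p. fst p + snd p)"
    using dec by (auto simp: additive_decomposition_def)
  interpret \<beta>: prob_space \<beta> by fact
  have mfst: "fst \<in> borel_measurable \<beta>" and msnd: "snd \<in> borel_measurable \<beta>"
    unfolding measurable_cong_sets[OF sets refl]
    by (intro borel_measurable_continuous_onI continuous_intros)+
  let ?P = "Pi\<^sub>M J (\<lambda>_. \<beta>)"
  let ?ab = "\<lambda>p::real\<times>real. fst p + snd p"
  interpret PJ: prob_space ?P by (intro prob_space_PiM \<beta>)
  have mab: "?ab \<in> borel_measurable \<beta>" using mfst msnd by simp
  define T where "T x = offdiag_error J R m x" for x
  have T_cong: "T x = T y" if "\<And>j. j \<in> J \<Longrightarrow> x j = y j" for x y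
    unfolding T_def offdiag_error_def using that by (intro sum.cong refl) (auto simp: offdiag_def)
  have mT: "(\<lambda>z. T (\<lambda>j. h (z j))) \<in> borel_measurable (Pi\<^sub>M J (\<lambda>_. D))"
    if "h \<in> borel_measurable D" for h :: "'c \<Rightarrow> real" and D
  proof -
    have "(\<lambda>z. h (z j)) \<in> borel_measurable (Pi\<^sub>M J (\<lambda>_. D))" if "j \<in> J" for j
      by (rule measurable_compose[OF measurable_component_singleton[OF that] \<open>h \<in> borel_measurable D\<close>])
    then show ?thesis
      unfolding T_def offdiag_error_def case_prod_unfold
      by (intro borel_measurable_sum borel_measurable_times borel_measurable_diff
          borel_measurable_const) (auto simp: offdiag_def)
  qed
  have law: "distr ?P (Pi\<^sub>M J (\<lambda>_. borel)) (compose J ?ab) = Pi\<^sub>M J (\<lambda>_. \<nu>)"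
  proof -
    have "distr ?P (Pi\<^sub>M J (\<lambda>_. \<nu>)) (compose J ?ab) = Pi\<^sub>M J (\<lambda>_. distr \<beta> \<nu> ?ab)"
      by (rule distr_PiM_finite_prob_space'[OF J])
        (use \<beta> mab \<nu> in \<open>auto intro!: \<beta>.prob_space_distr\<close>)
    moreover have "distr \<beta> \<nu> ?ab = \<nu>"
      unfolding \<nu> by (rule distr_cong) auto
    moreover have "distr ?P (Pi\<^sub>M J (\<lambda>_. \<nu>)) (compose J ?ab) = distr ?P (Pi\<^sub>M J (\<lambda>_. borel)) (compose J ?ab)"
      by (rule distr_cong) (auto simp: \<nu> intro!: sets_PiM_cong)
    ultimately show ?thesis by simp
  qed
  have mcomp: "compose J ?ab \<in> ?P \<rightarrow>\<^sub>M Pi\<^sub>M J (\<lambda>_. borel)"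
    unfolding compose_def
    by (intro measurable_restrict measurable_compose[OF _ mab] measurable_component_singleton)
  have S: "{p \<in> space \<beta>. snd p \<noteq> 0} \<in> sets \<beta>" using msnd by measurable
  have mi: "(indicator {p. snd p \<noteq> 0} :: _ \<Rightarrow> real) \<in> borel_measurable \<beta>"
    using S by (simp add: borel_measurable_indicator_iff Int_def conj_commute)
  have c: "integrable ?P (\<lambda>z. indicator {p. snd p \<noteq> 0} (z j) :: real)"
    "(LINT z|?P. indicator {p. snd p \<noteq> 0} (z j)) = measure \<beta> {p \<in> space \<beta>. snd p \<noteq> 0}"
    if j: "j \<in> J" for j
  proof -
    have d: "distr ?P \<beta> (\<lambda>z. z j) = \<beta>"
      by (rule distr_PiM_component) (use \<beta> j in auto)
    have "(LINT z|?P. indicator {p. snd p \<noteq> 0} (z j) :: real) = (LINT p|distr ?P \<beta> (\<lambda>z. z j). indicator {p. snd p \<noteq> 0} p)"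
      by (rule integral_distr[symmetric]) (use j mi in auto)
    also have "\<dots> = measure \<beta> ({p. snd p \<noteq> 0} \<inter> space \<beta>)" unfolding d by simp
    finally show "(LINT z|?P. indicator {p. snd p \<noteq> 0} (z j)) = measure \<beta> {p \<in> space \<beta>. snd p \<noteq> 0}"
      by (simp add: Int_def conj_commute)
    show "integrable ?P (\<lambda>z. indicator {p. snd p \<noteq> 0} (z j) :: real)"
      by (rule PJ.integrable_const_bound[of _ 1])
        (use measurable_compose[OF measurable_component_singleton[OF j] mi] in \<open>auto simp: indicator_def\<close>)
  qed
  have iT: "integrable ?P (\<lambda>z. \<bar>T (\<lambda>j. fst (z j))\<bar>)"
    using offdiag_error_first_moment(1)[OF \<beta> J mfst b2 m V[unfolded m[symmetric]] sym row rows]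
    unfolding T_def by (rule integrable_abs)
  have "(LINT r|Pi\<^sub>M J (\<lambda>_. \<nu>). min 1 \<bar>T r\<bar>) = (LINT z|?P. min 1 \<bar>T (compose J ?ab z)\<bar>)"
    unfolding law[symmetric]
    by (rule integral_distr[OF mcomp]) (use mT[of "\<lambda>x. x" borel] in simp)
  also have "\<dots> = (LINT z|?P. min 1 \<bar>T (\<lambda>j. ?ab (z j))\<bar>)"
  proof -
    have "T (compose J ?ab z) = T (\<lambda>j. ?ab (z j))" for z
      by (rule T_cong) (simp add: compose_def)
    then show ?thesis by simp
  qed
  also have "\<dots> \<le> (LINT z|?P. \<bar>T (\<lambda>j. fst (z j))\<bar> + (\<Sum>j\<in>J. indicator {p. snd p \<noteq> 0} (z j)))"
  proof (rule integral_mono)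
    show "integrable ?P (\<lambda>z. min 1 \<bar>T (\<lambda>j. ?ab (z j))\<bar>)"
      by (rule PJ.integrable_const_bound[of _ 1]) (use mT[OF mab] in auto)
  next
    show "integrable ?P (\<lambda>z. \<bar>T (\<lambda>j. fst (z j))\<bar> + (\<Sum>j\<in>J. indicator {p. snd p \<noteq> 0} (z j)))"
      by (intro Bochner_Integration.integrable_add Bochner_Integration.integrable_sum iT c)
  next
    fix z assume "z \<in> space ?P"
    show "min 1 \<bar>T (\<lambda>j. ?ab (z j))\<bar> \<le> \<bar>T (\<lambda>j. fst (z j))\<bar> + (\<Sum>j\<in>J. indicator {p. snd p \<noteq> 0} (z j))"
    proof (cases "\<forall>j\<in>J. snd (z j) = 0")
      case True
      then have "T (\<lambda>j. ?ab (z j)) = T (\<lambda>j. fst (z j))" by (intro T_cong) simp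
      moreover have "0 \<le> (\<Sum>j\<in>J. indicator {p. snd p \<noteq> 0} (z j) :: real)" by (simp add: sum_nonneg)
      ultimately show ?thesis by simp
    next
      case False
      then obtain j where j: "j \<in> J" "snd (z j) \<noteq> 0" by blast
      have "(1::real) = indicator {p. snd p \<noteq> 0} (z j)" using j by simp
      also have "\<dots> \<le> (\<Sum>j\<in>J. indicator {p. snd p \<noteq> 0} (z j))"
        using j J by (intro member_le_sum) auto
      finally show ?thesis by simp
    qed
  qed
  also have "\<dots> = (LINT z|?P. \<bar>T (\<lambda>j. fst (z j))\<bar>) + (\<Sum>j\<in>J. measure \<beta> {p \<in> space \<beta>. snd p \<noteq> 0})"
    using iT c by (simp add: Bochner_Integration.integral_add Bochner_Integration.integral_sum
        Bochner_Integration.integrable_sum)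
  also have "\<dots> \<le> offdiag_bound (card J) m V + card J * measure \<beta> {p \<in> space \<beta>. snd p \<noteq> 0}"
    using offdiag_error_first_moment(2)[OF \<beta> J mfst b2 m V[unfolded m[symmetric]] sym row rows]
    by (simp add: T_def)
  finally show ?thesis by (simp add: T_def)
qed

section \<open>Variance of the diagonal part\<close>

text \<open>
  If \<open>exp (- \<rho>)\<close> is close to \<open>k\<close> and \<open>\<rho>\<close> to \<open>W + D\<close>, then \<open>exp (- W)\<close> is close to \<open>k exp D\<close>.  The bound is
  uniform in \<open>D\<close>, because \<open>W \<ge> 0\<close> prevents \<open>D\<close> from being large and positive while \<open>\<rho>\<close> stays bounded.
\<close>

lemma exp_transfer:
  fixes k \<rho> W D :: real
  assumes k: "0 < k" "k \<le> 1" and W: "0 \<le> W"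
  shows "\<bar>exp (- W) - min 1 (k * exp D)\<bar> \<le> 6 / k * (\<bar>exp (- \<rho>) - k\<bar> + min 1 \<bar>\<rho> - W - D\<bar>)"
proof -
  define T where "T = \<rho> - W - D"
  define a where "a = \<bar>exp (- \<rho>) - k\<bar>"
  define b where "b = min 1 \<bar>T\<bar>"
  have a0: "0 \<le> a" and b0: "0 \<le> b" by (auto simp: a_def b_def)
  have eW: "0 < exp (- W)" "exp (- W) \<le> 1" using W by auto
  have kD: "0 < k * exp D" using k by simp
  have le1: "\<bar>exp (- W) - min 1 (k * exp D)\<bar> \<le> 1"
  proof -
    have "0 \<le> min 1 (k * exp D)" "min 1 (k * exp D) \<le> 1" using kD by auto
    then show ?thesis using eW by linarith
  qed
  have k4: "4 \<le> 6 / k" using k by (simp add: field_simps)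
  \<comment> \<open>In the first two cases the right hand side is at least 1 and the bound is trivial.\<close>
  consider "1 / 4 \<le> b" | "k / 4 \<le> a" | "b < 1 / 4" "a < k / 4" by linarith
  then have "\<bar>exp (- W) - min 1 (k * exp D)\<bar> \<le> 6 / k * (a + b)"
  proof cases
    case 1
    have "1 \<le> 4 * b" using 1 by simp
    also have "\<dots> \<le> 6 / k * b" by (intro mult_right_mono k4 b0)
    also have "\<dots> \<le> 6 / k * (a + b)" using a0 k by (intro mult_left_mono) auto
    finally show ?thesis using le1 by linarith
  next
    case 2
    have "1 \<le> 6 / k * (k / 4)" using k by simp
    also have "\<dots> \<le> 6 / k * a" using 2 k by (intro mult_left_mono) auto
    also have "\<dots> \<le> 6 / k * (a + b)" using b0 k by (intro mult_left_mono) auto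
    finally show ?thesis using le1 by linarith
  next
    case 3
    have T: "\<bar>T\<bar> < 1 / 4" "b = \<bar>T\<bar>" using 3(1) by (auto simp: b_def min_def split: if_splits)
    have e: "exp (- W) = exp D * (exp T * exp (- \<rho>))"
      by (simp add: T_def flip: exp_add)
    have eT: "\<bar>exp T - 1\<bar> \<le> 2 * \<bar>T\<bar>"
    proof -
      have "exp T \<le> 1 + 2 * \<bar>T\<bar>"
        using exp_bound_lemma[of T] T(1) by simp
      moreover have "1 + T \<le> exp T" by (rule exp_ge_add_one_self)
      ultimately show ?thesis by linarith
    qed
    have er: "3 * k / 4 \<le> exp (- \<rho>)" "exp (- \<rho>) \<le> 5 / 4"
      using 3(2) k unfolding a_def by linarith+
    have eT2: "3 / 4 \<le> exp T" using exp_ge_add_one_self[of T] T(1) by linarith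
    have "exp D * (3 / 4 * (3 * k / 4)) \<le> exp D * (exp T * exp (- \<rho>))"
      using eT2 er k by (intro mult_left_mono mult_mono) auto
    also have "\<dots> \<le> 1" using e eW by simp
    finally have "exp D * k \<le> 16 / 9" by simp
    then have D: "exp D \<le> 2 / k" using k by (simp add: field_simps)
    have "\<bar>exp (- W) - min 1 (k * exp D)\<bar> \<le> \<bar>exp (- W) - k * exp D\<bar>"
      using eW by (auto simp: min_def)
    also have "exp (- W) - k * exp D = exp D * ((exp T - 1) * exp (- \<rho>) + (exp (- \<rho>) - k))"
      unfolding e by (simp add: algebra_simps)
    also have "\<bar>\<dots>\<bar> \<le> exp D * (2 * \<bar>T\<bar> * (5 / 4) + a)"
    proof -
      have "\<bar>(exp T - 1) * exp (- \<rho>)\<bar> \<le> 2 * \<bar>T\<bar> * (5 / 4)"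
        unfolding abs_mult by (intro mult_mono eT) (use er in auto)
      then have "\<bar>(exp T - 1) * exp (- \<rho>) + (exp (- \<rho>) - k)\<bar> \<le> 2 * \<bar>T\<bar> * (5 / 4) + a"
        unfolding a_def by linarith
      then show ?thesis unfolding abs_mult by simp
    qed
    also have "\<dots> \<le> exp D * (3 * (a + b))"
      using a0 T(2) by (intro mult_left_mono) auto
    also have "\<dots> \<le> 2 / k * (3 * (a + b))"
      using D a0 b0 by (intro mult_right_mono) auto
    finally show ?thesis by simp
  qed
  then show ?thesis by (simp add: a_def b_def T_def)
qed

text \<open>
  For a product of independent factors with means \<open>b p\<close> and second moments \<open>a p\<close> the right hand side of the first
  inequality is the variance, and the sum on the left consists of the variances of the factors.
\<close>

lemma prod_gap:
  fixes a b :: "'i \<Rightarrow> real"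
  assumes J: "finite J" and \<beta>: "0 \<le> \<beta>" "\<beta> \<le> 1"
    and b: "\<And>p. p \<in> J \<Longrightarrow> \<beta> \<le> b p" and ab: "\<And>p. p \<in> J \<Longrightarrow> (b p)\<^sup>2 \<le> a p"
  shows "\<beta> ^ (2 * card J) * (\<Sum>p\<in>J. a p - (b p)\<^sup>2) \<le> (\<Prod>p\<in>J. a p) - (\<Prod>p\<in>J. (b p)\<^sup>2)
    \<and> \<beta> ^ (2 * card J) \<le> (\<Prod>p\<in>J. (b p)\<^sup>2)"
  using J b ab
proof (induction J rule: finite_induct)
  case empty
  then show ?case by simp
next
  case (insert i F)
  define A where "A = (\<Prod>p\<in>F. a p)"
  define B where "B = (\<Prod>p\<in>F. (b p)\<^sup>2)"
  define S where "S = (\<Sum>p\<in>F. a p - (b p)\<^sup>2)"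
  define q where "q = \<beta> ^ (2 * card F)"
  have IH: "q * S \<le> A - B" "q \<le> B"
    using insert by (auto simp: A_def B_def S_def q_def)
  have q: "0 \<le> q" using \<beta> by (simp add: q_def)
  have S: "0 \<le> S" unfolding S_def using insert.prems by (intro sum_nonneg) auto
  have bi: "\<beta>\<^sup>2 \<le> (b i)\<^sup>2" using insert.prems(1)[of i] \<beta> by (intro power_mono) auto
  have ai: "(b i)\<^sup>2 \<le> a i" using insert.prems(2) by simp
  have \<beta>2: "0 \<le> \<beta>\<^sup>2" "\<beta>\<^sup>2 \<le> 1" using \<beta> by (auto simp: power_le_one)
  have qS: "0 \<le> q * S" using q S by simp
  have AB: "q \<le> A" using IH qS by linarith
  have c: "\<beta> ^ (2 * card (insert i F)) = \<beta>\<^sup>2 * q"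
    using insert.hyps by (simp add: q_def power2_eq_square)
  have "\<beta>\<^sup>2 * q * (S + (a i - (b i)\<^sup>2)) = \<beta>\<^sup>2 * (q * S) + \<beta>\<^sup>2 * (q * (a i - (b i)\<^sup>2))"
    by (simp add: algebra_simps)
  also have "\<dots> \<le> (b i)\<^sup>2 * (A - B) + A * (a i - (b i)\<^sup>2)"
  proof (rule add_mono)
    show "\<beta>\<^sup>2 * (q * S) \<le> (b i)\<^sup>2 * (A - B)" by (intro mult_mono bi IH(1) qS) simp
    have "\<beta>\<^sup>2 * (q * (a i - (b i)\<^sup>2)) \<le> 1 * (A * (a i - (b i)\<^sup>2))"
      using ai AB q by (intro mult_mono \<beta>2) auto
    then show "\<beta>\<^sup>2 * (q * (a i - (b i)\<^sup>2)) \<le> A * (a i - (b i)\<^sup>2)" by simp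
  qed
  also have "\<dots> = a i * A - (b i)\<^sup>2 * B" by (simp add: algebra_simps)
  finally have 1: "\<beta>\<^sup>2 * q * (S + (a i - (b i)\<^sup>2)) \<le> a i * A - (b i)\<^sup>2 * B" .
  have 2: "\<beta>\<^sup>2 * q \<le> (b i)\<^sup>2 * B" by (intro mult_mono bi IH(2) q) simp
  show ?case
    using 1 2 insert.hyps unfolding c by (simp add: A_def B_def S_def add.commute)
qed

definition square_laplace :: "real measure \<Rightarrow> real \<Rightarrow> real" where
  "square_laplace \<nu> w = (LINT x|\<nu>. exp (- (w * x\<^sup>2)))"

text \<open>
  A truncated fourth moment: the integrand is comparable to \<open>min 1 (x\<^sup>4)\<close>.  Multiplied by the size of the matrix it
  measures the large summands in the sum of the squares of the entries of a row.
\<close>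

definition saturated_moment :: "real measure \<Rightarrow> real" where
  "saturated_moment \<nu> = (LINT x|\<nu>. (1 - exp (- x\<^sup>2))\<^sup>2)"

lemma one_minus_exp_scale:
  fixes w t :: real
  assumes "0 \<le> w" "w \<le> 1"
  shows "w * (1 - exp (- t)) \<le> 1 - exp (- (w * t))"
proof -
  have "exp ((1 - w) *\<^sub>R 0 + w *\<^sub>R (- t)) \<le> (1 - w) * exp 0 + w * exp (- t)"
    by (rule convex_onD[OF exp_convex]) (use assms in auto)
  then show ?thesis by (simp add: algebra_simps)
qed

context real_distribution
begin

lemma exp_square_measurable [measurable]: "(\<lambda>x. exp (- (w * x\<^sup>2))) \<in> borel_measurable M"
proof -
  have "(\<lambda>x::real. exp (- (w * x\<^sup>2))) \<in> borel_measurable borel" by measurable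
  then show ?thesis by simp
qed

lemma exp_square_integrable: "0 \<le> w \<Longrightarrow> integrable M (\<lambda>x. exp (- (w * x\<^sup>2)))"
  by (rule integrable_const_bound[of _ 1]) auto

lemma square_laplace_bounds:
  assumes w: "0 \<le> w" "w \<le> 1"
  shows "square_laplace M 1 \<le> square_laplace M w" "square_laplace M w \<le> 1" "0 \<le> square_laplace M w"
proof -
  show "square_laplace M 1 \<le> square_laplace M w"
    unfolding square_laplace_def using w
    by (intro integral_mono exp_square_integrable) (auto simp: mult_left_le_one_le)
  have "square_laplace M w \<le> (LINT x|M. 1)"
    unfolding square_laplace_def using w by (intro integral_mono exp_square_integrable) auto
  then show "square_laplace M w \<le> 1" using prob_space by simp
  show "0 \<le> square_laplace M w" unfolding square_laplace_def by simp
qed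

lemma square_laplace_variance:
  assumes w: "0 \<le> w" "w \<le> 1"
  shows "w\<^sup>2 * saturated_moment M - (1 - square_laplace M 1)\<^sup>2 \<le> square_laplace M (2 * w) - (square_laplace M w)\<^sup>2"
    and "(square_laplace M w)\<^sup>2 \<le> square_laplace M (2 * w)"
proof -
  define f where "f x = exp (- (w * x\<^sup>2))" for x
  define g where "g x = 1 - f x" for x
  have fi: "integrable M f" unfolding f_def[abs_def] by (rule exp_square_integrable[OF w(1)])
  have f2: "(f x)\<^sup>2 = exp (- (2 * w * x\<^sup>2))" for x
    by (simp add: f_def power2_eq_square flip: exp_add)
  have f2i: "integrable M (\<lambda>x. (f x)\<^sup>2)"
    unfolding f2 by (rule exp_square_integrable) (use w in simp)
  have Ef: "(LINT x|M. f x) = square_laplace M w" "(LINT x|M. (f x)\<^sup>2) = square_laplace M (2 * w)"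
    unfolding f2 by (simp_all add: f_def square_laplace_def)
  have var: "variance f = square_laplace M (2 * w) - (square_laplace M w)\<^sup>2"
    by (subst variance_eq[OF fi f2i]) (simp add: Ef)
  show "(square_laplace M w)\<^sup>2 \<le> square_laplace M (2 * w)"
    using variance_positive[of f] var by linarith
  have u2i: "integrable M (\<lambda>x. (1 - exp (- x\<^sup>2))\<^sup>2)"
  proof (rule integrable_const_bound[of _ 1])
    have "\<bar>1 - exp (- x\<^sup>2)\<bar> \<le> 1" for x :: real by simp
    then show "AE x in M. norm ((1 - exp (- x\<^sup>2))\<^sup>2) \<le> 1" by (simp add: abs_square_le_1)
    have "(\<lambda>x::real. (1 - exp (- x\<^sup>2))\<^sup>2) \<in> borel_measurable borel" by measurable
    then show "(\<lambda>x. (1 - exp (- x\<^sup>2))\<^sup>2) \<in> borel_measurable M" by simp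
  qed
  have g2i: "integrable M (\<lambda>x. (g x)\<^sup>2)"
    unfolding g_def power2_diff using fi f2i by simp
  have Eg: "(LINT x|M. g x) = 1 - square_laplace M w"
    unfolding g_def using fi prob_space by (simp add: Ef)
  have Eg2: "(LINT x|M. (g x)\<^sup>2) = 1 - 2 * square_laplace M w + square_laplace M (2 * w)"
  proof -
    have "(LINT x|M. (g x)\<^sup>2) = (LINT x|M. 1 - 2 * f x + (f x)\<^sup>2)"
      by (simp add: g_def power2_diff algebra_simps)
    also have "\<dots> = 1 - 2 * square_laplace M w + square_laplace M (2 * w)"
      using fi f2i prob_space by (simp add: Ef)
    finally show ?thesis .
  qed
  have "w\<^sup>2 * saturated_moment M = (LINT x|M. w\<^sup>2 * (1 - exp (- x\<^sup>2))\<^sup>2)"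
    by (simp add: saturated_moment_def)
  also have "\<dots> \<le> (LINT x|M. (g x)\<^sup>2)"
  proof (rule integral_mono)
    show "w\<^sup>2 * (1 - exp (- x\<^sup>2))\<^sup>2 \<le> (g x)\<^sup>2" for x
      unfolding power_mult_distrib[symmetric] g_def f_def
      by (intro power_mono one_minus_exp_scale w mult_nonneg_nonneg) simp
  qed (use u2i g2i in auto)
  finally have 1: "w\<^sup>2 * saturated_moment M \<le> 1 - 2 * square_laplace M w + square_laplace M (2 * w)"
    by (simp add: Eg2)
  have "(1 - square_laplace M w)\<^sup>2 \<le> (1 - square_laplace M 1)\<^sup>2"
    using square_laplace_bounds[OF w] by (intro power_mono) auto
  then show "w\<^sup>2 * saturated_moment M - (1 - square_laplace M 1)\<^sup>2 \<le> square_laplace M (2 * w) - (square_laplace M w)\<^sup>2"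
    using 1 by (simp add: power2_diff)
qed

end

definition quad_form :: "'i set \<Rightarrow> ('i \<Rightarrow> 'i \<Rightarrow> real) \<Rightarrow> ('i \<Rightarrow> real) \<Rightarrow> real" where
  "quad_form J R r = (\<Sum>p\<in>J. \<Sum>q\<in>J. r p * R p q * r q)"

lemma quad_form_split:
  assumes J: "finite J"
  shows "offdiag_error J R m r = quad_form J R r - (\<Sum>p\<in>J. R p p * (r p)\<^sup>2) - m\<^sup>2 * (\<Sum>(p, q)\<in>offdiag J. R p q)"
proof -
  have o: "offdiag J = (SIGMA p:J. J - {p})" by (auto simp: offdiag_def)
  have "quad_form J R r = (\<Sum>p\<in>J. R p p * (r p)\<^sup>2 + (\<Sum>q\<in>J - {p}. R p q * (r p * r q)))"
    unfolding quad_form_def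
  proof (rule sum.cong[OF refl])
    fix p assume p: "p \<in> J"
    show "(\<Sum>q\<in>J. r p * R p q * r q) = R p p * (r p)\<^sup>2 + (\<Sum>q\<in>J - {p}. R p q * (r p * r q))"
      unfolding sum.remove[OF J p] by (simp add: power2_eq_square mult_ac)
  qed
  also have "\<dots> = (\<Sum>p\<in>J. R p p * (r p)\<^sup>2) + (\<Sum>(p, q)\<in>offdiag J. R p q * (r p * r q))"
    unfolding o sum.distrib using J by (simp add: sum.Sigma)
  finally have "quad_form J R r = (\<Sum>p\<in>J. R p p * (r p)\<^sup>2) + (\<Sum>(p, q)\<in>offdiag J. R p q * (r p * r q))" .
  moreover have "offdiag_error J R m r = (\<Sum>(p, q)\<in>offdiag J. R p q * (r p * r q)) - m\<^sup>2 * (\<Sum>(p, q)\<in>offdiag J. R p q)"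
    unfolding offdiag_error_def sum_distrib_left sum_subtractf[symmetric]
    by (intro sum.cong refl) (auto simp: algebra_simps)
  ultimately show ?thesis by simp
qed

text \<open>
  Given the weights \<open>R\<close>, the variable \<open>exp (- W)\<close> with \<open>W\<close> the diagonal part of the quadratic form is close to the
  constant \<open>min 1 (k exp D)\<close>, with \<open>D\<close> the mean of the off-diagonal part.  Its variance is bounded below by
  \<open>prod_gap\<close> and \<open>square_laplace_variance\<close>.  The parameter \<open>c\<close> makes the lower bound linear in \<open>R p p\<close>, by
  \<open>x\<^sup>2 \<ge> 2 c x - c\<^sup>2\<close>, so that only the mean of \<open>R p p\<close> enters after integration.
\<close>

lemma row_variance_bound:
  fixes R :: "'i \<Rightarrow> 'i \<Rightarrow> real"
  assumes \<nu>: "real_distribution \<nu>" and dec: "additive_decomposition \<nu> \<beta>" and J: "finite J"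
    and b2: "integrable \<beta> (\<lambda>p. (fst p)\<^sup>2)"
    and m: "m = prob_space.expectation \<beta> fst" and V: "V = prob_space.variance \<beta> fst"
    and sym: "\<forall>j\<in>J. \<forall>k\<in>J. R j k = R k j"
    and row: "\<forall>j\<in>J. (\<Sum>k\<in>J. (R j k)\<^sup>2) \<le> 1"
    and rows: "(\<Sum>j\<in>J. (\<Sum>k\<in>J. R j k)\<^sup>2) \<le> card J"
    and diag: "\<forall>p\<in>J. 0 \<le> R p p \<and> R p p \<le> 1"
    and pos: "\<forall>r. 0 \<le> quad_form J R r"
    and k: "0 < k" "k \<le> 1"
  shows "(square_laplace \<nu> 1) ^ (2 * card J) *
      (saturated_moment \<nu> * (\<Sum>p\<in>J. 2 * c * R p p - c\<^sup>2) - card J * (1 - square_laplace \<nu> 1)\<^sup>2)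
    \<le> 6 / k * ((LINT r|Pi\<^sub>M J (\<lambda>_. \<nu>). \<bar>exp (- quad_form J R r) - k\<bar>)
        + (card J * measure \<beta> {p \<in> space \<beta>. snd p \<noteq> 0} + offdiag_bound (card J) m V))"
proof -
  interpret \<nu>: real_distribution \<nu> by fact
  interpret P: product_sigma_finite "\<lambda>_. \<nu>" by unfold_locales
  let ?P = "Pi\<^sub>M J (\<lambda>_. \<nu>)"
  interpret PJ: prob_space ?P by (intro prob_space_PiM \<nu>.prob_space_axioms)
  define \<phi> where "\<phi> = square_laplace \<nu>"
  define W where "W r = (\<Sum>p\<in>J. R p p * (r p)\<^sup>2)" for r
  define D where "D = m\<^sup>2 * (\<Sum>(p, q)\<in>offdiag J. R p q)"
  define T where "T r = offdiag_error J R m r" for r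
  \<comment> \<open>The constant to which \<open>exp (- W)\<close> is close; clipping it at 1 keeps the
    squared distance below the distance.\<close>
  define \<kappa> where "\<kappa> = min 1 (k * exp D)"
  have comp: "(\<lambda>r. r p) \<in> borel_measurable ?P" if "p \<in> J" for p
  proof -
    have "(\<lambda>r. r p) \<in> ?P \<rightarrow>\<^sub>M \<nu>" by (rule measurable_component_singleton[OF that])
    then show ?thesis by (simp add: measurable_cong_sets[OF refl \<nu>.events_eq_borel])
  qed
  have mq: "quad_form J R \<in> borel_measurable ?P"
    unfolding quad_form_def[abs_def]
    by (intro borel_measurable_sum borel_measurable_times borel_measurable_const comp)
  have mW: "W \<in> borel_measurable ?P"
    unfolding W_def[abs_def]
    by (intro borel_measurable_sum borel_measurable_times borel_measurable_power borel_measurable_const comp)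
  have mT: "T \<in> borel_measurable ?P"
    unfolding T_def[abs_def] offdiag_error_def case_prod_unfold
    by (intro borel_measurable_sum borel_measurable_times borel_measurable_diff
        borel_measurable_const comp) (auto simp: offdiag_def)
  have W0: "0 \<le> W r" for r unfolding W_def using diag by (intro sum_nonneg) auto
  have T: "T r = quad_form J R r - W r - D" for r
    unfolding T_def W_def D_def by (rule quad_form_split[OF J])
  have lap: "integrable ?P (\<lambda>r. exp (- (s * W r)))" "(LINT r|?P. exp (- (s * W r))) = (\<Prod>p\<in>J. \<phi> (s * R p p))"
    if s: "0 \<le> s" for s
  proof -
    have e: "exp (- (s * W r)) = (\<Prod>p\<in>J. exp (- (s * R p p * (r p)\<^sup>2)))" for r
      using J by (simp add: W_def sum_distrib_left sum_negf[symmetric] exp_sum mult.assoc)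
    have i: "integrable \<nu> (\<lambda>x. exp (- (s * R p p * x\<^sup>2)))" if "p \<in> J" for p
      by (rule \<nu>.exp_square_integrable) (use diag s that in auto)
    show "integrable ?P (\<lambda>r. exp (- (s * W r)))"
      unfolding e by (rule P.product_integrable_prod[OF J i])
    show "(LINT r|?P. exp (- (s * W r))) = (\<Prod>p\<in>J. \<phi> (s * R p p))"
      unfolding e \<phi>_def square_laplace_def by (rule P.product_integral_prod[OF J i])
  qed
  have X: "integrable ?P (\<lambda>r. exp (- W r))" "(LINT r|?P. exp (- W r)) = (\<Prod>p\<in>J. \<phi> (R p p))"
    using lap[of 1] by simp_all
  have X2: "integrable ?P (\<lambda>r. (exp (- W r))\<^sup>2)" "(LINT r|?P. (exp (- W r))\<^sup>2) = (\<Prod>p\<in>J. \<phi> (2 * R p p))"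
  proof -
    have "(exp (- W r))\<^sup>2 = exp (- (2 * W r))" for r
      by (simp add: power2_eq_square flip: exp_add)
    then show "integrable ?P (\<lambda>r. (exp (- W r))\<^sup>2)" "(LINT r|?P. (exp (- W r))\<^sup>2) = (\<Prod>p\<in>J. \<phi> (2 * R p p))"
      using lap[of 2] by simp_all
  qed
  have \<kappa>: "0 \<le> \<kappa>" "\<kappa> \<le> 1" using k by (auto simp: \<kappa>_def)
  have iX: "integrable ?P (\<lambda>r. \<bar>exp (- quad_form J R r) - k\<bar>)"
  proof (rule PJ.integrable_const_bound[of _ 1])
    have "\<bar>exp (- quad_form J R r) - k\<bar> \<le> 1" for r
    proof -
      have "0 < exp (- quad_form J R r)" "exp (- quad_form J R r) \<le> 1" using pos by auto
      then show ?thesis using k by linarith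
    qed
    then show "AE r in ?P. norm \<bar>exp (- quad_form J R r) - k\<bar> \<le> 1" by simp
  qed (use mq in measurable)
  have iT: "integrable ?P (\<lambda>r. min 1 \<bar>T r\<bar>)"
    by (rule PJ.integrable_const_bound[of _ 1]) (use mT in auto)
  have gap: "\<phi> 1 ^ (2 * card J) * (\<Sum>p\<in>J. \<phi> (2 * R p p) - (\<phi> (R p p))\<^sup>2)
      \<le> (\<Prod>p\<in>J. \<phi> (2 * R p p)) - (\<Prod>p\<in>J. \<phi> (R p p))\<^sup>2"
    using prod_gap[OF J, of "\<phi> 1" "\<lambda>p. \<phi> (R p p)" "\<lambda>p. \<phi> (2 * R p p)"]
      \<nu>.square_laplace_bounds \<nu>.square_laplace_variance(2) diag
    unfolding \<phi>_def by (simp add: prod_power_distrib)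
  have "saturated_moment \<nu> * (\<Sum>p\<in>J. 2 * c * R p p - c\<^sup>2) - card J * (1 - \<phi> 1)\<^sup>2
      = (\<Sum>p\<in>J. (2 * c * R p p - c\<^sup>2) * saturated_moment \<nu> - (1 - \<phi> 1)\<^sup>2)"
  proof -
    have "(\<Sum>p\<in>J. (2 * c * R p p - c\<^sup>2) * saturated_moment \<nu> - (1 - \<phi> 1)\<^sup>2)
        = (\<Sum>p\<in>J. (2 * c * R p p - c\<^sup>2) * saturated_moment \<nu>) - (\<Sum>p\<in>J. (1 - \<phi> 1)\<^sup>2)"
      by (rule sum_subtractf)
    also have "(\<Sum>p\<in>J. (2 * c * R p p - c\<^sup>2) * saturated_moment \<nu>)
        = (\<Sum>p\<in>J. 2 * c * R p p - c\<^sup>2) * saturated_moment \<nu>"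
      by (rule sum_distrib_right[symmetric])
    finally show ?thesis by (simp add: mult.commute)
  qed
  also have "\<dots> \<le> (\<Sum>p\<in>J. \<phi> (2 * R p p) - (\<phi> (R p p))\<^sup>2)"
  proof (rule sum_mono)
    fix p assume p: "p \<in> J"
    have "2 * c * R p p - c\<^sup>2 \<le> (R p p)\<^sup>2"
      using zero_le_power2[of "R p p - c"] by (simp add: power2_diff algebra_simps)
    moreover have "0 \<le> saturated_moment \<nu>" by (simp add: saturated_moment_def)
    ultimately have "(2 * c * R p p - c\<^sup>2) * saturated_moment \<nu> \<le> (R p p)\<^sup>2 * saturated_moment \<nu>"
      by (rule mult_right_mono)
    then show "(2 * c * R p p - c\<^sup>2) * saturated_moment \<nu> - (1 - \<phi> 1)\<^sup>2 \<le> \<phi> (2 * R p p) - (\<phi> (R p p))\<^sup>2"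
      using \<nu>.square_laplace_variance(1)[of "R p p"] diag p unfolding \<phi>_def by force
  qed
  finally have "\<phi> 1 ^ (2 * card J) * (saturated_moment \<nu> * (\<Sum>p\<in>J. 2 * c * R p p - c\<^sup>2) - card J * (1 - \<phi> 1)\<^sup>2)
      \<le> \<phi> 1 ^ (2 * card J) * (\<Sum>p\<in>J. \<phi> (2 * R p p) - (\<phi> (R p p))\<^sup>2)"
    by (rule mult_left_mono) (use \<nu>.square_laplace_bounds(3)[of 1] in \<open>simp add: \<phi>_def\<close>)
  also note gap
  also have "(\<Prod>p\<in>J. \<phi> (2 * R p p)) - (\<Prod>p\<in>J. \<phi> (R p p))\<^sup>2
      \<le> (LINT r|?P. (exp (- W r) - \<kappa>)\<^sup>2)"
  proof -
    have "(LINT r|?P. (exp (- W r) - \<kappa>)\<^sup>2) = (LINT r|?P. (exp (- W r))\<^sup>2 - 2 * \<kappa> * exp (- W r) + \<kappa>\<^sup>2)"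
      by (simp add: power2_diff algebra_simps)
    also have "\<dots> = (\<Prod>p\<in>J. \<phi> (2 * R p p)) - 2 * \<kappa> * (\<Prod>p\<in>J. \<phi> (R p p)) + \<kappa>\<^sup>2"
      using X X2 by (simp add: PJ.prob_space)
    finally have "(LINT r|?P. (exp (- W r) - \<kappa>)\<^sup>2) - ((\<Prod>p\<in>J. \<phi> (2 * R p p)) - (\<Prod>p\<in>J. \<phi> (R p p))\<^sup>2)
        = ((\<Prod>p\<in>J. \<phi> (R p p)) - \<kappa>)\<^sup>2"
      by (simp add: power2_diff algebra_simps)
    then show ?thesis using zero_le_power2[of "(\<Prod>p\<in>J. \<phi> (R p p)) - \<kappa>"] by linarith
  qed
  also have "\<dots> \<le> (LINT r|?P. 6 / k * (\<bar>exp (- quad_form J R r) - k\<bar> + min 1 \<bar>T r\<bar>))"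
  proof (rule integral_mono)
    show "integrable ?P (\<lambda>r. (exp (- W r) - \<kappa>)\<^sup>2)"
      unfolding power2_diff using X X2 by simp
    show "integrable ?P (\<lambda>r. 6 / k * (\<bar>exp (- quad_form J R r) - k\<bar> + min 1 \<bar>T r\<bar>))"
      by (intro integrable_mult_right Bochner_Integration.integrable_add iX iT)
    fix r assume "r \<in> space ?P"
    define e where "e = exp (- W r)"
    have e: "0 \<le> e" "e \<le> 1" using W0 by (auto simp: e_def)
    have "(e - \<kappa>)\<^sup>2 = \<bar>e - \<kappa>\<bar> * \<bar>e - \<kappa>\<bar>" by (simp add: power2_eq_square)
    also have "\<dots> \<le> 1 * \<bar>e - \<kappa>\<bar>" using e \<kappa> by (intro mult_right_mono) auto
    also have "\<dots> \<le> 6 / k * (\<bar>exp (- quad_form J R r) - k\<bar> + min 1 \<bar>quad_form J R r - W r - D\<bar>)"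
      unfolding e_def \<kappa>_def using exp_transfer[OF k W0, of r D "quad_form J R r"] by simp
    finally show "(exp (- W r) - \<kappa>)\<^sup>2 \<le> 6 / k * (\<bar>exp (- quad_form J R r) - k\<bar> + min 1 \<bar>T r\<bar>)"
      by (simp add: e_def T)
  qed
  also have "\<dots> = 6 / k * ((LINT r|?P. \<bar>exp (- quad_form J R r) - k\<bar>) + (LINT r|?P. min 1 \<bar>T r\<bar>))"
    using iX iT by simp
  also have "\<dots> \<le> 6 / k * ((LINT r|?P. \<bar>exp (- quad_form J R r) - k\<bar>)
      + (card J * measure \<beta> {p \<in> space \<beta>. snd p \<noteq> 0} + offdiag_bound (card J) m V))"
    unfolding T_def using k
    by (intro mult_left_mono add_left_mono offdiag_error_decomposition[OF dec J b2 m V sym row rows]) auto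
  finally show ?thesis by (simp add: \<phi>_def)
qed

section \<open>The first row and the complementary minor\<close>

lemma resolvent_cong:
  assumes "\<And>i j. i < N \<Longrightarrow> j < N \<Longrightarrow> a i j = b i j"
  shows "resolvent N a = resolvent N b"
proof -
  have "one_plus_square N a = one_plus_square N b"
    unfolding one_plus_square_def using assms by (intro eq_matI) (auto intro!: sum.cong)
  then show ?thesis by (simp add: resolvent_def fun_eq_iff)
qed

text \<open>
  The positions below the diagonal that form the first column, and those of the complementary minor.  The
  corner \<open>(0, 0)\<close> belongs to neither.
\<close>

definition row_idx :: "nat \<Rightarrow> (nat \<times> nat) set" where
  "row_idx N = (\<lambda>k. (Suc k, 0)) ` {..<N}"

definition minor_idx :: "nat \<Rightarrow> (nat \<times> nat) set" where
  "minor_idx N = {(i, j). 1 \<le> j \<and> j \<le> i \<and> i \<le> N}"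

definition minor_of :: "(nat \<times> nat \<Rightarrow> real) \<Rightarrow> nat \<Rightarrow> nat \<Rightarrow> real" where
  "minor_of x i j = x (Suc (max i j), Suc (min i j))"

definition row_res :: "nat \<Rightarrow> (nat \<times> nat \<Rightarrow> real) \<Rightarrow> nat \<times> nat \<Rightarrow> nat \<times> nat \<Rightarrow> real" where
  "row_res N x p q = resolvent N (minor_of x) (fst p - 1) (fst q - 1)"

lemma finite_idx [simp]: "finite (row_idx N)" "finite (minor_idx N)"
proof -
  show "finite (row_idx N)" by (simp add: row_idx_def)
  have "minor_idx N \<subseteq> {..N} \<times> {..N}" by (auto simp: minor_idx_def)
  then show "finite (minor_idx N)" using finite_subset by blast
qed

lemma disjoint_idx: "minor_idx N \<inter> row_idx N = {}"
  by (auto simp: minor_idx_def row_idx_def)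

lemma sum_row_idx: "(\<Sum>p\<in>row_idx N. F p) = (\<Sum>k<N. F (Suc k, 0))"
  unfolding row_idx_def by (subst sum.reindex) (auto simp: inj_on_def)

lemma card_row_idx: "card (row_idx N) = N"
  unfolding row_idx_def by (subst card_image) (auto simp: inj_on_def)

lemma minor_idx_mem: "i < N \<Longrightarrow> j < N \<Longrightarrow> (Suc (max i j), Suc (min i j)) \<in> minor_idx N"
  by (auto simp: minor_idx_def)

lemma minor_symmetric: "symmetric_on N (minor_of x)"
  by (simp add: symmetric_on_def minor_of_def max.commute min.commute)

lemma quad_form_row_res:
  "quad_form (row_idx N) (row_res N x) r
     = (\<Sum>k<N. r (Suc k, 0) * matvec N (resolvent N (minor_of x)) (\<lambda>k. r (Suc k, 0)) k)"
  unfolding quad_form_def sum_row_idx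
  by (simp add: row_res_def matvec_def sum_distrib_left mult.assoc)

lemma quad_form_row_res_nonneg: "0 \<le> quad_form (row_idx N) (row_res N x) r"
proof -
  let ?r = "\<lambda>k. r (Suc k, 0)" and ?a = "minor_of x"
  let ?y = "matvec N (resolvent N ?a) ?r"
  have "(\<Sum>k<N. ?y k * ?r k) = (\<Sum>k<N. (?y k)\<^sup>2) + (\<Sum>k<N. (matvec N ?a ?y k)\<^sup>2)"
    by (rule solves_energy[OF minor_symmetric resolvent_solves[OF minor_symmetric]])
  then have "0 \<le> (\<Sum>k<N. ?y k * ?r k)" by (simp add: sum_nonneg)
  then show ?thesis unfolding quad_form_row_res by (simp add: mult.commute)
qed

lemma quad_form_row_res_cong:
  assumes r: "\<And>p. p \<in> row_idx N \<Longrightarrow> r p = r' p" and x: "\<And>p. p \<in> minor_idx N \<Longrightarrow> x p = x' p"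
  shows "quad_form (row_idx N) (row_res N x) r = quad_form (row_idx N) (row_res N x') r'"
proof -
  have "resolvent N (minor_of x) = resolvent N (minor_of x')"
    by (rule resolvent_cong) (simp add: minor_of_def x minor_idx_mem)
  then have "row_res N x = row_res N x'" by (simp add: row_res_def fun_eq_iff)
  then show ?thesis
    unfolding quad_form_def by (intro sum.cong refl) (auto simp: r)
qed

lemma row_res_properties:
  shows "\<forall>p\<in>row_idx N. \<forall>q\<in>row_idx N. row_res N x p q = row_res N x q p"
    and "\<forall>p\<in>row_idx N. (\<Sum>q\<in>row_idx N. (row_res N x p q)\<^sup>2) \<le> 1"
    and "(\<Sum>p\<in>row_idx N. (\<Sum>q\<in>row_idx N. row_res N x p q)\<^sup>2) \<le> card (row_idx N)"
    and "\<forall>p\<in>row_idx N. 0 \<le> row_res N x p p \<and> row_res N x p p \<le> 1"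
proof -
  have s: "symmetric_on N (resolvent N (minor_of x))" by (rule resolvent_sym[OF minor_symmetric])
  show "\<forall>p\<in>row_idx N. \<forall>q\<in>row_idx N. row_res N x p q = row_res N x q p"
    using s by (auto simp: row_res_def row_idx_def symmetric_on_def)
  show "\<forall>p\<in>row_idx N. (\<Sum>q\<in>row_idx N. (row_res N x p q)\<^sup>2) \<le> 1"
    unfolding sum_row_idx using resolvent_row_norm[OF minor_symmetric]
    by (auto simp: row_res_def row_idx_def)
  show "(\<Sum>p\<in>row_idx N. (\<Sum>q\<in>row_idx N. row_res N x p q)\<^sup>2) \<le> card (row_idx N)"
    unfolding sum_row_idx card_row_idx using resolvent_row_sums[OF minor_symmetric]
    by (simp add: row_res_def)
  show "\<forall>p\<in>row_idx N. 0 \<le> row_res N x p p \<and> row_res N x p p \<le> 1"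
    using resolvent_diag_bounds[OF minor_symmetric] by (auto simp: row_res_def row_idx_def)
qed

lemma quad_form_row_res_measurable:
  assumes r: "\<And>p. p \<in> row_idx N \<Longrightarrow> (\<lambda>\<omega>. r \<omega> p) \<in> borel_measurable M"
    and x: "\<And>p. p \<in> minor_idx N \<Longrightarrow> (\<lambda>\<omega>. x \<omega> p) \<in> borel_measurable M"
  shows "(\<lambda>\<omega>. quad_form (row_idx N) (row_res N (x \<omega>)) (r \<omega>)) \<in> borel_measurable M"
proof -
  have "(\<lambda>\<omega>. row_res N (x \<omega>) p q) \<in> borel_measurable M" if "p \<in> row_idx N" "q \<in> row_idx N" for p q
    unfolding row_res_def
    by (rule borel_measurable_resolvent)
      (use that in \<open>auto simp: minor_of_def row_idx_def intro!: x minor_idx_mem\<close>)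
  then show ?thesis
    unfolding quad_form_def by (intro borel_measurable_sum borel_measurable_times r) auto
qed

lemma minor_diag_expectation:
  assumes \<nu>: "real_distribution \<nu>" and p: "p \<in> row_idx N"
  shows "integrable (Pi\<^sub>M (minor_idx N) (\<lambda>_. \<nu>)) (\<lambda>y. row_res N y p p)"
    and "(square_laplace \<nu> 1) ^ N \<le> (LINT y|Pi\<^sub>M (minor_idx N) (\<lambda>_. \<nu>). row_res N y p p)"
proof -
  interpret \<nu>: real_distribution \<nu> by fact
  interpret P: product_sigma_finite "\<lambda>_. \<nu>" by unfold_locales
  let ?K = "minor_idx N"
  let ?P = "Pi\<^sub>M ?K (\<lambda>_. \<nu>)"
  interpret PK: prob_space ?P by (intro prob_space_PiM \<nu>.prob_space_axioms)
  obtain k where k: "k < N" "p = (Suc k, 0)" using p by (auto simp: row_idx_def)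
  have comp: "(\<lambda>y. y q) \<in> borel_measurable ?P" if "q \<in> ?K" for q
  proof -
    have "(\<lambda>y. y q) \<in> ?P \<rightarrow>\<^sub>M \<nu>" by (rule measurable_component_singleton[OF that])
    then show ?thesis by (simp add: measurable_cong_sets[OF refl \<nu>.events_eq_borel])
  qed
  show int: "integrable ?P (\<lambda>y. row_res N y p p)"
  proof (rule PK.integrable_const_bound[of _ 1])
    show "AE y in ?P. norm (row_res N y p p) \<le> 1"
      using row_res_properties(4) p by (auto simp: abs_le_iff intro!: AE_I2)
    show "(\<lambda>y. row_res N y p p) \<in> borel_measurable ?P"
      unfolding row_res_def
      by (rule borel_measurable_resolvent) (use k in \<open>auto simp: minor_of_def intro!: comp minor_idx_mem\<close>)
  qed
  \<comment> \<open>The positions of the entries of row \<open>k\<close> of the minor; by symmetry they are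
    looked up below the diagonal.\<close>
  define Z where "Z = (\<lambda>j. (Suc (max k j), Suc (min k j))) ` {..<N}"
  have Z: "Z \<subseteq> ?K" unfolding Z_def using k by (auto intro!: minor_idx_mem)
  have injZ: "inj_on (\<lambda>j. (Suc (max k j), Suc (min k j))) {..<N}"
    by (auto simp: inj_on_def max_def min_def split: if_splits)
  define f where "f q x = (if q \<in> Z then exp (- (1 * x\<^sup>2)) else 1)" for q and x :: real
  have fi: "integrable \<nu> (f q)" for q
    unfolding f_def[abs_def] using \<nu>.exp_square_integrable[of 1] by (cases "q \<in> Z") auto
  have e: "exp (- (\<Sum>j<N. (minor_of y k j)\<^sup>2)) = (\<Prod>q\<in>?K. f q (y q))" for y
  proof -
    have "(\<Prod>q\<in>?K. f q (y q)) = (\<Prod>q\<in>?K \<inter> Z. exp (- (1 * (y q)\<^sup>2)))"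
      unfolding f_def by (rule prod.inter_restrict[symmetric]) simp
    also have "?K \<inter> Z = Z" using Z by blast
    also have "(\<Prod>q\<in>Z. exp (- (1 * (y q)\<^sup>2))) = (\<Prod>j<N. exp (- (minor_of y k j)\<^sup>2))"
      unfolding Z_def by (subst prod.reindex[OF injZ]) (simp add: minor_of_def)
    also have "\<dots> = exp (- (\<Sum>j<N. (minor_of y k j)\<^sup>2))"
      by (simp add: exp_sum sum_negf[symmetric])
    finally show ?thesis ..
  qed
  have "(LINT y|?P. (\<Prod>q\<in>?K. f q (y q))) = (\<Prod>q\<in>?K. integral\<^sup>L \<nu> (f q))"
    by (rule P.product_integral_prod) (use fi in auto)
  also have "\<dots> = (\<Prod>q\<in>?K. if q \<in> Z then square_laplace \<nu> 1 else 1)"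
  proof (rule prod.cong[OF refl])
    fix q
    show "integral\<^sup>L \<nu> (f q) = (if q \<in> Z then square_laplace \<nu> 1 else 1)"
      using \<nu>.prob_space by (cases "q \<in> Z") (auto simp: f_def[abs_def] square_laplace_def)
  qed
  also have "\<dots> = (\<Prod>q\<in>?K \<inter> Z. square_laplace \<nu> 1)"
    by (rule prod.inter_restrict[symmetric]) simp
  also have "?K \<inter> Z = Z" using Z by blast
  also have "(\<Prod>q\<in>Z. square_laplace \<nu> 1) = square_laplace \<nu> 1 ^ N"
    unfolding Z_def by (simp add: card_image[OF injZ])
  finally have E: "(LINT y|?P. (\<Prod>q\<in>?K. f q (y q))) = square_laplace \<nu> 1 ^ N" .
  have "(LINT y|?P. (\<Prod>q\<in>?K. f q (y q))) \<le> (LINT y|?P. row_res N y p p)"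
  proof (rule integral_mono[OF _ int])
    show "integrable ?P (\<lambda>y. \<Prod>q\<in>?K. f q (y q))"
      by (rule P.product_integrable_prod) (use fi in auto)
    show "(\<Prod>q\<in>?K. f q (y q)) \<le> row_res N y p p" for y
      unfolding e[symmetric] row_res_def k(2)
      using resolvent_diag_lower[OF minor_symmetric k(1)] by simp
  qed
  then show "square_laplace \<nu> 1 ^ N \<le> (LINT y|?P. row_res N y p p)" unfolding E .
qed

text \<open>
  The entries on and below the diagonal are independent, and \<open>G\<close> reads no others; hence their joint law may be
  replaced by a product measure, to which Fubini's theorem applies.
\<close>

lemma iid_symmetric_matrix_law:
  assumes iid: "iid_symmetric_matrix M (Suc N) \<nu> A" and N: "N \<ge> 1" and \<nu>: "real_distribution \<nu>"
  defines "I \<equiv> minor_idx N \<union> row_idx N"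
  assumes G: "G \<in> borel_measurable (Pi\<^sub>M I (\<lambda>_. borel))"
    and cong: "\<And>x y. (\<And>p. p \<in> I \<Longrightarrow> x p = y p) \<Longrightarrow> G x = G y"
  shows "(LINT \<omega>|M. G (\<lambda>p. A \<omega> $$ p)) = (LINT x|Pi\<^sub>M I (\<lambda>_. \<nu>). (G x :: real))"
proof -
  interpret prob_space M using iid by (simp add: iid_symmetric_matrix_def)
  let ?S = "{(i, j). j \<le> i \<and> i < Suc N}"
  define X where "X p \<omega> = A \<omega> $$ p" for p \<omega>
  have X_eq: "(\<lambda>(i, j) \<omega>. A \<omega> $$ (i, j)) = X" by (simp add: X_def fun_eq_iff)
  have I: "I \<subseteq> ?S" by (auto simp: I_def minor_idx_def row_idx_def)
  have "(Suc 0, 0) \<in> I" using N by (auto simp: I_def row_idx_def)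
  then have ne: "I \<noteq> {}" by blast
  have ind: "indep_vars (\<lambda>_. borel) X I"
    using iid I unfolding iid_symmetric_matrix_def X_eq by (blast intro: indep_vars_subset)
  have rv: "X p \<in> borel_measurable M" if "p \<in> I" for p
    using ind that by (simp add: indep_vars_def)
  have law: "distr M borel (X p) = \<nu>" if "p \<in> I" for p
  proof -
    obtain i j where p: "p = (i, j)" "j \<le> i" "i < Suc N" using I \<open>p \<in> I\<close> by auto
    have "distr M borel (\<lambda>\<omega>. A \<omega> $$ (i, j)) = \<nu>"
      using iid p unfolding iid_symmetric_matrix_def by blast
    then show ?thesis by (simp add: X_def[abs_def] p(1))
  qed
  have "distr M (Pi\<^sub>M I (\<lambda>_. borel)) (\<lambda>\<omega>. \<lambda>p\<in>I. X p \<omega>) = Pi\<^sub>M I (\<lambda>p. distr M borel (X p))"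
    using indep_vars_iff_distr_eq_PiM'[of I X "\<lambda>_. borel", OF ne rv] ind by blast
  also have "\<dots> = Pi\<^sub>M I (\<lambda>_. \<nu>)" by (rule PiM_cong) (auto simp: law)
  finally have D: "distr M (Pi\<^sub>M I (\<lambda>_. borel)) (\<lambda>\<omega>. \<lambda>p\<in>I. X p \<omega>) = Pi\<^sub>M I (\<lambda>_. \<nu>)" .
  have "(\<lambda>\<omega>. \<lambda>p\<in>I. X p \<omega>) \<in> M \<rightarrow>\<^sub>M Pi\<^sub>M I (\<lambda>_. borel)"
    using rv by (rule measurable_restrict)
  from integral_distr[OF this G]
  have "(LINT x|Pi\<^sub>M I (\<lambda>_. \<nu>). G x) = (LINT \<omega>|M. G (\<lambda>p\<in>I. X p \<omega>))" unfolding D .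
  also have "\<dots> = (LINT \<omega>|M. G (\<lambda>p. A \<omega> $$ p))"
    by (intro Bochner_Integration.integral_cong refl cong) (simp add: X_def)
  finally show ?thesis ..
qed

text \<open>
  The entries of the first column are independent of the minor.  The row bound is applied for
  each value of the minor and then integrated, with \<open>c\<close> the lower bound of the means
  in \<open>minor_diag_expectation\<close>.
\<close>

lemma master_inequality:
  assumes iid: "iid_symmetric_matrix M (Suc N) \<nu> A" and N: "N \<ge> 1" and \<nu>: "real_distribution \<nu>"
    and dec: "additive_decomposition \<nu> \<beta>" and b2: "integrable \<beta> (\<lambda>p. (fst p)\<^sup>2)"
    and m: "m = prob_space.expectation \<beta> fst" and V: "V = prob_space.variance \<beta> fst"
    and k: "0 < k" "k \<le> 1"
  shows "(square_laplace \<nu> 1) ^ (2 * N) *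
      (saturated_moment \<nu> * (N * (square_laplace \<nu> 1) ^ (2 * N)) - N * (1 - square_laplace \<nu> 1)\<^sup>2)
    \<le> 6 / k * ((LINT \<omega>|M. \<bar>exp (- quad_form (row_idx N) (row_res N (\<lambda>p. A \<omega> $$ p)) (\<lambda>p. A \<omega> $$ p)) - k\<bar>)
        + (N * measure \<beta> {p \<in> space \<beta>. snd p \<noteq> 0} + offdiag_bound N m V))"
proof -
  interpret \<nu>: real_distribution \<nu> by fact
  interpret P: product_sigma_finite "\<lambda>_. \<nu>" by unfold_locales
  let ?K = "minor_idx N" and ?J = "row_idx N"
  let ?PK = "Pi\<^sub>M ?K (\<lambda>_. \<nu>)" and ?PJ = "Pi\<^sub>M ?J (\<lambda>_. \<nu>)"
  interpret PK: prob_space ?PK by (intro prob_space_PiM \<nu>.prob_space_axioms)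
  interpret PJ: prob_space ?PJ by (intro prob_space_PiM \<nu>.prob_space_axioms)
  interpret PI: prob_space "Pi\<^sub>M (?K \<union> ?J) (\<lambda>_. \<nu>)" by (intro prob_space_PiM \<nu>.prob_space_axioms)
  define \<phi> where "\<phi> = square_laplace \<nu> 1"
  define u where "u = saturated_moment \<nu>"
  define \<delta> where "\<delta> = N * measure \<beta> {p \<in> space \<beta>. snd p \<noteq> 0} + offdiag_bound N m V"
  define g where "g y r = \<bar>exp (- quad_form ?J (row_res N y) r) - k\<bar>" for y r
  have g01: "0 \<le> g y r" "g y r \<le> 1" for y r
  proof -
    have "0 < exp (- quad_form ?J (row_res N y) r)" "exp (- quad_form ?J (row_res N y) r) \<le> 1"
      using quad_form_row_res_nonneg by auto
    then show "g y r \<le> 1" unfolding g_def using k by linarith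
  qed (simp add: g_def)
  have to_borel: "f \<in> M' \<rightarrow>\<^sub>M \<nu> \<Longrightarrow> f \<in> borel_measurable M'" for f :: "'z \<Rightarrow> real" and M'
    by (simp add: measurable_cong_sets[OF refl \<nu>.events_eq_borel])
  have meas: "(\<lambda>\<omega>. g (x \<omega>) (r \<omega>)) \<in> borel_measurable M'"
    if "\<And>p. p \<in> ?J \<Longrightarrow> (\<lambda>\<omega>. r \<omega> p) \<in> borel_measurable M'" "\<And>p. p \<in> ?K \<Longrightarrow> (\<lambda>\<omega>. x \<omega> p) \<in> borel_measurable M'"
    for x r and M' :: "'z measure"
  proof -
    have [measurable]: "(\<lambda>\<omega>. quad_form ?J (row_res N (x \<omega>)) (r \<omega>)) \<in> borel_measurable M'"
      by (rule quad_form_row_res_measurable[OF that])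
    show ?thesis unfolding g_def by measurable
  qed
  have mg_pair: "(\<lambda>(y, r). g y r) \<in> borel_measurable (?PK \<Otimes>\<^sub>M ?PJ)"
    unfolding case_prod_unfold
  proof (rule meas)
    show "(\<lambda>z. snd z p) \<in> borel_measurable (?PK \<Otimes>\<^sub>M ?PJ)" if "p \<in> ?J" for p
      by (rule to_borel[OF measurable_compose[OF measurable_snd measurable_component_singleton[OF that]]])
    show "(\<lambda>z. fst z p) \<in> borel_measurable (?PK \<Otimes>\<^sub>M ?PJ)" if "p \<in> ?K" for p
      by (rule to_borel[OF measurable_compose[OF measurable_fst measurable_component_singleton[OF that]]])
  qed
  have mg_I: "(\<lambda>x. g x x) \<in> borel_measurable (Pi\<^sub>M (?K \<union> ?J) (\<lambda>_. borel))"
    by (intro meas measurable_component_singleton) auto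
  have mg_I': "(\<lambda>x. g x x) \<in> borel_measurable (Pi\<^sub>M (?K \<union> ?J) (\<lambda>_. \<nu>))"
    by (intro meas to_borel measurable_component_singleton) auto
  define h where "h y = (LINT r|?PJ. g y r)" for y
  have mh: "h \<in> borel_measurable ?PK"
    unfolding h_def[abs_def] by (rule PJ.borel_measurable_lebesgue_integral[OF mg_pair])
  have h01: "0 \<le> h y" "h y \<le> 1" for y
  proof -
    show "0 \<le> h y" unfolding h_def using g01 by simp
    have "h y \<le> (LINT r|?PJ. 1)"
    proof (cases "integrable ?PJ (g y)")
      case True
      then show ?thesis unfolding h_def using g01 by (intro integral_mono) auto
    next
      case False
      then show ?thesis unfolding h_def by (simp add: not_integrable_integral_eq)
    qed
    then show "h y \<le> 1" by (simp add: PJ.prob_space)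
  qed
  have ih: "integrable ?PK h"
    by (rule PK.integrable_const_bound[of _ 1]) (use h01 mh in auto)
  have "(LINT \<omega>|M. g (\<lambda>p. A \<omega> $$ p) (\<lambda>p. A \<omega> $$ p)) = (LINT x|Pi\<^sub>M (?K \<union> ?J) (\<lambda>_. \<nu>). g x x)"
  proof (rule iid_symmetric_matrix_law[OF iid N \<nu> mg_I])
    show "g x x = g y y" if "\<And>p. p \<in> ?K \<union> ?J \<Longrightarrow> x p = y p" for x y
      unfolding g_def using quad_form_row_res_cong[of N x y x y] that by simp
  qed
  also have "\<dots> = (LINT y|?PK. LINT r|?PJ. g (merge ?K ?J (y, r)) (merge ?K ?J (y, r)))"
    by (rule P.product_integral_fold[OF disjoint_idx])
      (use g01 mg_I' in \<open>auto intro!: PI.integrable_const_bound[of _ 1]\<close>)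
  also have "\<dots> = (LINT y|?PK. h y)"
    unfolding h_def
  proof (intro Bochner_Integration.integral_cong refl)
    fix y r
    show "g (merge ?K ?J (y, r)) (merge ?K ?J (y, r)) = g y r"
    proof -
      have "p \<notin> ?K" if "p \<in> ?J" for p using disjoint_idx[of N] that by blast
      then have "quad_form ?J (row_res N (merge ?K ?J (y, r))) (merge ?K ?J (y, r)) = quad_form ?J (row_res N y) r"
        by (intro quad_form_row_res_cong) (simp_all add: merge_def)
      then show ?thesis unfolding g_def by simp
    qed
  qed
  finally have law: "(LINT \<omega>|M. g (\<lambda>p. A \<omega> $$ p) (\<lambda>p. A \<omega> $$ p)) = (LINT y|?PK. h y)" .
  \<comment> \<open>The value of \<open>c\<close> that maximizes \<open>2 c E R\<^sub>k\<^sub>k -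
    c\<^sup>2\<close> if \<open>E R\<^sub>k\<^sub>k\<close> equals its lower bound.\<close>
  define c where "c = \<phi> ^ N"
  have u0: "0 \<le> u" by (simp add: u_def saturated_moment_def)
  have c0: "0 \<le> c" using \<nu>.square_laplace_bounds(3)[of 1] by (simp add: c_def \<phi>_def)
  have c2: "\<phi> ^ (2 * N) = c\<^sup>2" by (simp add: c_def power_mult[symmetric] mult.commute)
  have bound: "c\<^sup>2 * (u * (\<Sum>p\<in>?J. 2 * c * row_res N y p p - c\<^sup>2) - N * (1 - \<phi>)\<^sup>2) \<le> 6 / k * (h y + \<delta>)" for y
  proof -
    have pos: "\<forall>r. 0 \<le> quad_form ?J (row_res N y) r" using quad_form_row_res_nonneg by blast
    show ?thesis
      using row_variance_bound[OF \<nu> dec finite_idx(1) b2 m V row_res_properties[of N y] pos k, of c]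
      unfolding card_row_idx h_def g_def \<delta>_def u_def \<phi>_def[symmetric] c2 .
  qed
  have ir: "integrable ?PK (\<lambda>y. row_res N y p p)" if "p \<in> ?J" for p
    by (rule minor_diag_expectation(1)[OF \<nu> that])
  have iS: "integrable ?PK (\<lambda>y. \<Sum>p\<in>?J. 2 * c * row_res N y p p - c\<^sup>2)"
    by (intro Bochner_Integration.integrable_sum Bochner_Integration.integrable_diff
        integrable_mult_right ir) auto
  have "N * c\<^sup>2 = (\<Sum>p\<in>?J. 2 * c * c - c\<^sup>2)"
    by (simp add: card_row_idx power2_eq_square)
  also have "\<dots> \<le> (\<Sum>p\<in>?J. 2 * c * (LINT y|?PK. row_res N y p p) - c\<^sup>2)"
    using minor_diag_expectation(2)[OF \<nu>] c0
    by (intro sum_mono diff_right_mono mult_left_mono) (auto simp: c_def \<phi>_def)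
  also have "\<dots> = (\<Sum>p\<in>?J. (LINT y|?PK. 2 * c * row_res N y p p - c\<^sup>2))"
    using ir by (intro sum.cong refl) (simp add: PK.prob_space)
  also have "\<dots> = (LINT y|?PK. (\<Sum>p\<in>?J. 2 * c * row_res N y p p - c\<^sup>2))"
    using ir by (intro Bochner_Integration.integral_sum[symmetric]) auto
  finally have S: "N * c\<^sup>2 \<le> (LINT y|?PK. (\<Sum>p\<in>?J. 2 * c * row_res N y p p - c\<^sup>2))" .
  have "c\<^sup>2 * (u * (N * c\<^sup>2) - N * (1 - \<phi>)\<^sup>2)
      \<le> c\<^sup>2 * (u * (LINT y|?PK. (\<Sum>p\<in>?J. 2 * c * row_res N y p p - c\<^sup>2)) - N * (1 - \<phi>)\<^sup>2)"
    using S u0 by (intro mult_left_mono diff_right_mono) auto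
  also have "\<dots> = (LINT y|?PK. c\<^sup>2 * (u * (\<Sum>p\<in>?J. 2 * c * row_res N y p p - c\<^sup>2) - N * (1 - \<phi>)\<^sup>2))"
  proof -
    have *: "(LINT y|?PK. a * (b * F y - d)) = a * (b * (LINT y|?PK. F y) - d)"
      if "integrable ?PK F" for F and a b d :: real
      using that by (simp add: PK.prob_space)
    show ?thesis by (rule *[OF iS, symmetric])
  qed
  also have "\<dots> \<le> (LINT y|?PK. 6 / k * (h y + \<delta>))"
  proof (rule integral_mono)
    show "integrable ?PK (\<lambda>y. c\<^sup>2 * (u * (\<Sum>p\<in>?J. 2 * c * row_res N y p p - c\<^sup>2) - N * (1 - \<phi>)\<^sup>2))"
      by (intro integrable_mult_right Bochner_Integration.integrable_diff iS) simp
    show "integrable ?PK (\<lambda>y. 6 / k * (h y + \<delta>))"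
      by (intro integrable_mult_right Bochner_Integration.integrable_add ih) simp
  qed (rule bound)
  also have "\<dots> = 6 / k * ((LINT y|?PK. h y) + \<delta>)"
    using ih by (simp add: PK.prob_space)
  finally show ?thesis
    unfolding law[symmetric] by (simp add: \<phi>_def[symmetric] u_def[symmetric] \<delta>_def c2 g_def)
qed

text \<open>
  The eigenvectors give the first columns of \<open>(1 + A\<^sup>2)\<^sup>-\<^sup>1\<close> and of \<open>A (1 + A\<^sup>2)\<^sup>-\<^sup>1\<close>, which solve the equations of
  \<open>schur_identity\<close>.
\<close>

lemma quad_form_eigendecomposition:
  assumes e: "ordered_eigendecomposition (Suc N) A U l" and A: "A \<in> carrier_mat (Suc N) (Suc N)" "transpose_mat A = A"
  defines "q \<equiv> \<Sum>j<Suc N. \<bar>U $$ (0, j)\<bar>\<^sup>2 * (1 / (1 + (l j)\<^sup>2))"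
    and "p \<equiv> \<Sum>j<Suc N. \<bar>U $$ (0, j)\<bar>\<^sup>2 * (l j / (1 + (l j)\<^sup>2))"
  shows "quad_form (row_idx N) (row_res N (\<lambda>p. A $$ p)) (\<lambda>p. A $$ p) = q / (p\<^sup>2 + q\<^sup>2) - 1"
proof -
  let ?x = "\<lambda>p. A $$ p" and ?r = "\<lambda>k. A $$ (Suc k, 0)"
  let ?a = "minor_of ?x"
  define f where "f j = 1 / (1 + (l j)\<^sup>2)" for j
  have f: "(1 + (l j)\<^sup>2) * f j = 1" "0 < f j" for j
  proof -
    have "0 < 1 + (l j)\<^sup>2" by (simp add: add_pos_nonneg)
    then show "(1 + (l j)\<^sup>2) * f j = 1" "0 < f j" by (simp_all add: f_def)
  qed
  define Y where "Y i = (\<Sum>j<Suc N. U $$ (i, j) * U $$ (0, j) * f j)" for i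
  define X where "X i = (\<Sum>j<Suc N. U $$ (i, j) * U $$ (0, j) * (l j * f j))" for i
  have q: "q = Y 0" and p: "p = X 0"
    unfolding q_def p_def Y_def X_def f_def by (simp_all add: power2_eq_square)
  have app: "(\<Sum>k<Suc N. A $$ (i, k) * (\<Sum>j<Suc N. U $$ (k, j) * w j)) = (\<Sum>j<Suc N. l j * U $$ (i, j) * w j)"
    if i: "i < Suc N" for i and w :: "nat \<Rightarrow> real"
  proof -
    have "(\<Sum>k<Suc N. A $$ (i, k) * (\<Sum>j<Suc N. U $$ (k, j) * w j))
        = (\<Sum>k<Suc N. \<Sum>j<Suc N. A $$ (i, k) * U $$ (k, j) * w j)"
      by (simp only: sum_distrib_left mult.assoc)
    also have "\<dots> = (\<Sum>j<Suc N. \<Sum>k<Suc N. A $$ (i, k) * U $$ (k, j) * w j)" by (rule sum.swap)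
    also have "\<dots> = (\<Sum>j<Suc N. l j * U $$ (i, j) * w j)"
    proof (rule sum.cong[OF refl])
      fix j assume "j \<in> {..<Suc N}"
      then have "(\<Sum>k<Suc N. A $$ (i, k) * U $$ (k, j)) = l j * U $$ (i, j)"
        using eigendecomposition_apply[OF e i] by blast
      then show "(\<Sum>k<Suc N. A $$ (i, k) * U $$ (k, j) * w j) = l j * U $$ (i, j) * w j"
        by (simp only: sum_distrib_right[symmetric])
    qed
    finally show ?thesis .
  qed
  have AY: "(\<Sum>k<Suc N. A $$ (i, k) * Y k) = X i" if i: "i < Suc N" for i
    unfolding Y_def X_def using app[OF i, of "\<lambda>j. U $$ (0, j) * f j"]
    by (simp only: mult.assoc mult.left_commute[of "l _"])
  have AX: "(\<Sum>k<Suc N. A $$ (i, k) * X k) + Y i = (if i = 0 then 1 else 0)" if i: "i < Suc N" for i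
  proof -
    have "(\<Sum>k<Suc N. A $$ (i, k) * X k) + Y i
        = (\<Sum>j<Suc N. l j * U $$ (i, j) * (U $$ (0, j) * (l j * f j))) + Y i"
      unfolding X_def using app[OF i, of "\<lambda>j. U $$ (0, j) * (l j * f j)"] by (simp only: mult.assoc)
    also have "\<dots> = (\<Sum>j<Suc N. U $$ (i, j) * U $$ (0, j) * ((1 + (l j)\<^sup>2) * f j))"
      unfolding Y_def sum.distrib[symmetric]
      by (rule sum.cong) (simp_all add: algebra_simps power2_eq_square)
    also have "\<dots> = (if i = 0 then 1 else 0)"
      using eigendecomposition_rows[OF e i, of 0] by (simp only: f mult_1_right)
    finally show ?thesis .
  qed
  have Asym: "A $$ (i, j) = A $$ (j, i)" if "i < Suc N" "j < Suc N" for i j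
    using arg_cong[OF A(2), of "\<lambda>B. B $$ (j, i)"] A(1) that by simp
  have minor: "?a i j = A $$ (Suc i, Suc j)" if "i < N" "j < N" for i j
    using Asym[of "Suc i" "Suc j"] that by (simp add: minor_of_def max_def min_def)
  have mv: "matvec N ?a (\<lambda>k. v (Suc k)) i = (\<Sum>k<N. A $$ (Suc i, Suc k) * v (Suc k))" if "i < N" for i v
    unfolding matvec_def using that by (intro sum.cong refl) (simp add: minor)
  have s0: "(\<Sum>k<N. A $$ (0, Suc k) * v k) = (\<Sum>k<N. ?r k * v k)" for v
  proof (rule sum.cong[OF refl])
    fix k assume "k \<in> {..<N}"
    then have "A $$ (0, Suc k) = ?r k" by (intro Asym) auto
    then show "A $$ (0, Suc k) * v k = ?r k * v k" by (simp only:)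
  qed
  note AX' = AX[unfolded sum.lessThan_Suc_shift] and AY' = AY[unfolded sum.lessThan_Suc_shift]
  have id: "(p\<^sup>2 + q\<^sup>2) * (1 + (\<Sum>k<N. ?r k * matvec N (resolvent N ?a) ?r k)) = q"
  proof (rule schur_identity[OF minor_symmetric resolvent_solves[OF minor_symmetric]])
    show "A $$ (0, 0) * p + (\<Sum>k<N. ?r k * X (Suc k)) + q = 1"
      using AX'[OF zero_less_Suc] unfolding p q s0 by (simp only: simp_thms if_True)
    show "A $$ (0, 0) * q + (\<Sum>k<N. ?r k * Y (Suc k)) = p"
      using AY'[OF zero_less_Suc] unfolding p q s0 .
    show "?r i * q + matvec N ?a (\<lambda>k. Y (Suc k)) i = X (Suc i)" if "i < N" for i
      using AY'[of "Suc i"] that unfolding q mv[OF that] by (simp only: Suc_less_eq)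
    show "?r i * p + matvec N ?a (\<lambda>k. X (Suc k)) i + Y (Suc i) = 0" if "i < N" for i
      using AX'[of "Suc i"] that unfolding p mv[OF that] by (simp only: Suc_less_eq nat.distinct if_False simp_thms)
  qed
  have "q \<noteq> 0"
  proof
    assume "q = 0"
    then have "\<forall>j\<in>{..<Suc N}. \<bar>U $$ (0, j)\<bar>\<^sup>2 * f j = 0"
      unfolding q_def f_def[symmetric] using f(2)
      by (subst (asm) sum_nonneg_eq_0_iff) (auto intro!: mult_nonneg_nonneg simp: less_imp_le)
    then have "\<forall>j\<in>{..<Suc N}. U $$ (0, j) * U $$ (0, j) = 0" using f(2) by (auto simp: less_le)
    then have "(\<Sum>j<Suc N. U $$ (0, j) * U $$ (0, j)) = 0" by (intro sum.neutral)
    then show False using eigendecomposition_rows[OF e, of 0 0] by simp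
  qed
  then have "p\<^sup>2 + q\<^sup>2 \<noteq> 0" by (simp add: add_nonneg_eq_0_iff)
  then have "1 + (\<Sum>k<N. ?r k * matvec N (resolvent N ?a) ?r k) = q / (p\<^sup>2 + q\<^sup>2)"
    using id by (simp add: field_simps)
  then show ?thesis unfolding quad_form_row_res by simp
qed

lemma iid_symmetric_matrix_measurable:
  assumes "iid_symmetric_matrix M n \<nu> A" and ij: "i < n" "j < n"
  shows "(\<lambda>\<omega>. A \<omega> $$ (i, j)) \<in> borel_measurable M"
proof -
  interpret prob_space M using assms by (simp add: iid_symmetric_matrix_def)
  have low: "(\<lambda>\<omega>. A \<omega> $$ (i, j)) \<in> borel_measurable M" if "j \<le> i" "i < n" for i j
    using assms(1) that unfolding iid_symmetric_matrix_def indep_vars_def by force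
  show ?thesis
  proof (cases "j \<le> i")
    case False
    have sym: "A \<omega> $$ (i, j) = A \<omega> $$ (j, i)" if "\<omega> \<in> space M" for \<omega>
    proof -
      have A: "A \<omega> \<in> carrier_mat n n" "transpose_mat (A \<omega>) = A \<omega>"
        using assms(1) that by (auto simp: iid_symmetric_matrix_def)
      have "transpose_mat (A \<omega>) $$ (j, i) = A \<omega> $$ (i, j)" using A(1) ij by simp
      then show ?thesis by (simp only: A(2))
    qed
    have "(\<lambda>\<omega>. A \<omega> $$ (j, i)) \<in> borel_measurable M" by (rule low) (use False ij in auto)
    moreover have "(\<lambda>\<omega>. A \<omega> $$ (i, j)) \<in> borel_measurable M \<longleftrightarrow> (\<lambda>\<omega>. A \<omega> $$ (j, i)) \<in> borel_measurable M"
      by (rule measurable_cong) (rule sym)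
    ultimately show ?thesis by (simp only:)
  qed (use low ij in simp)
qed

section \<open>The mean and variance of the truncated entries\<close>

lemma additive_decomposition_laplace:
  assumes dec: "additive_decomposition \<nu> \<beta>"
  shows "(LINT p|\<beta>. 1 - exp (- (fst p)\<^sup>2)) \<le> 1 - square_laplace \<nu> 1 + measure \<beta> {p \<in> space \<beta>. snd p \<noteq> 0}"
proof -
  have \<beta>: "prob_space \<beta>" and sets: "sets \<beta> = sets borel"
    and \<nu>: "\<nu> = distr \<beta> borel (\<lambda>p. fst p + snd p)"
    using dec by (auto simp: additive_decomposition_def)
  interpret prob_space \<beta> by fact
  have mfst [measurable]: "fst \<in> borel_measurable \<beta>" and msnd [measurable]: "snd \<in> borel_measurable \<beta>"
    unfolding measurable_cong_sets[OF sets refl]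
    by (intro borel_measurable_continuous_onI continuous_intros)+
  let ?S = "{p \<in> space \<beta>. snd p \<noteq> 0}"
  have S: "?S \<in> events" by measurable
  define f where "f = (\<lambda>p::real \<times> real. exp (- (fst p + snd p)\<^sup>2))"
  have fi: "integrable \<beta> f"
    unfolding f_def by (rule integrable_const_bound[of _ 1]) auto
  have gi: "integrable \<beta> (\<lambda>p. exp (- (fst p)\<^sup>2))"
    by (rule integrable_const_bound[of _ 1]) auto
  have Si: "integrable \<beta> (indicator ?S :: _ \<Rightarrow> real)"
    by (rule integrable_const_bound[of _ 1]) (use S in \<open>auto simp: indicator_def\<close>)
  have "square_laplace \<nu> 1 = (LINT p|\<beta>. exp (- (1 * (fst p + snd p)\<^sup>2)))"
    unfolding square_laplace_def \<nu> by (rule integral_distr) auto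
  then have \<phi>: "square_laplace \<nu> 1 = (LINT p|\<beta>. f p)" by (simp add: f_def)
  have "(LINT p|\<beta>. 1 - exp (- (fst p)\<^sup>2)) \<le> (LINT p|\<beta>. 1 - f p + indicator ?S p)"
  proof (rule integral_mono)
    fix p assume p: "p \<in> space \<beta>"
    show "1 - exp (- (fst p)\<^sup>2) \<le> 1 - f p + indicator ?S p"
    proof (cases "snd p = 0")
      case False
      have "exp (- (fst p + snd p)\<^sup>2) \<le> 1" "0 < exp (- (fst p)\<^sup>2)" by simp_all
      moreover have "indicator ?S p = (1::real)" using p False by simp
      ultimately show ?thesis unfolding f_def by linarith
    qed (use p in \<open>simp add: f_def\<close>)
  qed (use fi gi Si in auto)
  also have "\<dots> = 1 - (LINT p|\<beta>. f p) + (LINT p|\<beta>. indicator ?S p)"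
    using fi Si by (simp add: prob_space)
  also have "(LINT p|\<beta>. indicator ?S p) = prob ?S"
    using S sets.sets_into_space[OF S] by (simp add: Int_absorb2)
  finally show ?thesis unfolding \<phi> .
qed

text \<open>
  If the mean \<open>m\<close> is large compared with the standard deviation, then by Chebyshev's inequality \<open>\<bar>b\<bar> \<ge> \<bar>m\<bar> / 2\<close>
  with probability at least one half.  As \<open>E (1 - exp (- b\<^sup>2))\<close> is of order \<open>1 / n\<close>, so is then \<open>m\<^sup>2\<close>.
\<close>

lemma truncated_mean_bound:
  assumes dec: "additive_decomposition \<nu> \<beta>" and b2: "integrable \<beta> (\<lambda>p. (fst p)\<^sup>2)"
    and m: "m = prob_space.expectation \<beta> fst" and V: "V = prob_space.variance \<beta> fst"
    and K: "real n * (1 - square_laplace \<nu> 1) \<le> K" "real n * measure \<beta> {p \<in> space \<beta>. snd p \<noteq> 0} \<le> 1"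
    and n: "4 * (K + 1) \<le> real n" "0 \<le> K"
  shows "m\<^sup>2 \<le> 8 * V \<or> real n * m\<^sup>2 \<le> 16 * (K + 1)"
proof (rule disjCI)
  assume "\<not> real n * m\<^sup>2 \<le> 16 * (K + 1)"
  then have big: "16 * (K + 1) < real n * m\<^sup>2" by simp
  show "m\<^sup>2 \<le> 8 * V"
  proof (rule ccontr)
    assume "\<not> m\<^sup>2 \<le> 8 * V"
    then have mV: "8 * V < m\<^sup>2" by simp
    have \<beta>: "prob_space \<beta>" and sets: "sets \<beta> = sets borel"
      using dec by (auto simp: additive_decomposition_def)
    interpret prob_space \<beta> by fact
    have mfst [measurable]: "fst \<in> borel_measurable \<beta>"
      unfolding measurable_cong_sets[OF sets refl]
      by (intro borel_measurable_continuous_onI continuous_intros)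
    have m0: "m \<noteq> 0" using big n by auto
    define x where "x = m\<^sup>2 / 4"
    have x0: "0 < x" using m0 by (simp add: x_def)
    let ?E = "{p \<in> space \<beta>. \<bar>m\<bar> / 2 \<le> \<bar>fst p - m\<bar>}"
    have E: "?E \<in> events" by measurable
    have "prob ?E \<le> V / (\<bar>m\<bar> / 2)\<^sup>2"
      unfolding m V by (rule Chebyshev_inequality) (use b2 m0 m in auto)
    also have "\<dots> \<le> 1 / 2" using mV m0 by (simp add: power_divide field_simps)
    finally have PE: "prob ?E \<le> 1 / 2" .
    have Ei: "integrable \<beta> (indicator ?E :: _ \<Rightarrow> real)"
      by (rule integrable_const_bound[of _ 1]) (use E in \<open>auto simp: indicator_def\<close>)
    have e1: "exp (- x) \<le> 1" using x0 by simp
    have "(1 - exp (- x)) / 2 \<le> (1 - exp (- x)) * (1 - prob ?E)"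
      using PE e1 mult_left_mono[of "1 / 2" "1 - prob ?E" "1 - exp (- x)"] by simp
    also have "\<dots> = (LINT p|\<beta>. (1 - exp (- x)) * (1 - indicator ?E p))"
      using Ei E sets.sets_into_space[OF E] by (simp add: prob_space Int_absorb2)
    also have "\<dots> \<le> (LINT p|\<beta>. 1 - exp (- (fst p)\<^sup>2))"
    proof (rule integral_mono)
      show "integrable \<beta> (\<lambda>p. (1 - exp (- x)) * (1 - indicator ?E p))" using Ei by simp
      show "integrable \<beta> (\<lambda>p. 1 - exp (- (fst p)\<^sup>2))"
        by (rule integrable_const_bound[of _ 1]) auto
      fix p assume p: "p \<in> space \<beta>"
      show "(1 - exp (- x)) * (1 - indicator ?E p) \<le> 1 - exp (- (fst p)\<^sup>2)"
      proof (cases "p \<in> ?E")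
        case False
        then have "\<bar>fst p - m\<bar> < \<bar>m\<bar> / 2" using p by auto
        then have "\<bar>m / 2\<bar> \<le> \<bar>fst p\<bar>" by linarith
        then have "(m / 2)\<^sup>2 \<le> (fst p)\<^sup>2" by (simp only: abs_le_square_iff)
        then have "x \<le> (fst p)\<^sup>2" by (simp add: x_def power_divide)
        then show ?thesis using False by simp
      qed simp
    qed
    also have "\<dots> \<le> 1 - square_laplace \<nu> 1 + prob {p \<in> space \<beta>. snd p \<noteq> 0}"
      by (rule additive_decomposition_laplace[OF dec])
    finally have "real n * ((1 - exp (- x)) / 2) \<le> real n * (1 - square_laplace \<nu> 1 + prob {p \<in> space \<beta>. snd p \<noteq> 0})"
      by (rule mult_left_mono) simp
    also have "\<dots> \<le> K + 1" using K by (simp add: distrib_left)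
    finally have h: "real n * (1 - exp (- x)) \<le> 2 * (K + 1)" by simp
    have "exp (- x) \<le> 1 / (1 + x)"
      unfolding exp_minus inverse_eq_divide using x0 exp_ge_add_one_self[of x]
      by (intro divide_left_mono) auto
    then have "x / (1 + x) \<le> 1 - exp (- x)" using x0 by (simp add: field_simps)
    then have "real n * (x / (1 + x)) \<le> real n * (1 - exp (- x))" by (rule mult_left_mono) simp
    then have "real n * (x / (1 + x)) \<le> 2 * (K + 1)" using h by linarith
    then have "real n * x \<le> 2 * (K + 1) * (1 + x)" using x0 by (simp add: field_simps)
    also have "\<dots> = 2 * (K + 1) + 2 * (K + 1) * x" by (simp add: distrib_left)
    also have "2 * (K + 1) * x \<le> real n / 2 * x" using n x0 by (intro mult_right_mono) auto
    finally have "real n * x \<le> 4 * (K + 1)" by simp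
    then show False using big by (simp add: x_def)
  qed
qed

lemma offdiag_bound_mono:
  assumes "0 \<le> V" "N \<le> N'"
  shows "offdiag_bound N m V \<le> offdiag_bound N' m V"
  unfolding offdiag_bound_def using assms
  by (intro real_sqrt_le_mono add_mono mult_left_mono) auto

text \<open>
  The assumption \<open>sqrt n * V \<rightarrow> 0\<close> on the variances is exactly what makes \<open>n V\<^sup>2\<close> vanish.  For \<open>n m\<^sup>2 V\<close> the
  alternative of \<open>truncated_mean_bound\<close> leaves a bound by a multiple of \<open>n V\<^sup>2\<close> or of \<open>V\<close>.
\<close>

lemma truncation_error_tendsto_0:
  fixes \<beta> :: "nat \<Rightarrow> (real \<times> real) measure"
  assumes dec: "\<And>n. n \<ge> 1 \<Longrightarrow> additive_decomposition (\<nu> n) (\<beta> n)"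
    and c0: "(\<lambda>n. real n * measure (\<beta> n) {p \<in> space (\<beta> n). snd p \<noteq> 0}) \<longlonglongrightarrow> 0"
    and b2: "\<forall>\<^sub>F n in sequentially. integrable (\<beta> n) (\<lambda>p. (fst p)\<^sup>2)"
    and V0: "(\<lambda>n. sqrt (real n) * prob_space.variance (\<beta> n) fst) \<longlonglongrightarrow> 0"
    and K: "\<forall>\<^sub>F n in sequentially. real n * (1 - square_laplace (\<nu> n) 1) \<le> K" "0 \<le> K"
  shows "(\<lambda>n. real n * measure (\<beta> n) {p \<in> space (\<beta> n). snd p \<noteq> 0}
     + offdiag_bound n (prob_space.expectation (\<beta> n) fst) (prob_space.variance (\<beta> n) fst)) \<longlonglongrightarrow> 0"
proof -
  define m where "m n = prob_space.expectation (\<beta> n) fst" for n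
  define V where "V n = prob_space.variance (\<beta> n) fst" for n
  have Vn: "0 \<le> V n" for n by (simp add: V_def)
  have sV: "(\<lambda>n. sqrt (real n) * V n) \<longlonglongrightarrow> 0" using V0 by (simp add: V_def)
  have nV2: "(\<lambda>n. real n * (V n)\<^sup>2) \<longlonglongrightarrow> 0"
  proof -
    have "(\<lambda>n. (sqrt (real n) * V n)\<^sup>2) \<longlonglongrightarrow> 0\<^sup>2" by (intro tendsto_power sV)
    then show ?thesis by (simp add: power_mult_distrib)
  qed
  have V0': "V \<longlonglongrightarrow> 0"
  proof (rule Lim_null_comparison[OF _ sV])
    show "\<forall>\<^sub>F n in sequentially. norm (V n) \<le> sqrt (real n) * V n"
      using eventually_ge_at_top[of 1]
    proof eventually_elim
      case (elim n)
      then have "1 * V n \<le> sqrt (real n) * V n" using Vn by (intro mult_right_mono) auto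
      then show ?case using Vn by simp
    qed
  qed
  have mVn: "(\<lambda>n. (m n)\<^sup>2 * V n * real n) \<longlonglongrightarrow> 0"
  proof (rule Lim_null_comparison)
    have "(\<lambda>n. 8 * (real n * (V n)\<^sup>2) + 16 * (K + 1) * V n) \<longlonglongrightarrow> 8 * 0 + 16 * (K + 1) * 0"
      by (intro tendsto_add tendsto_mult tendsto_const nV2 V0')
    then show "(\<lambda>n. 8 * (real n * (V n)\<^sup>2) + 16 * (K + 1) * V n) \<longlonglongrightarrow> 0" by simp
    have "\<forall>\<^sub>F n in sequentially. real n * measure (\<beta> n) {p \<in> space (\<beta> n). snd p \<noteq> 0} < 1"
      by (rule order_tendstoD[OF c0]) simp
    moreover have "\<forall>\<^sub>F n in sequentially. 4 * (K + 1) \<le> real n"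
      using filterlim_real_sequentially unfolding filterlim_at_top by blast
    ultimately show "\<forall>\<^sub>F n in sequentially. norm ((m n)\<^sup>2 * V n * real n) \<le> 8 * (real n * (V n)\<^sup>2) + 16 * (K + 1) * V n"
      using b2 K(1) eventually_ge_at_top[of 1]
    proof eventually_elim
      case (elim n)
      have "(m n)\<^sup>2 \<le> 8 * V n \<or> real n * (m n)\<^sup>2 \<le> 16 * (K + 1)"
        by (rule truncated_mean_bound[OF dec _ m_def V_def]) (use elim K in auto)
      then have "(m n)\<^sup>2 * V n * real n \<le> 8 * (real n * (V n)\<^sup>2) + 16 * (K + 1) * V n"
      proof
        assume "(m n)\<^sup>2 \<le> 8 * V n"
        then have "(m n)\<^sup>2 * (V n * real n) \<le> 8 * V n * (V n * real n)"
          using Vn by (intro mult_right_mono) auto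
        moreover have "0 \<le> 16 * (K + 1) * V n" using Vn K(2) by simp
        ultimately show ?thesis by (simp add: power2_eq_square mult_ac)
      next
        assume "real n * (m n)\<^sup>2 \<le> 16 * (K + 1)"
        then have "real n * (m n)\<^sup>2 * V n \<le> 16 * (K + 1) * V n" using Vn by (rule mult_right_mono)
        moreover have "0 \<le> 8 * (real n * (V n)\<^sup>2)" by simp
        moreover have "(m n)\<^sup>2 * V n * real n = real n * (m n)\<^sup>2 * V n" by (simp only: mult_ac)
        ultimately show ?thesis by linarith
      qed
      then show ?case using Vn by simp
    qed
  qed
  have "(\<lambda>n. real n * measure (\<beta> n) {p \<in> space (\<beta> n). snd p \<noteq> 0}
     + sqrt (4 * (real n * (V n)\<^sup>2) + 32 * ((m n)\<^sup>2 * V n * real n))) \<longlonglongrightarrow> 0 + sqrt (4 * 0 + 32 * 0)"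
    by (intro tendsto_add c0 tendsto_real_sqrt tendsto_mult tendsto_const nV2 mVn)
  moreover have "offdiag_bound n (m n) (V n) = sqrt (4 * (real n * (V n)\<^sup>2) + 32 * ((m n)\<^sup>2 * V n * real n))" for n
    by (simp add: offdiag_bound_def mult_ac)
  ultimately show ?thesis
    unfolding V_def[symmetric] unfolding m_def[symmetric] by simp
qed

section \<open>Consequences for the law of the entries\<close>

text \<open>
  A value of \<open>\<phi>\<close> with \<open>1 - \<phi>\<close> of order \<open>1 / n\<close> has powers up to order \<open>n\<close> that stay away from 0.
\<close>

lemma power_lower_bound:
  fixes \<phi> K :: real
  assumes "real n * (1 - \<phi>) \<le> K" "\<phi> \<le> 1" "2 * K \<le> real n" "n \<ge> 1" "N \<le> n"
  shows "exp (- (2 * K)) \<le> \<phi> ^ N"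
proof -
  have "1 - \<phi> \<le> K / real n" using assms(1,4) by (simp add: field_simps)
  also have "\<dots> \<le> 1 / 2" using assms(3,4) by (simp add: field_simps)
  finally have h: "1 - \<phi> \<le> 1 / 2" .
  have e: "exp (- (2 * (1 - \<phi>))) \<le> \<phi>"
  proof -
    have "exp (- (2 * (1 - \<phi>))) \<le> 1 - 2 * (1 - \<phi>) / 2"
      by (rule exp_minus_le_half) (use h assms(2) in auto)
    also have "1 - 2 * (1 - \<phi>) / 2 = \<phi>" by (simp add: field_simps)
    finally show ?thesis .
  qed
  have "real N * (1 - \<phi>) \<le> real n * (1 - \<phi>)" using assms(2,5) by (intro mult_right_mono) auto
  then have "- (2 * K) \<le> real N * - (2 * (1 - \<phi>))" using assms(1) by linarith
  then have "exp (- (2 * K)) \<le> exp (real N * - (2 * (1 - \<phi>)))" by simp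
  also have "\<dots> = exp (- (2 * (1 - \<phi>))) ^ N" by (rule exp_of_nat_mult)
  also have "\<dots> \<le> \<phi> ^ N" by (intro power_mono e) simp
  finally show ?thesis .
qed

text \<open>
  In \<open>master_inequality\<close> the right hand side and the term \<open>N (1 - \<phi>)\<^sup>2\<close> tend to 0, while
  the powers of \<open>\<phi>\<close> stay bounded below.
\<close>

lemma saturated_moment_vanishes:
  assumes entries: "entry_hypothesis \<nu> \<Phi>"
    and matrices: "\<And>n. n \<ge> 1 \<Longrightarrow> iid_symmetric_matrix (M n) n (\<nu> n) (A n)"
    and k: "0 < k" "k \<le> 1"
    and conc: "(\<lambda>n. LINT \<omega>|M n. \<bar>exp (- quad_form (row_idx (n - 1)) (row_res (n - 1) (\<lambda>p. A n \<omega> $$ p)) (\<lambda>p. A n \<omega> $$ p)) - k\<bar>) \<longlonglongrightarrow> 0"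
  shows "(\<lambda>n. real n * saturated_moment (\<nu> n)) \<longlonglongrightarrow> 0"
proof -
  have \<nu>: "\<And>n. n \<ge> 1 \<Longrightarrow> real_distribution (\<nu> n)" and lim: "has_limit_exponent \<nu> \<Phi>"
    and tight: "tight_truncation \<nu>"
    using entries by (auto simp: entry_hypothesis_def)
  obtain \<beta> where dec: "\<And>n. n \<ge> 1 \<Longrightarrow> additive_decomposition (\<nu> n) (\<beta> n)"
    and c0: "(\<lambda>n. real n * measure (\<beta> n) {p \<in> space (\<beta> n). snd p \<noteq> 0}) \<longlonglongrightarrow> 0"
    and b2: "\<forall>\<^sub>F n in sequentially. integrable (\<beta> n) (\<lambda>p. (fst p)\<^sup>2)"
    and V0: "(\<lambda>n. sqrt (real n) * prob_space.variance (\<beta> n) fst) \<longlonglongrightarrow> 0"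
    using tight unfolding tight_truncation_def by blast
  define \<phi> where "\<phi> n = square_laplace (\<nu> n) 1" for n
  define u where "u n = saturated_moment (\<nu> n)" for n
  have \<phi>1: "\<phi> n \<le> 1" "0 \<le> \<phi> n" if "n \<ge> 1" for n
  proof -
    interpret real_distribution "\<nu> n" by (rule \<nu>[OF that])
    show "\<phi> n \<le> 1" "0 \<le> \<phi> n" unfolding \<phi>_def by (rule square_laplace_bounds; simp)+
  qed
  have u0: "0 \<le> u n" for n by (simp add: u_def saturated_moment_def)
  have lap: "laplace_square (\<nu> n) (- \<i>) = complex_of_real (\<phi> n)" if "n \<ge> 1" for n
  proof -
    have "exp (- (\<i> * (- \<i>) * complex_of_real (x\<^sup>2))) = complex_of_real (exp (- (1 * x\<^sup>2)))" for x :: real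
      by (simp add: exp_of_real flip: of_real_minus of_real_power)
    then show ?thesis unfolding laplace_square_def \<phi>_def square_laplace_def by simp
  qed
  have "(\<lambda>n. of_nat n * (laplace_square (\<nu> n) (- \<i>) - 1)) \<longlonglongrightarrow> \<Phi> (- \<i>)"
  proof -
    have "compact {- \<i>} \<and> {- \<i>} \<subseteq> closed_lower_half_plane" by simp
    then have "uniform_limit {- \<i>} (\<lambda>n l. of_nat n * (laplace_square (\<nu> n) l - 1)) \<Phi> sequentially"
      using lim unfolding has_limit_exponent_def by blast
    then show ?thesis by simp
  qed
  then have "Bseq (\<lambda>n. of_nat n * (laplace_square (\<nu> n) (- \<i>) - 1))"
    by (intro convergent_imp_Bseq convergentI)
  then obtain K where K: "K > 0" "\<And>n. cmod (of_nat n * (laplace_square (\<nu> n) (- \<i>) - 1)) \<le> K"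
    unfolding Bseq_def by blast
  have nK: "real n * (1 - \<phi> n) \<le> K" if "n \<ge> 1" for n
  proof -
    have "of_nat n * (laplace_square (\<nu> n) (- \<i>) - 1) = complex_of_real (real n * (\<phi> n - 1))"
      by (simp add: lap[OF that])
    then have "\<bar>real n * (\<phi> n - 1)\<bar> \<le> K" using K(2)[of n] by (simp only: norm_of_real)
    then have "- (real n * (\<phi> n - 1)) \<le> K" by linarith
    then show ?thesis by (simp add: algebra_simps)
  qed
  define \<delta> where "\<delta> n = real n * measure (\<beta> n) {p \<in> space (\<beta> n). snd p \<noteq> 0}
     + offdiag_bound n (prob_space.expectation (\<beta> n) fst) (prob_space.variance (\<beta> n) fst)" for n
  have \<delta>: "\<delta> \<longlonglongrightarrow> 0"
    unfolding \<delta>_def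
    by (rule truncation_error_tendsto_0[OF dec c0 b2 V0, of K])
      (use nK K(1) in \<open>auto simp: \<phi>_def intro!: eventually_sequentiallyI[of 1]\<close>)
  define X where "X n = (LINT \<omega>|M n. \<bar>exp (- quad_form (row_idx (n - 1)) (row_res (n - 1) (\<lambda>p. A n \<omega> $$ p)) (\<lambda>p. A n \<omega> $$ p)) - k\<bar>)" for n
  have X: "X \<longlonglongrightarrow> 0" unfolding X_def[abs_def] by (rule conc)
  \<comment> \<open>The lower bound of the powers of \<open>\<phi> n\<close> from
    \<open>power_lower_bound\<close>.\<close>
  define E where "E = exp (- (2 * K))"
  have E: "0 < E" by (simp add: E_def)
  define S where "S n = 2 / (E ^ 4) * (6 / k * (X n + \<delta> n) + K\<^sup>2 * (1 / real n))" for n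
  have "S \<longlonglongrightarrow> 2 / (E ^ 4) * (6 / k * (0 + 0) + K\<^sup>2 * 0)"
    unfolding S_def by (intro tendsto_mult tendsto_add tendsto_const X \<delta> lim_1_over_n)
  then have S: "S \<longlonglongrightarrow> 0" by simp
  show ?thesis
  proof (rule Lim_null_comparison[OF _ S])
    have "\<forall>\<^sub>F n in sequentially. 2 * K \<le> real n"
      using filterlim_real_sequentially unfolding filterlim_at_top by blast
    then show "\<forall>\<^sub>F n in sequentially. norm (real n * saturated_moment (\<nu> n)) \<le> S n"
      using b2 eventually_ge_at_top[of 2]
    proof eventually_elim
      case (elim n)
      \<comment> \<open>The minor has size \<open>n - 1\<close>, but its entries have the law \<open>\<nu>
        n\<close>.\<close>
      define N where "N = n - 1"
      have N: "N \<ge> 1" "n = Suc N" "n \<ge> 1" using elim(3) by (auto simp: N_def)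
      have b2n: "integrable (\<beta> n) (\<lambda>p. (fst p)\<^sup>2)" by (rule elim(2))
      define m where "m = prob_space.expectation (\<beta> n) fst"
      define V where "V = prob_space.variance (\<beta> n) fst"
      define c where "c = \<phi> n ^ (2 * N)"
      have V: "0 \<le> V" by (simp add: V_def)
      have iid: "iid_symmetric_matrix (M n) (Suc N) (\<nu> n) (A n)" using matrices[OF N(3)] N(2) by simp
      have "c * (u n * (N * c) - N * (1 - \<phi> n)\<^sup>2) \<le> 6 / k * (X n + (N * measure (\<beta> n) {p \<in> space (\<beta> n). snd p \<noteq> 0} + offdiag_bound N m V))"
        using master_inequality[OF iid N(1) \<nu>[OF N(3)] dec[OF N(3)] b2n m_def V_def k]
        unfolding c_def u_def \<phi>_def X_def N_def .
      also have "\<dots> \<le> 6 / k * (X n + \<delta> n)"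
      proof -
        have "N * measure (\<beta> n) {p \<in> space (\<beta> n). snd p \<noteq> 0} \<le> real n * measure (\<beta> n) {p \<in> space (\<beta> n). snd p \<noteq> 0}"
          using N(2) by (intro mult_right_mono) auto
        moreover have "offdiag_bound N m V \<le> offdiag_bound n m V"
          by (rule offdiag_bound_mono[OF V]) (use N(2) in simp)
        ultimately show ?thesis
          unfolding \<delta>_def m_def V_def using k by (intro mult_left_mono add_left_mono add_mono) auto
      qed
      finally have main: "c * (u n * (N * c) - N * (1 - \<phi> n)\<^sup>2) \<le> 6 / k * (X n + \<delta> n)" .
      have c1: "c \<le> 1" "0 \<le> c" unfolding c_def using \<phi>1[OF N(3)] by (auto intro: power_le_one)
      have Ec: "E ^ 2 \<le> c"
      proof -
        have "E \<le> \<phi> n ^ N"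
          unfolding E_def by (rule power_lower_bound[OF nK[OF N(3)] \<phi>1(1)[OF N(3)] elim(1) N(3)]) (use N(2) in simp)
        then have "E ^ 2 \<le> (\<phi> n ^ N) ^ 2" using E by (intro power_mono) auto
        then show ?thesis by (simp add: c_def power_mult[symmetric] mult.commute)
      qed
      have q: "N * (1 - \<phi> n)\<^sup>2 \<le> K\<^sup>2 * (1 / real n)"
      proof -
        have "(real n * (1 - \<phi> n))\<^sup>2 \<le> K\<^sup>2" using nK[OF N(3)] \<phi>1[OF N(3)] by (intro power_mono) auto
        then have "real n * (1 - \<phi> n)\<^sup>2 \<le> K\<^sup>2 * (1 / real n)"
          using N(3) by (simp add: power_mult_distrib power2_eq_square field_simps)
        moreover have "N * (1 - \<phi> n)\<^sup>2 \<le> real n * (1 - \<phi> n)\<^sup>2" using N(2) by (intro mult_right_mono) auto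
        ultimately show ?thesis by linarith
      qed
      have "c * (N * (1 - \<phi> n)\<^sup>2) \<le> 1 * (K\<^sup>2 * (1 / real n))"
        by (intro mult_mono q c1) auto
      then have "c * (u n * (N * c)) \<le> 6 / k * (X n + \<delta> n) + K\<^sup>2 * (1 / real n)"
        using main by (simp add: right_diff_distrib)
      moreover have "E ^ 4 * (N * u n) \<le> c * (u n * (N * c))"
      proof -
        have "E ^ 2 * E ^ 2 \<le> c * c" using Ec E c1 by (intro mult_mono) auto
        then have "E ^ 2 * E ^ 2 * (N * u n) \<le> c * c * (N * u n)" using u0 by (intro mult_right_mono) auto
        moreover have "E ^ 4 = E ^ 2 * E ^ 2" by (simp flip: power_add)
        moreover have "c * (u n * (N * c)) = c * c * (N * u n)" by (simp only: mult_ac)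
        ultimately show ?thesis by (simp only:)
      qed
      ultimately have "E ^ 4 * (N * u n) \<le> 6 / k * (X n + \<delta> n) + K\<^sup>2 * (1 / real n)" by linarith
      then have "N * u n \<le> (6 / k * (X n + \<delta> n) + K\<^sup>2 * (1 / real n)) / E ^ 4"
        using E by (simp add: pos_le_divide_eq mult.commute)
      moreover have "real n * u n \<le> 2 * (N * u n)"
      proof -
        have "real n \<le> 2 * N" using N by simp
        then have "real n * u n \<le> 2 * N * u n" using u0 by (rule mult_right_mono)
        then show ?thesis by simp
      qed
      moreover have "S n = 2 * ((6 / k * (X n + \<delta> n) + K\<^sup>2 * (1 / real n)) / E ^ 4)"
      proof -
        have "2 / e * y = 2 * (y / e)" for e y :: real by simp
        then show ?thesis unfolding S_def by blast
      qed
      ultimately have "real n * u n \<le> S n" by linarith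
      then show ?case using u0[of n] by (simp add: u_def)
    qed
  qed
qed

section \<open>Linearity of the exponent\<close>

text \<open>
  For \<open>x \<le> 1\<close> this is a Taylor expansion, with \<open>x\<close> comparable to \<open>1 - exp (- x)\<close>.  For \<open>x > 1\<close> the left hand side is
  bounded and \<open>1 - exp (- x)\<close> is at least one half.
\<close>

lemma exp_linearization:
  fixes z :: complex and x :: real
  assumes z: "Im z \<le> 0" and x: "0 \<le> x"
  shows "cmod (exp (- (\<i> * z * x)) - 1 + \<i> * z * (1 - exp (- x)))
     \<le> (8 + 4 * cmod z + 4 * exp (cmod z) * (cmod z)\<^sup>2) * (1 - exp (- x))\<^sup>2"
proof -
  define u where "u = 1 - exp (- x)"
  define C where "C = 8 + 4 * cmod z + 4 * exp (cmod z) * (cmod z)\<^sup>2"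
  have u0: "0 \<le> u" "u \<le> 1" using x by (auto simp: u_def)
  have zC: "0 \<le> 4 * exp (cmod z) * (cmod z)\<^sup>2" by simp
  show ?thesis
  proof (cases "x \<le> 1")
    case True
    have "exp (- x) \<le> 1 - x / 2" by (rule exp_minus_le_half[OF x True])
    then have xu: "x \<le> 2 * u" by (simp add: u_def)
    then have x2: "x\<^sup>2 \<le> 4 * u\<^sup>2"
      using power_mono[OF xu x, of 2] by (simp add: power_mult_distrib)
    let ?w = "- (\<i> * z * x)"
    have nw: "cmod ?w = cmod z * x" using x by (simp add: norm_mult)
    have T: "cmod (exp ?w - (\<Sum>i\<le>1. ?w ^ i / fact i)) \<le> exp (cmod ?w) * cmod ?w ^ Suc 1 / fact 1"
      by (rule Taylor_exp_field)
    have T1: "exp ?w - (\<Sum>i\<le>1. ?w ^ i / fact i) = exp ?w - 1 - ?w" by simp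
    have T2: "exp (cmod ?w) * cmod ?w ^ Suc 1 / fact 1 = exp (cmod z * x) * (cmod z * x)\<^sup>2"
      unfolding nw by (simp add: power2_eq_square)
    have 1: "cmod (exp ?w - 1 - ?w) \<le> exp (cmod z * x) * (cmod z * x)\<^sup>2"
      using T unfolding T1 T2 .
    have "exp (cmod z * x) * (cmod z * x)\<^sup>2 \<le> exp (cmod z) * ((cmod z)\<^sup>2 * (4 * u\<^sup>2))"
      unfolding power_mult_distrib using x2 True x by (intro mult_mono) (auto simp: mult_left_le)
    then have 2: "cmod (exp ?w - 1 - ?w) \<le> 4 * exp (cmod z) * (cmod z)\<^sup>2 * u\<^sup>2" using 1 by simp
    have ux: "\<bar>u - x\<bar> \<le> 2 * u\<^sup>2"
    proof -
      have "u \<le> x" using exp_ge_add_one_self[of "- x"] by (simp add: u_def)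
      moreover have "exp (- x) \<le> 1 - x + x\<^sup>2 / 2"
      proof -
        have "exp (- x) * (1 + x + x\<^sup>2 / 2) \<le> exp (- x) * exp x"
          by (intro mult_left_mono exp_lower_Taylor_quadratic x) simp
        then have e: "exp (- x) * (1 + x + x\<^sup>2 / 2) \<le> 1" by (simp flip: exp_add)
        have p: "0 < 1 + x + x\<^sup>2 / 2" using x by (simp add: add_pos_nonneg)
        have "1 \<le> (1 - x + x\<^sup>2 / 2) * (1 + x + x\<^sup>2 / 2)"
        proof -
          have "(1 - x + x\<^sup>2 / 2) * (1 + x + x\<^sup>2 / 2) = 1 + x\<^sup>2 * x\<^sup>2 / 4"
            by (simp add: algebra_simps power2_eq_square)
          then show ?thesis by simp
        qed
        then have "exp (- x) * (1 + x + x\<^sup>2 / 2) \<le> (1 - x + x\<^sup>2 / 2) * (1 + x + x\<^sup>2 / 2)"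
          using e by linarith
        then show ?thesis using p by (rule mult_right_le_imp_le)
      qed
      then have "x - u \<le> x\<^sup>2 / 2" by (simp add: u_def)
      ultimately show ?thesis using x2 by linarith
    qed
    have "exp ?w - 1 + \<i> * z * u = (exp ?w - 1 - ?w) + \<i> * z * (of_real (u - x))"
      by (simp add: algebra_simps)
    also have "cmod \<dots> \<le> 4 * exp (cmod z) * (cmod z)\<^sup>2 * u\<^sup>2 + cmod z * (2 * u\<^sup>2)"
    proof (rule order_trans[OF norm_triangle_ineq], rule add_mono[OF 2])
      have "cmod (\<i> * z * of_real (u - x)) = cmod z * \<bar>u - x\<bar>"
        by (simp only: norm_mult norm_ii norm_of_real mult_1)
      then show "cmod (\<i> * z * of_real (u - x)) \<le> cmod z * (2 * u\<^sup>2)"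
        using ux by (simp add: mult_left_mono)
    qed
    also have "\<dots> \<le> C * u\<^sup>2"
    proof -
      have "4 * exp (cmod z) * (cmod z)\<^sup>2 * u\<^sup>2 + cmod z * (2 * u\<^sup>2) = (4 * exp (cmod z) * (cmod z)\<^sup>2 + 2 * cmod z) * u\<^sup>2"
        by (simp add: algebra_simps)
      also have "\<dots> \<le> C * u\<^sup>2"
        unfolding C_def by (intro mult_right_mono) (auto intro: order_trans[OF _ norm_ge_zero])
      finally show ?thesis .
    qed
    finally show ?thesis by (simp add: u_def C_def)
  next
    case False
    have "exp (- x) \<le> exp (- 1)" using False by simp
    also have "exp (- 1) \<le> (1 / 2 :: real)"
      using exp_ge_add_one_self[of 1] by (simp add: exp_minus field_simps)
    finally have "1 / 2 \<le> u" by (simp add: u_def)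
    then have "(1 / 2)\<^sup>2 \<le> u\<^sup>2" by (intro power_mono) auto
    then have u4: "1 \<le> 4 * u\<^sup>2" by (simp add: power_divide)
    have "cmod (exp (- (\<i> * z * x))) = exp (Im z * x)" by simp
    also have "\<dots> \<le> 1" using z x by (simp add: mult_nonpos_nonneg)
    finally have e1: "cmod (exp (- (\<i> * z * x))) \<le> 1" .
    have "cmod (exp (- (\<i> * z * x)) - 1 + \<i> * z * u) \<le> cmod (exp (- (\<i> * z * x)) - 1) + cmod (\<i> * z * u)"
      by (rule norm_triangle_ineq)
    also have "\<dots> \<le> (1 + 1) + cmod z * 1"
    proof (rule add_mono)
      show "cmod (exp (- (\<i> * z * x)) - 1) \<le> 1 + 1"
        by (rule order_trans[OF norm_triangle_ineq4]) (use e1 in simp)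
      show "cmod (\<i> * z * u) \<le> cmod z * 1"
        unfolding norm_mult using u0 by (simp add: mult_left_le)
    qed
    also have "\<dots> \<le> (2 + cmod z) * (4 * u\<^sup>2)"
      using mult_left_mono[OF u4, of "2 + cmod z"] by simp
    also have "\<dots> = (8 + 4 * cmod z) * u\<^sup>2" by (simp add: algebra_simps)
    also have "\<dots> \<le> C * u\<^sup>2" unfolding C_def using zC by (intro mult_right_mono) auto
    finally show ?thesis by (simp add: u_def C_def)
  qed
qed

text \<open>
  The error of \<open>exp_linearization\<close> is integrated against the law of the entries.  The linear term is the
  same quantity at the point \<open>- \<i>\<close>, where \<open>exp (- \<i> z x\<^sup>2)\<close> is \<open>exp (- x\<^sup>2)\<close>.
\<close>

lemma linear_exponent_if_saturated_moment_vanishes: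
  assumes lim: "has_limit_exponent \<nu> \<Phi>" and \<nu>: "\<And>n. n \<ge> 1 \<Longrightarrow> real_distribution (\<nu> n)"
    and null: "(\<lambda>n. real n * saturated_moment (\<nu> n)) \<longlonglongrightarrow> 0"
  shows "linear_exponent \<Phi>"
  unfolding linear_exponent_def
proof (intro exI ballI)
  have pw: "(\<lambda>n. of_nat n * (laplace_square (\<nu> n) z - 1)) \<longlonglongrightarrow> \<Phi> z" if "Im z \<le> 0" for z
  proof -
    have "compact {z} \<and> {z} \<subseteq> closed_lower_half_plane" using that by simp
    then have "uniform_limit {z} (\<lambda>n l. of_nat n * (laplace_square (\<nu> n) l - 1)) \<Phi> sequentially"
      using lim unfolding has_limit_exponent_def by blast
    then show ?thesis by simp
  qed
  fix z assume "z \<in> closed_lower_half_plane"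
  then have z: "Im z \<le> 0" by simp
  define C where "C = 8 + 4 * cmod z + 4 * exp (cmod z) * (cmod z)\<^sup>2"
  have "(\<lambda>n. of_nat n * (laplace_square (\<nu> n) z - 1) - \<i> * z * (of_nat n * (laplace_square (\<nu> n) (- \<i>) - 1)))
      \<longlonglongrightarrow> \<Phi> z - \<i> * z * \<Phi> (- \<i>)"
    by (intro tendsto_diff tendsto_mult tendsto_const pw z) simp
  moreover have "(\<lambda>n. of_nat n * (laplace_square (\<nu> n) z - 1) - \<i> * z * (of_nat n * (laplace_square (\<nu> n) (- \<i>) - 1)))
      \<longlonglongrightarrow> 0"
  proof (rule Lim_null_comparison)
    show "(\<lambda>n. C * (real n * saturated_moment (\<nu> n))) \<longlonglongrightarrow> 0"
      using tendsto_mult[OF tendsto_const null, of C] by simp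
    show "\<forall>\<^sub>F n in sequentially. norm (of_nat n * (laplace_square (\<nu> n) z - 1)
        - \<i> * z * (of_nat n * (laplace_square (\<nu> n) (- \<i>) - 1))) \<le> C * (real n * saturated_moment (\<nu> n))"
      using eventually_ge_at_top[of 1]
    proof eventually_elim
      case (elim n)
      interpret \<nu>n: real_distribution "\<nu> n" by (rule \<nu>[OF elim])
      have mb: "f \<in> borel_measurable (\<nu> n)" if "f \<in> borel_measurable borel" for f :: "real \<Rightarrow> 'z::topological_space"
        using that by (simp add: measurable_cong_sets[OF \<nu>n.events_eq_borel refl])
      have ei: "integrable (\<nu> n) (\<lambda>x. exp (- (\<i> * w * complex_of_real (x\<^sup>2))))" if "Im w \<le> 0" for w
      proof (rule \<nu>n.integrable_const_bound[of _ 1])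
        show "AE x in \<nu> n. norm (exp (- (\<i> * w * complex_of_real (x\<^sup>2)))) \<le> 1"
          using that by (intro AE_I2) (simp add: mult_nonpos_nonneg)
        show "(\<lambda>x. exp (- (\<i> * w * complex_of_real (x\<^sup>2)))) \<in> borel_measurable (\<nu> n)"
          by (intro mb borel_measurable_continuous_onI continuous_intros)
      qed
      define F where "F x = exp (- (\<i> * z * complex_of_real (x\<^sup>2))) - 1
          - \<i> * z * (exp (- (\<i> * (- \<i>) * complex_of_real (x\<^sup>2))) - 1)" for x
      have Fi: "integrable (\<nu> n) F"
        unfolding F_def[abs_def] using ei[OF z] ei[of "- \<i>"] by simp
      have "laplace_square (\<nu> n) z - 1 - \<i> * z * (laplace_square (\<nu> n) (- \<i>) - 1) = (LINT x|\<nu> n. F x)"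
        unfolding F_def laplace_square_def using ei[OF z] ei[of "- \<i>"] \<nu>n.prob_space by simp
      moreover have "cmod (LINT x|\<nu> n. F x) \<le> (LINT x|\<nu> n. C * (1 - exp (- x\<^sup>2))\<^sup>2)"
      proof (rule norm_integral_le[OF Fi])
        show "integrable (\<nu> n) (\<lambda>x. C * (1 - exp (- x\<^sup>2))\<^sup>2)"
        proof (intro integrable_mult_right \<nu>n.integrable_const_bound[of _ 1])
          have "\<bar>1 - exp (- x\<^sup>2)\<bar> \<le> 1" for x :: real by simp
          then show "AE x in \<nu> n. norm ((1 - exp (- x\<^sup>2))\<^sup>2) \<le> 1" by (simp add: abs_square_le_1)
          show "(\<lambda>x. (1 - exp (- x\<^sup>2))\<^sup>2) \<in> borel_measurable (\<nu> n)"
            by (intro mb borel_measurable_continuous_onI continuous_intros)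
        qed
        fix x :: real
        have "exp (- (\<i> * (- \<i>) * complex_of_real (x\<^sup>2))) = complex_of_real (exp (- x\<^sup>2))"
          by (simp add: exp_of_real flip: of_real_minus of_real_power)
        then have "F x = exp (- (\<i> * z * complex_of_real (x\<^sup>2))) - 1 + \<i> * z * (1 - complex_of_real (exp (- x\<^sup>2)))"
          by (simp add: F_def algebra_simps)
        then show "cmod (F x) \<le> C * (1 - exp (- x\<^sup>2))\<^sup>2"
          using exp_linearization[OF z, of "x\<^sup>2"] by (simp add: C_def)
      qed
      ultimately have h: "cmod (laplace_square (\<nu> n) z - 1 - \<i> * z * (laplace_square (\<nu> n) (- \<i>) - 1))
          \<le> C * saturated_moment (\<nu> n)"
        by (simp add: saturated_moment_def)
      have "of_nat n * (laplace_square (\<nu> n) z - 1) - \<i> * z * (of_nat n * (laplace_square (\<nu> n) (- \<i>) - 1))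
          = of_nat n * (laplace_square (\<nu> n) z - 1 - \<i> * z * (laplace_square (\<nu> n) (- \<i>) - 1))"
        by (simp add: algebra_simps)
      then show ?case
        using mult_left_mono[OF h, of "real n"] by (simp add: norm_mult mult_ac)
    qed
  qed
  ultimately have "\<Phi> z - \<i> * z * \<Phi> (- \<i>) = 0" by (rule LIMSEQ_unique)
  then show "\<Phi> z = \<i> * \<Phi> (- \<i>) * z" by (simp add: mult_ac)
qed

section \<open>The covariance of the limit process\<close>

text \<open>
  The functions \<open>1 / (1 + x\<^sup>2)\<close> and \<open>x / (1 + x\<^sup>2)\<close> are, up to sign, the imaginary and real parts of
  \<open>1 / (\<i> - x)\<close>; averaged against the spectral measure at a basis vector they give a diagonal entry of the resolvent.
\<close>

lemma resolvent_parts_bounds: 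
  fixes x y :: real
  shows "\<bar>1 / (1 + x\<^sup>2) - 1 / (1 + y\<^sup>2)\<bar> \<le> \<bar>x - y\<bar>" "\<bar>1 / (1 + x\<^sup>2)\<bar> * \<bar>x\<bar> \<le> 1" "\<bar>1 / (1 + x\<^sup>2)\<bar> \<le> 1"
    and "\<bar>x / (1 + x\<^sup>2) - y / (1 + y\<^sup>2)\<bar> \<le> \<bar>x - y\<bar>" "\<bar>x / (1 + x\<^sup>2)\<bar> * \<bar>x\<bar> \<le> 1" "\<bar>x / (1 + x\<^sup>2)\<bar> \<le> 1"
proof -
  have px: "0 < 1 + x\<^sup>2" and py: "0 < 1 + y\<^sup>2" by (simp_all add: add_pos_nonneg)
  define Q where "Q = (1 + x\<^sup>2) * (1 + y\<^sup>2)"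
  have Q0: "0 < Q" using px py by (simp add: Q_def)
  have half: "2 * \<bar>z\<bar> \<le> 1 + z\<^sup>2" for z :: real
    using zero_le_power2[of "\<bar>z\<bar> - 1"] by (simp add: power2_diff)
  have Qexp: "Q = 1 + x\<^sup>2 + y\<^sup>2 + x\<^sup>2 * y\<^sup>2" by (simp add: Q_def algebra_simps)
  have xy: "0 \<le> x\<^sup>2 * y\<^sup>2" by simp
  have quot: "\<bar>(x - y) * u / Q\<bar> \<le> \<bar>x - y\<bar>" if "\<bar>u\<bar> \<le> Q" for u
  proof -
    have "\<bar>(x - y) * u / Q\<bar> = \<bar>x - y\<bar> * (\<bar>u\<bar> / Q)" using Q0 by (simp add: abs_mult)
    also have "\<dots> \<le> \<bar>x - y\<bar> * 1" using that Q0 by (intro mult_left_mono) auto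
    finally show ?thesis by simp
  qed
  have "\<bar>- (x + y)\<bar> \<le> Q"
    using half[of x] half[of y] xy zero_le_power2[of x] zero_le_power2[of y] unfolding Qexp by linarith
  moreover have "1 / (1 + x\<^sup>2) - 1 / (1 + y\<^sup>2) = (x - y) * (- (x + y)) / Q"
    unfolding Q_def using px py by (simp add: divide_simps) (simp add: algebra_simps power2_eq_square)
  ultimately show "\<bar>1 / (1 + x\<^sup>2) - 1 / (1 + y\<^sup>2)\<bar> \<le> \<bar>x - y\<bar>" using quot by simp
  have "2 * \<bar>x * y\<bar> \<le> x\<^sup>2 + y\<^sup>2"
    using zero_le_power2[of "\<bar>x\<bar> - \<bar>y\<bar>"] by (simp add: power2_diff abs_mult)
  then have "\<bar>1 - x * y\<bar> \<le> Q"
    using xy zero_le_power2[of x] zero_le_power2[of y] unfolding Qexp by linarith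
  moreover have "x / (1 + x\<^sup>2) - y / (1 + y\<^sup>2) = (x - y) * (1 - x * y) / Q"
    unfolding Q_def using px py by (simp add: divide_simps) (simp add: algebra_simps power2_eq_square)
  ultimately show "\<bar>x / (1 + x\<^sup>2) - y / (1 + y\<^sup>2)\<bar> \<le> \<bar>x - y\<bar>" using quot by simp
  have x1: "\<bar>x\<bar> \<le> 1 + x\<^sup>2" using half[of x] zero_le_power2[of x] by linarith
  show "\<bar>1 / (1 + x\<^sup>2)\<bar> * \<bar>x\<bar> \<le> 1" "\<bar>1 / (1 + x\<^sup>2)\<bar> \<le> 1" "\<bar>x / (1 + x\<^sup>2)\<bar> \<le> 1"
    using x1 px by simp_all
  show "\<bar>x / (1 + x\<^sup>2)\<bar> * \<bar>x\<bar> \<le> 1"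
    using px by (simp add: abs_mult[symmetric] flip: power2_eq_square)
qed

text \<open>
  By the Schur complement formula \<open>X\<close> will be \<open>exp (- \<rho>)\<close> for the quadratic form \<open>\<rho>\<close> in the first row.  It is bounded, so
  convergence of \<open>p\<close> and \<open>q\<close> in the mean suffices, although the quotient is unbounded near the origin.
\<close>

lemma ratio_L1_convergence:
  fixes a b :: real and p q X :: "nat \<Rightarrow> 'w \<Rightarrow> real"
  assumes ab: "a\<^sup>2 + b\<^sup>2 \<noteq> 0"
    and M: "\<And>n. n \<ge> 1 \<Longrightarrow> prob_space (M n)"
    and p: "(\<lambda>n. LINT \<omega>|M n. \<bar>p n \<omega> - a\<bar>) \<longlonglongrightarrow> 0" "\<And>n. n \<ge> 1 \<Longrightarrow> integrable (M n) (p n)"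
    and q: "(\<lambda>n. LINT \<omega>|M n. \<bar>q n \<omega> - b\<bar>) \<longlonglongrightarrow> 0" "\<And>n. n \<ge> 1 \<Longrightarrow> integrable (M n) (q n)"
    and X: "\<forall>\<^sub>F n in sequentially. X n \<in> borel_measurable (M n) \<and> (\<forall>\<omega>\<in>space (M n).
       X n \<omega> = exp (1 - q n \<omega> / ((p n \<omega>)\<^sup>2 + (q n \<omega>)\<^sup>2)) \<and> X n \<omega> \<le> 1)"
  defines "k \<equiv> exp (1 - b / (a\<^sup>2 + b\<^sup>2))"
  shows "(\<lambda>n. LINT \<omega>|M n. \<bar>X n \<omega> - k\<bar>) \<longlonglongrightarrow> 0" and "k \<le> 1"
proof -
  define F where "F z = exp (1 - snd z / ((fst z)\<^sup>2 + (snd z)\<^sup>2))" for z :: "real \<times> real"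
  have "isCont F (a, b)"
    unfolding F_def using ab by (intro continuous_intros) auto
  have lim: "(\<lambda>n. LINT \<omega>|M n. \<bar>X n \<omega> - k\<bar>) \<longlonglongrightarrow> 0"
  proof (rule LIMSEQ_I)
    fix r :: real assume r: "0 < r"
    obtain d where d: "d > 0" "\<And>z. dist z (a, b) < d \<Longrightarrow> dist (F z) (F (a, b)) < r / 2"
      using \<open>isCont F (a, b)\<close> r unfolding continuous_at_eps_delta by (metis half_gt_zero)
    \<comment> \<open>Outside of the \<open>d\<close>-neighbourhood of \<open>(a, b)\<close> the trivial bound
      \<open>1 + k\<close> is at most \<open>K d\<close>.\<close>
    define K where "K = (1 + k) / (d / 2)"
    have k0: "0 < k" by (simp add: k_def)
    have "(\<lambda>n. r / 2 + K * ((LINT \<omega>|M n. \<bar>p n \<omega> - a\<bar>) + (LINT \<omega>|M n. \<bar>q n \<omega> - b\<bar>))) \<longlonglongrightarrow> r / 2 + K * (0 + 0)"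
      by (intro tendsto_add tendsto_mult tendsto_const p q)
    then have "\<forall>\<^sub>F n in sequentially. r / 2 + K * ((LINT \<omega>|M n. \<bar>p n \<omega> - a\<bar>) + (LINT \<omega>|M n. \<bar>q n \<omega> - b\<bar>)) < r"
      by (rule order_tendstoD) (use r in simp)
    then have "\<forall>\<^sub>F n in sequentially. norm ((LINT \<omega>|M n. \<bar>X n \<omega> - k\<bar>) - 0) < r"
      using X eventually_ge_at_top[of 1]
    proof eventually_elim
      case (elim n)
      interpret Mn: prob_space "M n" using M elim by simp
      have ip: "integrable (M n) (\<lambda>\<omega>. \<bar>p n \<omega> - a\<bar>)" and iq: "integrable (M n) (\<lambda>\<omega>. \<bar>q n \<omega> - b\<bar>)"
        using p(2)[OF elim(3)] q(2)[OF elim(3)] by simp_all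
      have b1: "\<bar>X n \<omega> - k\<bar> \<le> 1 + k" if "\<omega> \<in> space (M n)" for \<omega>
      proof -
        have "0 < X n \<omega>" "X n \<omega> \<le> 1" using elim(2) that by auto
        then show ?thesis using k0 by linarith
      qed
      have pt: "\<bar>X n \<omega> - k\<bar> \<le> r / 2 + K * (\<bar>p n \<omega> - a\<bar> + \<bar>q n \<omega> - b\<bar>)" if \<omega>: "\<omega> \<in> space (M n)" for \<omega>
      proof (cases "\<bar>p n \<omega> - a\<bar> + \<bar>q n \<omega> - b\<bar> < d")
        case True
        have "dist (p n \<omega>, q n \<omega>) (a, b) \<le> \<bar>p n \<omega> - a\<bar> + \<bar>q n \<omega> - b\<bar>"
          unfolding dist_Pair_Pair dist_real_def
          using sqrt_sum_squares_le_sum_abs[of "\<bar>p n \<omega> - a\<bar>" "\<bar>q n \<omega> - b\<bar>"] by simp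
        then have "dist (F (p n \<omega>, q n \<omega>)) (F (a, b)) < r / 2" using True by (intro d(2)) simp
        moreover have "F (p n \<omega>, q n \<omega>) = X n \<omega>" using elim(2) \<omega> by (simp add: F_def)
        moreover have "F (a, b) = k" by (simp add: F_def k_def)
        moreover have "0 \<le> K * (\<bar>p n \<omega> - a\<bar> + \<bar>q n \<omega> - b\<bar>)" using k0 d(1) by (simp add: K_def)
        ultimately show ?thesis unfolding dist_real_def by linarith
      next
        case False
        have "1 + k \<le> K * d" using d(1) k0 by (simp add: K_def)
        also have "\<dots> \<le> K * (\<bar>p n \<omega> - a\<bar> + \<bar>q n \<omega> - b\<bar>)"
          using False k0 d(1) by (intro mult_left_mono) (auto simp: K_def)
        finally show ?thesis using b1[OF \<omega>] r by linarith
      qed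
      have iX: "integrable (M n) (\<lambda>\<omega>. \<bar>X n \<omega> - k\<bar>)"
        by (rule Mn.integrable_const_bound[of _ "1 + k"]) (use b1 elim(2) in auto)
      have "(LINT \<omega>|M n. \<bar>X n \<omega> - k\<bar>) \<le> (LINT \<omega>|M n. r / 2 + K * (\<bar>p n \<omega> - a\<bar> + \<bar>q n \<omega> - b\<bar>))"
        by (rule integral_mono[OF iX _ pt]) (use ip iq in auto)
      also have "\<dots> = r / 2 + K * ((LINT \<omega>|M n. \<bar>p n \<omega> - a\<bar>) + (LINT \<omega>|M n. \<bar>q n \<omega> - b\<bar>))"
        using ip iq by (simp add: Mn.prob_space)
      finally show ?case using elim(1) by simp
    qed
    then show "\<exists>no. \<forall>n\<ge>no. norm ((LINT \<omega>|M n. \<bar>X n \<omega> - k\<bar>) - 0) < r"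
      by (simp add: eventually_sequentially)
  qed
  then show "(\<lambda>n. LINT \<omega>|M n. \<bar>X n \<omega> - k\<bar>) \<longlonglongrightarrow> 0" .
  show "k \<le> 1"
  proof (rule ccontr)
    assume "\<not> k \<le> 1"
    then have "\<forall>\<^sub>F n in sequentially. (LINT \<omega>|M n. \<bar>X n \<omega> - k\<bar>) < k - 1"
      by (intro order_tendstoD(2)[OF lim]) simp
    then have "\<forall>\<^sub>F n in sequentially. False"
      using X eventually_ge_at_top[of 1]
    proof eventually_elim
      case (elim n)
      interpret Mn: prob_space "M n" using M elim by simp
      have "k - 1 = (LINT \<omega>|M n. k - 1)" by (simp add: Mn.prob_space)
      also have "\<dots> \<le> (LINT \<omega>|M n. \<bar>X n \<omega> - k\<bar>)"
      proof (rule integral_mono)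
        have "\<bar>X n \<omega> - k\<bar> \<le> 1 + k" if "\<omega> \<in> space (M n)" for \<omega>
        proof -
          have "0 < X n \<omega>" "X n \<omega> \<le> 1" "0 < k" using elim(2) that by (auto simp: k_def)
          then show ?thesis by linarith
        qed
        then show "integrable (M n) (\<lambda>\<omega>. \<bar>X n \<omega> - k\<bar>)"
          by (intro Mn.integrable_const_bound[of _ "1 + k"]) (use elim(2) in auto)
        show "k - 1 \<le> \<bar>X n \<omega> - k\<bar>" if "\<omega> \<in> space (M n)" for \<omega>
        proof -
          have "X n \<omega> \<le> 1" using elim(2) that by blast
          then show ?thesis by linarith
        qed
      qed simp
      finally show ?case using elim(1) by simp
    qed
    then show False by simp
  qed
qed

text \<open>
  Assembles the three steps: the vanishing of \<open>B\<close> makes the spectral measure at the first basis vector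
  deterministic, hence the quadratic form in the first row, hence the saturated moment is \<open>o(1 / n)\<close>.
\<close>

lemma null_variance_imp_linear:
  fixes s :: real
  assumes entries: "entry_hypothesis \<nu> \<Phi>"
    and matrices: "\<And>n. n \<ge> 1 \<Longrightarrow> iid_symmetric_matrix (M n) n (\<nu> n) (A n)"
    and eigen: "\<And>n \<omega>. n \<ge> 1 \<Longrightarrow> \<omega> \<in> space (M n) \<Longrightarrow>
                  ordered_eigendecomposition n (A n \<omega>) (U n \<omega>) (l n \<omega>)"
    and exchangeable: "\<And>n. n \<ge> 1 \<Longrightarrow> abs_rows_exchangeable (M n) n (U n)"
    and \<mu>: "real_distribution \<mu>" and spectral: "spectral_law_converges M l \<mu>"
    and limits: "limit_processes M U l \<mu> N B C"
    and s: "0 < s" "s < 1"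
    and null: "\<And>t. t \<in> spectral_levels \<mu> \<Longrightarrow> AE \<omega> in N. B \<omega> (s, t) = 0"
  shows "linear_exponent \<Phi>"
proof -
  have \<nu>: "\<And>n. n \<ge> 1 \<Longrightarrow> real_distribution (\<nu> n)" and lim: "has_limit_exponent \<nu> \<Phi>"
    using entries by (auto simp: entry_hypothesis_def)
  have prob: "prob_space (M n)" if "n \<ge> 1" for n
    using matrices[OF that] by (simp add: iid_symmetric_matrix_def)
  have basis: "random_eigenbasis (M n) n (A n) (U n) (l n)" if "n \<ge> 1" for n
  proof -
    interpret prob_space "M n" by (rule prob[OF that])
    show ?thesis
      by unfold_locales
        (use that iid_symmetric_matrix_measurable[OF matrices[OF that]] eigen exchangeable in auto)
  qed
  interpret \<mu>: real_distribution \<mu> by (rule \<mu>)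
  interpret S: eigenbasis_sequence \<mu> M A U l
    by (intro eigenbasis_sequence.intro \<mu> eigenbasis_sequence_axioms.intro basis spectral)
  have dev0: "(\<lambda>n. LINT \<omega>|M n. (S.dev n (\<lambda>j. real (Suc j) \<le> real n * t) \<omega> 0)\<^sup>2) \<longlonglongrightarrow> 0"
    if t: "t \<in> spectral_levels \<mu>" for t
  proof (rule row_deviation_vanishes[OF basis s])
    show "(\<lambda>n. LINT \<omega>|M n. min 1 \<bar>process_B n (U n \<omega>) (s, t)\<bar>) \<longlonglongrightarrow> 0"
      by (rule process_B_null[OF limits \<mu> _ prob s t null[OF t]])
        (use exchangeable in \<open>auto simp: abs_rows_exchangeable_def\<close>)
  qed
  define fq where "fq = (\<lambda>x::real. 1 / (1 + x\<^sup>2))"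
  define fp where "fp = (\<lambda>x::real. x / (1 + x\<^sup>2))"
  define b where "b = (LINT x|\<mu>. fq x)"
  define a where "a = (LINT x|\<mu>. fp x)"
  have q: "(\<lambda>n. LINT \<omega>|M n. \<bar>S.row_average n fq \<omega> - b\<bar>) \<longlonglongrightarrow> 0"
    unfolding b_def by (rule S.row_average_L1) (use resolvent_parts_bounds dev0 in \<open>auto simp: fq_def\<close>)
  have p: "(\<lambda>n. LINT \<omega>|M n. \<bar>S.row_average n fp \<omega> - a\<bar>) \<longlonglongrightarrow> 0"
    unfolding a_def by (rule S.row_average_L1) (use resolvent_parts_bounds dev0 in \<open>auto simp: fp_def\<close>)
  have pos1: "0 < 1 + x\<^sup>2" for x :: real by (simp add: add_pos_nonneg)
  have cont: "continuous_on UNIV fq" "continuous_on UNIV fp"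
    unfolding fq_def fp_def using pos1 by (auto intro!: continuous_intros simp: less_imp_neq[symmetric])
  have int: "integrable (M n) (S.row_average n f)" if "n \<ge> 1" "continuous_on UNIV f" "\<And>y. \<bar>f y\<bar> \<le> 1" for n f
  proof -
    interpret E: random_eigenbasis "M n" n "A n" "U n" "l n" by (rule basis[OF that(1)])
    show ?thesis
      by (rule E.integrable_const_bound[of _ 1])
        (use E.average_measurable(2)[OF borel_measurable_continuous_onI[OF that(2)]]
          E.average_bounds(2)[of f, OF that(3)] in auto)
  qed
  have "b \<noteq> 0"
  proof
    assume "b = 0"
    have fqm: "fq \<in> borel_measurable \<mu>"
      unfolding measurable_cong_sets[OF \<mu>.events_eq_borel refl]
      by (rule borel_measurable_continuous_onI[OF cont(1)])
    have fqi: "integrable \<mu> fq"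
      by (rule \<mu>.integrable_const_bound[of _ 1])
        (use fqm resolvent_parts_bounds(3) in \<open>auto simp: fq_def\<close>)
    have "AE x in \<mu>. fq x = 0"
      using integral_nonneg_eq_0_iff_AE[OF fqi] \<open>b = 0\<close> pos1 by (simp add: b_def fq_def less_imp_le)
    moreover have "fq x \<noteq> 0" for x using pos1[of x] by (simp add: fq_def)
    ultimately have "AE x in \<mu>. False" by simp
    then show False using \<mu>.AE_False by simp
  qed
  then have ab: "a\<^sup>2 + b\<^sup>2 \<noteq> 0" by (simp add: add_nonneg_eq_0_iff)
  define Q where "Q n \<omega> = quad_form (row_idx (n - 1)) (row_res (n - 1) (\<lambda>p. A n \<omega> $$ p)) (\<lambda>p. A n \<omega> $$ p)" for n \<omega>
  define k where "k = exp (1 - b / (a\<^sup>2 + b\<^sup>2))"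
  have X: "\<forall>\<^sub>F n in sequentially. (\<lambda>\<omega>. exp (- Q n \<omega>)) \<in> borel_measurable (M n) \<and> (\<forall>\<omega>\<in>space (M n).
       exp (- Q n \<omega>) = exp (1 - S.row_average n fq \<omega> / ((S.row_average n fp \<omega>)\<^sup>2 + (S.row_average n fq \<omega>)\<^sup>2))
       \<and> exp (- Q n \<omega>) \<le> 1)"
    using eventually_ge_at_top[of 1]
  proof eventually_elim
    case (elim n)
    interpret E: random_eigenbasis "M n" n "A n" "U n" "l n" by (rule basis[OF elim])
    obtain N' where N': "n = Suc N'" using elim by (cases n) auto
    have "Q n \<in> borel_measurable (M n)"
      unfolding Q_def[abs_def]
    proof (rule quad_form_row_res_measurable)
      show "(\<lambda>\<omega>. A n \<omega> $$ p) \<in> borel_measurable (M n)" if "p \<in> row_idx (n - 1)" for p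
        using that N' E.A_measurable[of "fst p" "snd p"] by (auto simp: row_idx_def)
      show "(\<lambda>\<omega>. A n \<omega> $$ p) \<in> borel_measurable (M n)" if "p \<in> minor_idx (n - 1)" for p
        using that N' E.A_measurable[of "fst p" "snd p"] by (auto simp: minor_idx_def)
    qed
    then have "(\<lambda>\<omega>. exp (- Q n \<omega>)) \<in> borel_measurable (M n)" by measurable
    moreover have "exp (- Q n \<omega>) = exp (1 - S.row_average n fq \<omega> / ((S.row_average n fp \<omega>)\<^sup>2 + (S.row_average n fq \<omega>)\<^sup>2))"
      if \<omega>: "\<omega> \<in> space (M n)" for \<omega>
    proof -
      have A: "A n \<omega> \<in> carrier_mat (Suc N') (Suc N')" "transpose_mat (A n \<omega>) = A n \<omega>"
        using matrices[OF elim] \<omega> N' by (auto simp: iid_symmetric_matrix_def)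
      have e: "ordered_eigendecomposition (Suc N') (A n \<omega>) (U n \<omega>) (l n \<omega>)"
        using eigen[OF elim \<omega>] N' by simp
      have "Q n \<omega> = S.row_average n fq \<omega> / ((S.row_average n fp \<omega>)\<^sup>2 + (S.row_average n fq \<omega>)\<^sup>2) - 1"
        using quad_form_eigendecomposition[OF e A]
        unfolding Q_def E.row_average_def unfolding fq_def fp_def N' diff_Suc_1 .
      then show ?thesis by simp
    qed
    moreover have "exp (- Q n \<omega>) \<le> 1" for \<omega>
      unfolding Q_def using quad_form_row_res_nonneg by simp
    ultimately show ?case by blast
  qed
  have ip: "integrable (M n) (S.row_average n fp)" and iq: "integrable (M n) (S.row_average n fq)" if "n \<ge> 1" for n
    using int[OF that cont(2)] int[OF that cont(1)] resolvent_parts_bounds by (auto simp: fp_def fq_def)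
  note R = ratio_L1_convergence[of a b M "\<lambda>n. S.row_average n fp" "\<lambda>n. S.row_average n fq"
      "\<lambda>n \<omega>. exp (- Q n \<omega>)", OF ab prob p ip q iq X, folded k_def]
  have sat: "(\<lambda>n. real n * saturated_moment (\<nu> n)) \<longlonglongrightarrow> 0"
    by (rule saturated_moment_vanishes[OF entries matrices _ R(2)]) (use R(1) in \<open>simp_all add: k_def Q_def\<close>)
  show ?thesis
    by (rule linear_exponent_if_saturated_moment_vanishes[OF lim]) (use \<nu> sat in simp_all)
qed

theorem proposition2p7:
  fixes M :: "nat \<Rightarrow> 'w measure"
    and \<nu> :: "nat \<Rightarrow> real measure"
    and A U :: "nat \<Rightarrow> 'w \<Rightarrow> real mat"
    and l :: "nat \<Rightarrow> 'w \<Rightarrow> nat \<Rightarrow> real"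
    and \<Phi> :: "complex \<Rightarrow> complex"
    and \<mu> :: "real measure"
    and N :: "'v measure"
    and B C :: "'v \<Rightarrow> real \<times> real \<Rightarrow> real"
    and s :: real
  assumes entries: "entry_hypothesis \<nu> \<Phi>"
    and matrices: "\<And>n. n \<ge> 1 \<Longrightarrow> iid_symmetric_matrix (M n) n (\<nu> n) (A n)"
    and eigen: "\<And>n \<omega>. n \<ge> 1 \<Longrightarrow> \<omega> \<in> space (M n) \<Longrightarrow>
                  ordered_eigendecomposition n (A n \<omega>) (U n \<omega>) (l n \<omega>)"
    and exchangeable: "\<And>n. n \<ge> 1 \<Longrightarrow> abs_rows_exchangeable (M n) n (U n)"
    and spectral_law: "real_distribution \<mu>" "spectral_law_converges M l \<mu>"
    and limits: "limit_processes M U l \<mu> N B C"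
    and nonlinear: "\<not> linear_exponent \<Phi>"
    and s: "0 < s" "s < 1"
  shows "(\<exists>t\<in>spectral_levels \<mu>. \<exists>t'\<in>spectral_levels \<mu>.
            covariance N (\<lambda>\<omega>. B \<omega> (s, t)) (\<lambda>\<omega>. B \<omega> (s, t')) \<noteq> 0) \<and>
         (\<exists>x x'. covariance N (\<lambda>\<omega>. C \<omega> (s, x)) (\<lambda>\<omega>. C \<omega> (s, x')) \<noteq> 0)"
proof (rule ccontr)
  assume neg: "\<not> ?thesis"
  have N: "prob_space N"
    and GB: "centered_gaussian_process N ({0..1} \<times> spectral_levels \<mu>) B"
    and GC: "centered_gaussian_process N ({0..1} \<times> UNIV) C"
    and bd: "AE \<omega> in N. \<forall>s\<in>{0..1}. B \<omega> (s, 0) = 0 \<and> B \<omega> (s, 1) = 0"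
    and BC: "AE \<omega> in N. \<forall>s\<in>{0..1}. \<forall>x. B \<omega> (s, cdf \<mu> x) = C \<omega> (s, x)"
    using limits by (simp_all add: limit_processes_def Let_def)
  have s01: "s \<in> {0..1}" using s by simp
  have null: "AE \<omega> in N. B \<omega> (s, t) = 0" if t: "t \<in> spectral_levels \<mu>" for t
  proof (cases "\<exists>t\<in>spectral_levels \<mu>. \<exists>t'\<in>spectral_levels \<mu>.
            covariance N (\<lambda>\<omega>. B \<omega> (s, t)) (\<lambda>\<omega>. B \<omega> (s, t')) \<noteq> 0")
    case False
    then have "covariance N (\<lambda>\<omega>. B \<omega> (s, t)) (\<lambda>\<omega>. B \<omega> (s, t)) = 0" using t by blast
    then show ?thesis
      by (intro null_covariance_imp_null[OF GB _ N]) (use t s01 in auto)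
  next
    case True
    then have "covariance N (\<lambda>\<omega>. C \<omega> (s, x)) (\<lambda>\<omega>. C \<omega> (s, x)) = 0" for x using neg by blast
    then have C0: "AE \<omega> in N. C \<omega> (s, x) = 0" for x
      by (intro null_covariance_imp_null[OF GC _ N]) (use s01 in auto)
    consider "t = 0 \<or> t = 1" | x where "t = cdf \<mu> x" using t by (auto simp: spectral_levels_def)
    then show ?thesis
    proof cases
      case 1
      show ?thesis using bd by eventually_elim (use 1 s01 in auto)
    next
      case 2
      show ?thesis using BC C0[of x] by eventually_elim (use 2 s01 in auto)
    qed
  qed
  have "linear_exponent \<Phi>"
    by (rule null_variance_imp_linear[of \<nu> \<Phi> M A U l \<mu> N B C s,
          OF entries matrices eigen exchangeable spectral_law limits s null])
  with nonlinear show False ..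
qed

end
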